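(* Let $A$ be a free Perm algebra, i.e. $A\cong\mathrm{Perm}\langle X\rangle$ for some set $X$, let $B$ be a pre-associative (dendriform) algebra, and let $N$ be a $B$-bimodule. Given the canonical embedding of cochain complexes $$\Psi: C^*_{\mathrm{dend}}(B,N)\hookrightarrow C^*_{\mathrm{Hoch}}(A\otimes B,A\otimes N)$$ (the map $\Psi$ defined in the context), we obtain a short exact sequence of complexes $$0\to C^*_{\mathrm{dend}}(B,N)\hookrightarrow C^*_{\mathrm{Hoch}}(A\otimes B,A\otimes N)\to Q^*\to 0,$$ where $Q^*=C^*_{\mathrm{Hoch}}(A\otimes B,A\otimes N)/C^*_{\mathrm{dend}}(B,N)$ is the quotient complex. Applying the cohomology functor yields the long exact sequence $$\begin{aligned}\cdots\to H^{n-1}_{\mathrm{dend}}(B,N)&\to HH^{n-1}(A\otimes B,A\otimes N)\to H^{n-1}(Q^* )\\&\to H^n_{\mathrm{dend}}(B,N)\to HH^n(A\otimes B,A\otimes N)\to H^n(Q^* )\\&\to H^{n+1}_{\mathrm{dend}}(B,N)\to HH^{n+1}(A\otimes B,A\otimes N)\to\cdots\end{aligned}$$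
   Context: All algebras are over a field $\Bbbk$, not necessarily unital; $\otimes=\otimes_\Bbbk$. Perm algebra: an algebra with $(ab)c=a(bc)=a(cb)$ for all $a,b,c$. Free Perm algebra on a set $X=\{x_1,x_2,\dots\}$: let $F\langle X\rangle$ be the free non-unital associative algebra on $X$ and $I$ the two-sided ideal generated by all $x(yz)-x(zy)$, $x,y,z\in F\langle X\rangle$; then $\mathrm{Perm}\langle X\rangle:=F\langle X\rangle/I$. Pre-associative (dendriform) algebra: a vector space $B$ with bilinear operations $\prec,\succ$ such that for all $x,y,z\in B$: $(x\prec y)\prec z=x\prec(y\prec z+y\succ z)$, $\ (x\succ y)\prec z=x\succ(y\prec z)$, $\ x\succ(y\succ z)=(x\prec y+x\succ y)\succ z$. Write $x*y:=x\prec y+x\succ y$. Representation ($B$-bimodule) of $B$: a vector space $N$ with bilinear maps $\prec,\succ:B\otimes N\to N$ and $\prec,\succ:N\otimes B\to N$ such that the three identities above hold whenever exactly one of $x,y,z$ lies in $N$ and the other two lie in $B$. $A\otimes B$ is the associative algebra with product $(a_1\otimes b_1)(a_2\otimes b_2)=a_1a_2\otimes(b_1\prec b_2)+a_2a_1\otimes(b_1\succ b_2)$. $A\otimes N$ is the $A\otimes B$-bimodule with $(a\otimes n)\cdot(a'\otimes b)=aa'\otimes(n\prec b)+a'a\otimes(n\succ b)$ and $(a'\otimes b)\cdot(a\otimes n)=a'a\otimes(b\prec n)+aa'\otimes(b\succ n)$. Pre-associative cochain complex: for $n\ge1$, $C_n=\{1,\dots,n\}$ and $C^n_{\mathrm{dend}}(B,N)=\mathrm{Hom}_\Bbbk(\Bbbk[C_n]\otimes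 B^{\otimes n},N)$, i.e. an $n$-cochain $f$ is a family of $n$ multilinear maps $f(r,-,\dots,-):B^{\otimes n}\to N$, $r=1,\dots,n$; $C^n_{\mathrm{dend}}(B,N)=0$ for $n\le 0$. The differential $\delta_{\mathrm{dend}}:C^n_{\mathrm{dend}}(B,N)\to C^{n+1}_{\mathrm{dend}}(B,N)$ is: for $r=1$: $(\delta_{\mathrm{dend}}f)(1,b_1,\dots,b_{n+1})=\sum_{i=1}^n b_1\prec f(i,b_2,\dots,b_{n+1})-f(1,b_1\prec b_2,b_3,\dots,b_{n+1})+\sum_{i=2}^n(-1)^i f(1,b_1,\dots,b_i*b_{i+1},\dots,b_{n+1})+(-1)^{n+1}f(1,b_1,\dots,b_n)\prec b_{n+1}$; for $2\le r\le n$: $(\delta_{\mathrm{dend}}f)(r,b_1,\dots,b_{n+1})=b_1\succ f(r-1,b_2,\dots,b_{n+1})+\sum_{i=1}^{r-2}(-1)^i f(r-1,b_1,\dots,b_i*b_{i+1},\dots,b_{n+1})+(-1)^{r-1}f(r-1,b_1,\dots,b_{r-1}\succ b_r,\dots,b_{n+1})+(-1)^r f(r,b_1,\dots,b_r\prec b_{r+1},\dots,b_{n+1})+\sum_{i=r+1}^n(-1)^i f(r,b_1,\dots,b_i*b_{i+1},\dots,b_{n+1})+(-1)^{n+1}f(r,b_1,\dots,b_n)\prec b_{n+1}$; for $r=n+1$: $(\delta_{\mathrm{dend}}f)(n+1,b_1,\dots,b_{n+1})=b_1\succ f(n,b_2,\dots,b_{n+1})+\sum_{i=1}^{n-1}(-1)^i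 f(n,b_1,\dots,b_i*b_{i+1},\dots,b_{n+1})+(-1)^n f(n,b_1,\dots,b_{n-1},b_n\succ b_{n+1})+(-1)^{n+1}\sum_{i=1}^n f(i,b_1,\dots,b_n)\succ b_{n+1}$. $H^*_{\mathrm{dend}}(B,N)$ is the cohomology of this complex. Hochschild complex: $C^n_{\mathrm{Hoch}}(R,M)=\mathrm{Hom}_\Bbbk(R^{\otimes n},M)$ for an associative algebra $R$ and $R$-bimodule $M$, with the usual Hochschild differential; its cohomology is $HH^*(R,M)$. The map $\Psi$: for $n\ge1$, $f\in C^n_{\mathrm{dend}}(B,N)$, $a_i\in A$, $b_i\in B$, $$\Psi(f)(a_1\otimes b_1,\dots,a_n\otimes b_n)=\sum_{r=1}^{n} (a_r a_{r-1}\cdots a_1\, a_{r+1}a_{r+2}\cdots a_n)\otimes f(r,b_1,\dots,b_n).$$ The quotient $Q^*$ is taken by the image of $\Psi$.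
   Formalization: The set X is assumed to have at least two elements: for |X| = 1 the algebra A is commutative and Ψ kills degree-2 cochains with f(1,-,-) = -f(2,-,-), and for empty X we have A = 0, so Ψ is not an embedding unless B = 0 or N = 0. *)

theory Defs
  imports "HOL-Algebra.Module" "HOL-Algebra.QuotRing" "HOL.Hull"
begin

text \<open>
  Everything is a \<open>\<Bbbk>\<close>-vector space given as a HOL-Algebra \<^type>\<open>module\<close> record over
  a field record \<open>K\<close>.  The fields \<^const>\<open>mult\<close> and \<^const>\<open>one\<close> of such a record are not
  constrained by the locale \<^locale>\<open>module\<close>; \<^const>\<open>mult\<close> is used as the product of a
  not necessarily unital algebra, \<^const>\<open>one\<close> is never used, and both are irrelevant for a
  plain vector space.
\<close>

section \<open>Linear algebra\<close>

definition lin_maps ::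
  "'k ring \<Rightarrow> ('k, 'u, 'c) module_scheme \<Rightarrow> ('k, 'v, 'd) module_scheme \<Rightarrow> ('u \<Rightarrow> 'v) set"
  where "lin_maps K U V =
    {h \<in> hom (add_monoid U) (add_monoid V).
      \<forall>c\<in>carrier K. \<forall>x\<in>carrier U. h (c \<odot>\<^bsub>U\<^esub> x) = c \<odot>\<^bsub>V\<^esub> h x}"

definition bilinear_op ::
  "'k ring \<Rightarrow> ('k, 'u, 'c) module_scheme \<Rightarrow> ('k, 'v, 'd) module_scheme \<Rightarrow>
    ('k, 'w, 'e) module_scheme \<Rightarrow> ('u \<Rightarrow> 'v \<Rightarrow> 'w) \<Rightarrow> bool"
  where "bilinear_op K U V W m \<longleftrightarrow>
    (\<forall>u\<in>carrier U. m u \<in> lin_maps K V W) \<and>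
    (\<forall>v\<in>carrier V. (\<lambda>u. m u v) \<in> lin_maps K U W)"

definition tuples :: "('k, 'u, 'c) module_scheme \<Rightarrow> nat \<Rightarrow> 'u list set"
  where "tuples U n = {xs. length xs = n \<and> set xs \<subseteq> carrier U}"

definition multilinear ::
  "'k ring \<Rightarrow> ('k, 'u, 'c) module_scheme \<Rightarrow> ('k, 'v, 'd) module_scheme \<Rightarrow> nat \<Rightarrow>
    ('u list \<Rightarrow> 'v) \<Rightarrow> bool"
  where "multilinear K U V n F \<longleftrightarrow>
    (\<forall>xs\<in>tuples U n. F xs \<in> carrier V \<and>
      (\<forall>i<n. (\<lambda>x. F (xs[i := x])) \<in> lin_maps K U V))"

text \<open>The quotient \<open>M/W\<close>; its elements are the cosets of \<open>W\<close>, as in \<^const>\<open>FactRing\<close>.\<close>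

definition quot_module :: "('k, 'v, 'c) module_scheme \<Rightarrow> 'v set \<Rightarrow> ('k, 'v set) module"
  where "quot_module M W =
    \<lparr>carrier = a_rcosets\<^bsub>M\<^esub> W, mult = rcoset_mult M W, one = W +>\<^bsub>M\<^esub> \<one>\<^bsub>M\<^esub>,
     zero = W, add = set_add M, smult = (\<lambda>c S. \<Union>x\<in>S. W +>\<^bsub>M\<^esub> (c \<odot>\<^bsub>M\<^esub> x))\<rparr>"

definition pointwise :: "('k, 'v, 'c) module_scheme \<Rightarrow> ('s \<Rightarrow> 'v) set \<Rightarrow> ('k, 's \<Rightarrow> 'v) module"
  where "pointwise M F =
    \<lparr>carrier = F, mult = undefined, one = undefined, zero = (\<lambda>_. \<zero>\<^bsub>M\<^esub>),
     add = (\<lambda>f g s. f s \<oplus>\<^bsub>M\<^esub> g s), smult = (\<lambda>c f s. c \<odot>\<^bsub>M\<^esub> f s)\<rparr>"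

text \<open>The vector space with basis \<open>S\<close>: finitely supported functions on \<open>S\<close>, extended by zero.\<close>

definition free_module :: "'k ring \<Rightarrow> 's set \<Rightarrow> ('k, 's \<Rightarrow> 'k) module"
  where "free_module K S =
    \<lparr>carrier = {p. (\<forall>s. p s \<in> carrier K) \<and> {s. p s \<noteq> \<zero>\<^bsub>K\<^esub>} \<subseteq> S \<and> finite {s. p s \<noteq> \<zero>\<^bsub>K\<^esub>}},
     mult = undefined, one = undefined, zero = (\<lambda>_. \<zero>\<^bsub>K\<^esub>),
     add = (\<lambda>p q s. p s \<oplus>\<^bsub>K\<^esub> q s), smult = (\<lambda>c p s. c \<otimes>\<^bsub>K\<^esub> p s)\<rparr>"

definition single :: "'k ring \<Rightarrow> 's \<Rightarrow> 's \<Rightarrow> 'k"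
  where "single K s = (\<lambda>t. if t = s then \<one>\<^bsub>K\<^esub> else \<zero>\<^bsub>K\<^esub>)"


section \<open>Tensor products\<close>

text \<open>\<open>U \<otimes> V\<close> is the vector space with basis \<open>U \<times> V\<close> modulo the bilinearity relations.\<close>

definition tensor_relations ::
  "'k ring \<Rightarrow> ('k, 'u, 'c) module_scheme \<Rightarrow> ('k, 'v, 'd) module_scheme \<Rightarrow> ('u \<times> 'v \<Rightarrow> 'k) set"
  where "tensor_relations K U V =
    (let F = free_module K (carrier U \<times> carrier V); e = (\<lambda>u v. single K (u, v)) in
     (\<lambda>W. submodule W K F) hull
      ({e (u \<oplus>\<^bsub>U\<^esub> u') v \<ominus>\<^bsub>F\<^esub> (e u v \<oplus>\<^bsub>F\<^esub> e u' v) |u u' v.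
          u \<in> carrier U \<and> u' \<in> carrier U \<and> v \<in> carrier V} \<union>
       {e u (v \<oplus>\<^bsub>V\<^esub> v') \<ominus>\<^bsub>F\<^esub> (e u v \<oplus>\<^bsub>F\<^esub> e u v') |u v v'.
          u \<in> carrier U \<and> v \<in> carrier V \<and> v' \<in> carrier V} \<union>
       {e (c \<odot>\<^bsub>U\<^esub> u) v \<ominus>\<^bsub>F\<^esub> c \<odot>\<^bsub>F\<^esub> e u v |c u v.
          c \<in> carrier K \<and> u \<in> carrier U \<and> v \<in> carrier V} \<union>
       {e u (c \<odot>\<^bsub>V\<^esub> v) \<ominus>\<^bsub>F\<^esub> c \<odot>\<^bsub>F\<^esub> e u v |c u v.
          c \<in> carrier K \<and> u \<in> carrier U \<and> v \<in> carrier V}))"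

definition tensor ::
  "'k ring \<Rightarrow> ('k, 'u, 'c) module_scheme \<Rightarrow> ('k, 'v, 'd) module_scheme \<Rightarrow>
    ('k, ('u \<times> 'v \<Rightarrow> 'k) set) module"
  where "tensor K U V =
    quot_module (free_module K (carrier U \<times> carrier V)) (tensor_relations K U V)"

definition pure_tensor ::
  "'k ring \<Rightarrow> ('k, 'u, 'c) module_scheme \<Rightarrow> ('k, 'v, 'd) module_scheme \<Rightarrow>
    'u \<Rightarrow> 'v \<Rightarrow> ('u \<times> 'v \<Rightarrow> 'k) set"
  where "pure_tensor K U V u v =
    tensor_relations K U V +>\<^bsub>free_module K (carrier U \<times> carrier V)\<^esub> single K (u, v)"


section \<open>Perm algebras\<close>

definition algebra_over :: "'k ring \<Rightarrow> ('k, 'a, 'c) module_scheme \<Rightarrow> bool"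
  where "algebra_over K A \<longleftrightarrow> module K A \<and> bilinear_op K A A A (mult A)"

definition perm_algebra :: "'k ring \<Rightarrow> ('k, 'a, 'c) module_scheme \<Rightarrow> bool"
  where "perm_algebra K A \<longleftrightarrow> algebra_over K A \<and>
    (\<forall>a\<in>carrier A. \<forall>b\<in>carrier A. \<forall>c\<in>carrier A.
      (a \<otimes>\<^bsub>A\<^esub> b) \<otimes>\<^bsub>A\<^esub> c = a \<otimes>\<^bsub>A\<^esub> (b \<otimes>\<^bsub>A\<^esub> c) \<and>
      a \<otimes>\<^bsub>A\<^esub> (b \<otimes>\<^bsub>A\<^esub> c) = a \<otimes>\<^bsub>A\<^esub> (c \<otimes>\<^bsub>A\<^esub> b))"

text \<open>
  The free non-unital associative algebra on \<open>X\<close>: the basis consists of the nonempty words in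
  \<open>X\<close>, and the product extends concatenation, so that the coefficient of a product at a word
  is a sum over all ways to cut the word in two.
\<close>

definition free_assoc :: "'k ring \<Rightarrow> 'x set \<Rightarrow> ('k, 'x list \<Rightarrow> 'k) module"
  where "free_assoc K X = (free_module K (lists X - {[]}))
    \<lparr>mult := (\<lambda>p q w. \<Oplus>\<^bsub>K\<^esub>i\<in>{..length w}. p (take i w) \<otimes>\<^bsub>K\<^esub> q (drop i w))\<rparr>"

definition two_sided_ideal :: "'k ring \<Rightarrow> ('k, 'a, 'c) module_scheme \<Rightarrow> 'a set \<Rightarrow> bool"
  where "two_sided_ideal K A J \<longleftrightarrow> submodule J K A \<and>
    (\<forall>a\<in>carrier A. \<forall>j\<in>J. a \<otimes>\<^bsub>A\<^esub> j \<in> J \<and> j \<otimes>\<^bsub>A\<^esub> a \<in> J)"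

definition perm_ideal :: "'k ring \<Rightarrow> 'x set \<Rightarrow> ('x list \<Rightarrow> 'k) set"
  where "perm_ideal K X = (let F = free_assoc K X in
    two_sided_ideal K F hull
      {x \<otimes>\<^bsub>F\<^esub> (y \<otimes>\<^bsub>F\<^esub> z) \<ominus>\<^bsub>F\<^esub> x \<otimes>\<^bsub>F\<^esub> (z \<otimes>\<^bsub>F\<^esub> y) |x y z.
        x \<in> carrier F \<and> y \<in> carrier F \<and> z \<in> carrier F})"

definition Perm :: "'k ring \<Rightarrow> 'x set \<Rightarrow> ('k, ('x list \<Rightarrow> 'k) set) module"
  where "Perm K X = quot_module (free_assoc K X) (perm_ideal K X)"

definition algebra_isos ::
  "'k ring \<Rightarrow> ('k, 'a, 'c) module_scheme \<Rightarrow> ('k, 'b, 'd) module_scheme \<Rightarrow> ('a \<Rightarrow> 'b) set"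
  where "algebra_isos K A B =
    {h \<in> lin_maps K A B. bij_betw h (carrier A) (carrier B) \<and>
      (\<forall>x\<in>carrier A. \<forall>y\<in>carrier A. h (x \<otimes>\<^bsub>A\<^esub> y) = h x \<otimes>\<^bsub>B\<^esub> h y)}"

definition free_perm_algebra :: "'k ring \<Rightarrow> 'x set \<Rightarrow> ('k, 'a, 'c) module_scheme \<Rightarrow> bool"
  where "free_perm_algebra K X A \<longleftrightarrow> perm_algebra K A \<and> algebra_isos K (Perm K X) A \<noteq> {}"


section \<open>Pre-associative algebras and their representations\<close>

record ('k, 'b) preassoc = "('k, 'b) module" +
  prec :: "'b \<Rightarrow> 'b \<Rightarrow> 'b" (infixl \<open>\<prec>\<index>\<close> 70)
  succ :: "'b \<Rightarrow> 'b \<Rightarrow> 'b" (infixl \<open>\<succ>\<index>\<close> 70)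

definition star :: "('k, 'b, 'c) preassoc_scheme \<Rightarrow> 'b \<Rightarrow> 'b \<Rightarrow> 'b"
  where "star B x y = (x \<prec>\<^bsub>B\<^esub> y) \<oplus>\<^bsub>B\<^esub> (x \<succ>\<^bsub>B\<^esub> y)"

locale preassoc_algebra = module K B for K :: "'k ring" and B :: "('k, 'b) preassoc" +
  assumes prec_bilinear: "bilinear_op K B B B (prec B)"
    and succ_bilinear: "bilinear_op K B B B (succ B)"
    and prec_prec: "\<lbrakk>x \<in> carrier B; y \<in> carrier B; z \<in> carrier B\<rbrakk> \<Longrightarrow>
      (x \<prec>\<^bsub>B\<^esub> y) \<prec>\<^bsub>B\<^esub> z = x \<prec>\<^bsub>B\<^esub> (y \<prec>\<^bsub>B\<^esub> z \<oplus>\<^bsub>B\<^esub> y \<succ>\<^bsub>B\<^esub> z)"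
    and succ_prec: "\<lbrakk>x \<in> carrier B; y \<in> carrier B; z \<in> carrier B\<rbrakk> \<Longrightarrow>
      (x \<succ>\<^bsub>B\<^esub> y) \<prec>\<^bsub>B\<^esub> z = x \<succ>\<^bsub>B\<^esub> (y \<prec>\<^bsub>B\<^esub> z)"
    and succ_succ: "\<lbrakk>x \<in> carrier B; y \<in> carrier B; z \<in> carrier B\<rbrakk> \<Longrightarrow>
      x \<succ>\<^bsub>B\<^esub> (y \<succ>\<^bsub>B\<^esub> z) = (x \<prec>\<^bsub>B\<^esub> y \<oplus>\<^bsub>B\<^esub> x \<succ>\<^bsub>B\<^esub> y) \<succ>\<^bsub>B\<^esub> z"

text \<open>\<open>l\<close> marks the actions \<open>B \<otimes> N \<rightarrow> N\<close> and \<open>r\<close> the actions \<open>N \<otimes> B \<rightarrow> N\<close>.\<close>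

record ('k, 'b, 'n) preassoc_rep = "('k, 'n) module" +
  lprec :: "'b \<Rightarrow> 'n \<Rightarrow> 'n" (infixl \<open>\<prec>l\<index>\<close> 70)
  lsucc :: "'b \<Rightarrow> 'n \<Rightarrow> 'n" (infixl \<open>\<succ>l\<index>\<close> 70)
  rprec :: "'n \<Rightarrow> 'b \<Rightarrow> 'n" (infixl \<open>\<prec>r\<index>\<close> 70)
  rsucc :: "'n \<Rightarrow> 'b \<Rightarrow> 'n" (infixl \<open>\<succ>r\<index>\<close> 70)

locale preassoc_bimodule = B: preassoc_algebra K B + N: module K N
  for K :: "'k ring" and B :: "('k, 'b) preassoc" and N :: "('k, 'b, 'n) preassoc_rep" +
  assumes lprec_bilinear: "bilinear_op K B N N (lprec N)"
    and lsucc_bilinear: "bilinear_op K B N N (lsucc N)"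
    and rprec_bilinear: "bilinear_op K N B N (rprec N)"
    and rsucc_bilinear: "bilinear_op K N B N (rsucc N)"
    and prec_prec_1: "\<lbrakk>n \<in> carrier N; b \<in> carrier B; c \<in> carrier B\<rbrakk> \<Longrightarrow>
      (n \<prec>r\<^bsub>N\<^esub> b) \<prec>r\<^bsub>N\<^esub> c = n \<prec>r\<^bsub>N\<^esub> (b \<prec>\<^bsub>B\<^esub> c \<oplus>\<^bsub>B\<^esub> b \<succ>\<^bsub>B\<^esub> c)"
    and prec_prec_2: "\<lbrakk>n \<in> carrier N; b \<in> carrier B; c \<in> carrier B\<rbrakk> \<Longrightarrow>
      (b \<prec>l\<^bsub>N\<^esub> n) \<prec>r\<^bsub>N\<^esub> c = b \<prec>l\<^bsub>N\<^esub> (n \<prec>r\<^bsub>N\<^esub> c \<oplus>\<^bsub>N\<^esub> n \<succ>r\<^bsub>N\<^esub> c)"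
    and prec_prec_3: "\<lbrakk>n \<in> carrier N; b \<in> carrier B; c \<in> carrier B\<rbrakk> \<Longrightarrow>
      (b \<prec>\<^bsub>B\<^esub> c) \<prec>l\<^bsub>N\<^esub> n = b \<prec>l\<^bsub>N\<^esub> (c \<prec>l\<^bsub>N\<^esub> n \<oplus>\<^bsub>N\<^esub> c \<succ>l\<^bsub>N\<^esub> n)"
    and succ_prec_1: "\<lbrakk>n \<in> carrier N; b \<in> carrier B; c \<in> carrier B\<rbrakk> \<Longrightarrow>
      (n \<succ>r\<^bsub>N\<^esub> b) \<prec>r\<^bsub>N\<^esub> c = n \<succ>r\<^bsub>N\<^esub> (b \<prec>\<^bsub>B\<^esub> c)"
    and succ_prec_2: "\<lbrakk>n \<in> carrier N; b \<in> carrier B; c \<in> carrier B\<rbrakk> \<Longrightarrow>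
      (b \<succ>l\<^bsub>N\<^esub> n) \<prec>r\<^bsub>N\<^esub> c = b \<succ>l\<^bsub>N\<^esub> (n \<prec>r\<^bsub>N\<^esub> c)"
    and succ_prec_3: "\<lbrakk>n \<in> carrier N; b \<in> carrier B; c \<in> carrier B\<rbrakk> \<Longrightarrow>
      (b \<succ>\<^bsub>B\<^esub> c) \<prec>l\<^bsub>N\<^esub> n = b \<succ>l\<^bsub>N\<^esub> (c \<prec>l\<^bsub>N\<^esub> n)"
    and succ_succ_1: "\<lbrakk>n \<in> carrier N; b \<in> carrier B; c \<in> carrier B\<rbrakk> \<Longrightarrow>
      n \<succ>r\<^bsub>N\<^esub> (b \<succ>\<^bsub>B\<^esub> c) = (n \<prec>r\<^bsub>N\<^esub> b \<oplus>\<^bsub>N\<^esub> n \<succ>r\<^bsub>N\<^esub> b) \<succ>r\<^bsub>N\<^esub> c"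
    and succ_succ_2: "\<lbrakk>n \<in> carrier N; b \<in> carrier B; c \<in> carrier B\<rbrakk> \<Longrightarrow>
      b \<succ>l\<^bsub>N\<^esub> (n \<succ>r\<^bsub>N\<^esub> c) = (b \<prec>l\<^bsub>N\<^esub> n \<oplus>\<^bsub>N\<^esub> b \<succ>l\<^bsub>N\<^esub> n) \<succ>r\<^bsub>N\<^esub> c"
    and succ_succ_3: "\<lbrakk>n \<in> carrier N; b \<in> carrier B; c \<in> carrier B\<rbrakk> \<Longrightarrow>
      b \<succ>l\<^bsub>N\<^esub> (c \<succ>l\<^bsub>N\<^esub> n) = (b \<prec>\<^bsub>B\<^esub> c \<oplus>\<^bsub>B\<^esub> b \<succ>\<^bsub>B\<^esub> c) \<succ>l\<^bsub>N\<^esub> n"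


section \<open>The associative algebra \<open>A \<otimes> B\<close> and its bimodule \<open>A \<otimes> N\<close>\<close>

text \<open>
  The unique bilinear map \<open>(A \<otimes> U) \<times> (A \<otimes> V) \<rightarrow> A \<otimes> W\<close> with
  \<open>(a \<otimes> u) (a' \<otimes> v) = a a' \<otimes> p u v + a' a \<otimes> s u v\<close>.  The Hilbert choice is only
  arbitrary outside the carriers.
\<close>

definition tensor_op ::
  "'k ring \<Rightarrow> ('k, 'a, 'c) module_scheme \<Rightarrow> ('k, 'u, 'd) module_scheme \<Rightarrow>
    ('k, 'v, 'e) module_scheme \<Rightarrow> ('k, 'w, 'f) module_scheme \<Rightarrow>
    ('u \<Rightarrow> 'v \<Rightarrow> 'w) \<Rightarrow> ('u \<Rightarrow> 'v \<Rightarrow> 'w) \<Rightarrow>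
    ('a \<times> 'u \<Rightarrow> 'k) set \<Rightarrow> ('a \<times> 'v \<Rightarrow> 'k) set \<Rightarrow> ('a \<times> 'w \<Rightarrow> 'k) set"
  where "tensor_op K A U V W p s =
    (SOME m. bilinear_op K (tensor K A U) (tensor K A V) (tensor K A W) m \<and>
      (\<forall>a\<in>carrier A. \<forall>a'\<in>carrier A. \<forall>u\<in>carrier U. \<forall>v\<in>carrier V.
        m (pure_tensor K A U a u) (pure_tensor K A V a' v) =
          pure_tensor K A W (a \<otimes>\<^bsub>A\<^esub> a') (p u v) \<oplus>\<^bsub>tensor K A W\<^esub>
          pure_tensor K A W (a' \<otimes>\<^bsub>A\<^esub> a) (s u v)))"

definition tensor_algebra ::
  "'k ring \<Rightarrow> ('k, 'a) module \<Rightarrow> ('k, 'b) preassoc \<Rightarrow> ('k, ('a \<times> 'b \<Rightarrow> 'k) set) module"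
  where "tensor_algebra K A B =
    (tensor K A B)\<lparr>mult := tensor_op K A B B B (prec B) (succ B)\<rparr>"

definition tensor_lact ::
  "'k ring \<Rightarrow> ('k, 'a) module \<Rightarrow> ('k, 'b) preassoc \<Rightarrow> ('k, 'b, 'n) preassoc_rep \<Rightarrow>
    ('a \<times> 'b \<Rightarrow> 'k) set \<Rightarrow> ('a \<times> 'n \<Rightarrow> 'k) set \<Rightarrow> ('a \<times> 'n \<Rightarrow> 'k) set"
  where "tensor_lact K A B N = tensor_op K A B N N (lprec N) (lsucc N)"

definition tensor_ract ::
  "'k ring \<Rightarrow> ('k, 'a) module \<Rightarrow> ('k, 'b) preassoc \<Rightarrow> ('k, 'b, 'n) preassoc_rep \<Rightarrow>
    ('a \<times> 'n \<Rightarrow> 'k) set \<Rightarrow> ('a \<times> 'b \<Rightarrow> 'k) set \<Rightarrow> ('a \<times> 'n \<Rightarrow> 'k) set"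
  where "tensor_ract K A B N = tensor_op K A N B N (rprec N) (rsucc N)"


section \<open>Cochain complexes\<close>

text \<open>
  Complexes are indexed by all integers; \<open>coho\<close> is the cohomology, \<open>coho_map\<close> the map
  induced on cohomology by a cochain map, and \<open>connecting\<close> the connecting homomorphism, which
  sends the class of \<open>\<psi> x\<close> to the class of the \<open>y\<close> with \<open>\<phi> y = d x\<close>.
  As in \<^const>\<open>rcoset_mult\<close>, maps on quotients are written as unions of cosets over all
  representatives; by well-definedness these unions consist of a single coset.
\<close>

record ('k, 'v) cochains =
  obj :: "int \<Rightarrow> ('k, 'v) module"
  cobd :: "int \<Rightarrow> 'v \<Rightarrow> 'v"

definition cochain_complex :: "'k ring \<Rightarrow> ('k, 'v) cochains \<Rightarrow> bool"
  where "cochain_complex K C \<longleftrightarrow>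
    (\<forall>n. module K (obj C n) \<and> cobd C n \<in> lin_maps K (obj C n) (obj C (n + 1)) \<and>
      (\<forall>x\<in>carrier (obj C n). cobd C (n + 1) (cobd C n x) = \<zero>\<^bsub>obj C (n + 1 + 1)\<^esub>))"

definition cochain_map ::
  "'k ring \<Rightarrow> ('k, 'u) cochains \<Rightarrow> ('k, 'v) cochains \<Rightarrow> (int \<Rightarrow> 'u \<Rightarrow> 'v) \<Rightarrow> bool"
  where "cochain_map K C D \<phi> \<longleftrightarrow>
    (\<forall>n. \<phi> n \<in> lin_maps K (obj C n) (obj D n) \<and>
      (\<forall>x\<in>carrier (obj C n). \<phi> (n + 1) (cobd C n x) = cobd D n (\<phi> n x)))"

definition cocycles :: "('k, 'v) cochains \<Rightarrow> int \<Rightarrow> 'v set"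
  where "cocycles C n = a_kernel (obj C n) (obj C (n + 1)) (cobd C n)"

definition coboundaries :: "('k, 'v) cochains \<Rightarrow> int \<Rightarrow> 'v set"
  where "coboundaries C n = cobd C (n - 1) ` carrier (obj C (n - 1))"

definition coho :: "('k, 'v) cochains \<Rightarrow> int \<Rightarrow> ('k, 'v set) module"
  where "coho C n = quot_module ((obj C n)\<lparr>carrier := cocycles C n\<rparr>) (coboundaries C n)"

definition coho_map ::
  "('k, 'v) cochains \<Rightarrow> (int \<Rightarrow> 'u \<Rightarrow> 'v) \<Rightarrow> int \<Rightarrow> 'u set \<Rightarrow> 'v set"
  where "coho_map D \<phi> n S = (\<Union>x\<in>S. coboundaries D n +>\<^bsub>obj D n\<^esub> \<phi> n x)"

definition quot_complex :: "('k, 'v) cochains \<Rightarrow> (int \<Rightarrow> 'v set) \<Rightarrow> ('k, 'v set) cochains"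
  where "quot_complex D W =
    \<lparr>obj = (\<lambda>n. quot_module (obj D n) (W n)),
     cobd = (\<lambda>n S. \<Union>x\<in>S. W (n + 1) +>\<^bsub>obj D (n + 1)\<^esub> cobd D n x)\<rparr>"

definition quot_proj :: "('k, 'v) cochains \<Rightarrow> (int \<Rightarrow> 'v set) \<Rightarrow> int \<Rightarrow> 'v \<Rightarrow> 'v set"
  where "quot_proj D W n x = W n +>\<^bsub>obj D n\<^esub> x"

definition connecting ::
  "('k, 'u) cochains \<Rightarrow> (int \<Rightarrow> 'u \<Rightarrow> 'v) \<Rightarrow> ('k, 'v) cochains \<Rightarrow> (int \<Rightarrow> 'v \<Rightarrow> 'w) \<Rightarrow>
    int \<Rightarrow> 'w set \<Rightarrow> 'u set"
  where "connecting C \<phi> D \<psi> n S =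
    \<Union> {coboundaries C (n + 1) +>\<^bsub>obj C (n + 1)\<^esub> y |x y.
        x \<in> carrier (obj D n) \<and> \<psi> n x \<in> S \<and>
        y \<in> carrier (obj C (n + 1)) \<and> \<phi> (n + 1) y = cobd D n x}"

definition exact_at ::
  "'k ring \<Rightarrow> ('k, 'u) module \<Rightarrow> ('u \<Rightarrow> 'v) \<Rightarrow> ('k, 'v) module \<Rightarrow> ('v \<Rightarrow> 'w) \<Rightarrow>
    ('k, 'w) module \<Rightarrow> bool"
  where "exact_at K U f V g W \<longleftrightarrow>
    f \<in> lin_maps K U V \<and> g \<in> lin_maps K V W \<and> f ` carrier U = a_kernel V W g"

definition short_exact_complexes ::
  "'k ring \<Rightarrow> ('k, 'u) cochains \<Rightarrow> (int \<Rightarrow> 'u \<Rightarrow> 'v) \<Rightarrow> ('k, 'v) cochains \<Rightarrow>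
    (int \<Rightarrow> 'v \<Rightarrow> 'w) \<Rightarrow> ('k, 'w) cochains \<Rightarrow> bool"
  where "short_exact_complexes K C \<phi> D \<psi> E \<longleftrightarrow>
    cochain_complex K C \<and> cochain_complex K D \<and> cochain_complex K E \<and>
    cochain_map K C D \<phi> \<and> cochain_map K D E \<psi> \<and>
    (\<forall>n. inj_on (\<phi> n) (carrier (obj C n)) \<and>
      exact_at K (obj C n) (\<phi> n) (obj D n) (\<psi> n) (obj E n) \<and>
      \<psi> n ` carrier (obj D n) = carrier (obj E n))"


section \<open>The Hochschild and the pre-associative complex\<close>

definition sgn_smult :: "('k, 'v, 'c) module_scheme \<Rightarrow> nat \<Rightarrow> 'v \<Rightarrow> 'v"
  where "sgn_smult M i v = (if even i then v else \<ominus>\<^bsub>M\<^esub> v)"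

text \<open>Replaces the entries \<open>x\<^sub>i, x\<^sub>i\<^sub>+\<^sub>1\<close> (counting from 1) of a list by their product.\<close>

definition contract :: "('r \<Rightarrow> 'r \<Rightarrow> 'r) \<Rightarrow> nat \<Rightarrow> 'r list \<Rightarrow> 'r list"
  where "contract m i xs = take (i - 1) xs @ m (xs ! (i - 1)) (xs ! i) # drop (i + 1) xs"

text \<open>
  Linear maps on a tensor power are represented by multilinear maps on lists; to make cochains
  extensional, these vanish on all lists that are not tuples of the right length.
\<close>

definition hoch_space ::
  "'k ring \<Rightarrow> ('k, 'r) module \<Rightarrow> ('k, 'm) module \<Rightarrow> int \<Rightarrow> ('k, 'r list \<Rightarrow> 'm) module"
  where "hoch_space K R M n = pointwise M
    (if n < 0 then {\<lambda>_. \<zero>\<^bsub>M\<^esub>}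
     else {F. multilinear K R M (nat n) F \<and> (\<forall>xs. xs \<notin> tuples R (nat n) \<longrightarrow> F xs = \<zero>\<^bsub>M\<^esub>)})"

definition hoch_cobd ::
  "('k, 'r) module \<Rightarrow> ('k, 'm) module \<Rightarrow> ('r \<Rightarrow> 'm \<Rightarrow> 'm) \<Rightarrow> ('m \<Rightarrow> 'r \<Rightarrow> 'm) \<Rightarrow>
    nat \<Rightarrow> ('r list \<Rightarrow> 'm) \<Rightarrow> 'r list \<Rightarrow> 'm"
  where "hoch_cobd R M l r n F xs =
    (if xs \<in> tuples R (n + 1) then
       l (hd xs) (F (tl xs)) \<oplus>\<^bsub>M\<^esub>
       (\<Oplus>\<^bsub>M\<^esub>i\<in>{1..n}. sgn_smult M i (F (contract (mult R) i xs))) \<oplus>\<^bsub>M\<^esub>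
       sgn_smult M (n + 1) (r (F (butlast xs)) (last xs))
     else \<zero>\<^bsub>M\<^esub>)"

definition hoch_complex ::
  "'k ring \<Rightarrow> ('k, 'r) module \<Rightarrow> ('k, 'm) module \<Rightarrow> ('r \<Rightarrow> 'm \<Rightarrow> 'm) \<Rightarrow> ('m \<Rightarrow> 'r \<Rightarrow> 'm) \<Rightarrow>
    ('k, 'r list \<Rightarrow> 'm) cochains"
  where "hoch_complex K R M l r =
    \<lparr>obj = hoch_space K R M,
     cobd = (\<lambda>n F. if n < 0 then (\<lambda>_. \<zero>\<^bsub>M\<^esub>) else hoch_cobd R M l r (nat n) F)\<rparr>"

text \<open>A cochain in degree \<open>n\<close> is a family \<open>f (r, b\<^sub>1 \<dots> b\<^sub>n)\<close>, \<open>r = 1, \<dots>, n\<close>.\<close>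

definition dend_space ::
  "'k ring \<Rightarrow> ('k, 'b) preassoc \<Rightarrow> ('k, 'b, 'n) preassoc_rep \<Rightarrow> int \<Rightarrow>
    ('k, nat \<times> 'b list \<Rightarrow> 'n) module"
  where "dend_space K B N n = pointwise N
    (if n \<le> 0 then {\<lambda>_. \<zero>\<^bsub>N\<^esub>}
     else {f. (\<forall>r\<in>{1..nat n}. multilinear K B N (nat n) (\<lambda>bs. f (r, bs))) \<and>
              (\<forall>r bs. (r, bs) \<notin> {1..nat n} \<times> tuples B (nat n) \<longrightarrow> f (r, bs) = \<zero>\<^bsub>N\<^esub>)})"

definition dend_cobd ::
  "('k, 'b) preassoc \<Rightarrow> ('k, 'b, 'n) preassoc_rep \<Rightarrow> nat \<Rightarrow>
    (nat \<times> 'b list \<Rightarrow> 'n) \<Rightarrow> nat \<times> 'b list \<Rightarrow> 'n"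
  where "dend_cobd B N n f = (\<lambda>(r, bs).
    if (r, bs) \<in> {1..n+1} \<times> tuples B (n + 1) then
      (if r = 1 then
         (\<Oplus>\<^bsub>N\<^esub>i\<in>{1..n}. hd bs \<prec>l\<^bsub>N\<^esub> f (i, tl bs)) \<ominus>\<^bsub>N\<^esub>
         f (1, contract (prec B) 1 bs) \<oplus>\<^bsub>N\<^esub>
         (\<Oplus>\<^bsub>N\<^esub>i\<in>{2..n}. sgn_smult N i (f (1, contract (star B) i bs))) \<oplus>\<^bsub>N\<^esub>
         sgn_smult N (n + 1) (f (1, butlast bs) \<prec>r\<^bsub>N\<^esub> last bs)
       else if r \<le> n then
         hd bs \<succ>l\<^bsub>N\<^esub> f (r - 1, tl bs) \<oplus>\<^bsub>N\<^esub>
         (\<Oplus>\<^bsub>N\<^esub>i\<in>{1..r-2}. sgn_smult N i (f (r - 1, contract (star B) i bs))) \<oplus>\<^bsub>N\<^esub>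
         sgn_smult N (r - 1) (f (r - 1, contract (succ B) (r - 1) bs)) \<oplus>\<^bsub>N\<^esub>
         sgn_smult N r (f (r, contract (prec B) r bs)) \<oplus>\<^bsub>N\<^esub>
         (\<Oplus>\<^bsub>N\<^esub>i\<in>{r+1..n}. sgn_smult N i (f (r, contract (star B) i bs))) \<oplus>\<^bsub>N\<^esub>
         sgn_smult N (n + 1) (f (r, butlast bs) \<prec>r\<^bsub>N\<^esub> last bs)
       else
         hd bs \<succ>l\<^bsub>N\<^esub> f (n, tl bs) \<oplus>\<^bsub>N\<^esub>
         (\<Oplus>\<^bsub>N\<^esub>i\<in>{1..n-1}. sgn_smult N i (f (n, contract (star B) i bs))) \<oplus>\<^bsub>N\<^esub>
         sgn_smult N n (f (n, contract (succ B) n bs)) \<oplus>\<^bsub>N\<^esub>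
         sgn_smult N (n + 1) (\<Oplus>\<^bsub>N\<^esub>i\<in>{1..n}. f (i, butlast bs) \<succ>r\<^bsub>N\<^esub> last bs))
    else \<zero>\<^bsub>N\<^esub>)"

definition dend_complex ::
  "'k ring \<Rightarrow> ('k, 'b) preassoc \<Rightarrow> ('k, 'b, 'n) preassoc_rep \<Rightarrow>
    ('k, nat \<times> 'b list \<Rightarrow> 'n) cochains"
  where "dend_complex K B N =
    \<lparr>obj = dend_space K B N,
     cobd = (\<lambda>n f. if n \<le> 0 then (\<lambda>_. \<zero>\<^bsub>N\<^esub>) else dend_cobd B N (nat n) f)\<rparr>"

definition tensor_hoch_complex ::
  "'k ring \<Rightarrow> ('k, 'a) module \<Rightarrow> ('k, 'b) preassoc \<Rightarrow> ('k, 'b, 'n) preassoc_rep \<Rightarrow>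
    ('k, ('a \<times> 'b \<Rightarrow> 'k) set list \<Rightarrow> ('a \<times> 'n \<Rightarrow> 'k) set) cochains"
  where "tensor_hoch_complex K A B N =
    hoch_complex K (tensor_algebra K A B) (tensor K A N) (tensor_lact K A B N) (tensor_ract K A B N)"


section \<open>The map \<open>\<Psi>\<close>\<close>

text \<open>The product of a nonempty list; the algebra need not have a unit to start from.\<close>

definition list_mult :: "('k, 'a) module \<Rightarrow> 'a list \<Rightarrow> 'a"
  where "list_mult A as = foldl (mult A) (hd as) (tl as)"

text \<open>In degree \<open>n \<ge> 1\<close>: the multilinear map with the prescribed values on pure tensors.\<close>

definition Psi ::
  "'k ring \<Rightarrow> ('k, 'a) module \<Rightarrow> ('k, 'b) preassoc \<Rightarrow> ('k, 'b, 'n) preassoc_rep \<Rightarrow> int \<Rightarrow>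
    (nat \<times> 'b list \<Rightarrow> 'n) \<Rightarrow> ('a \<times> 'b \<Rightarrow> 'k) set list \<Rightarrow> ('a \<times> 'n \<Rightarrow> 'k) set"
  where "Psi K A B N n f =
    (if n \<le> 0 then (\<lambda>_. \<zero>\<^bsub>tensor K A N\<^esub>)
     else (THE F. F \<in> carrier (obj (tensor_hoch_complex K A B N) n) \<and>
       (\<forall>as\<in>tuples A (nat n). \<forall>bs\<in>tuples B (nat n).
         F (map2 (pure_tensor K A B) as bs) =
           (\<Oplus>\<^bsub>tensor K A N\<^esub>r\<in>{1..nat n}.
             pure_tensor K A N (list_mult A (rev (take r as) @ drop r as)) (f (r, bs))))))"

definition Psi_image ::
  "'k ring \<Rightarrow> ('k, 'a) module \<Rightarrow> ('k, 'b) preassoc \<Rightarrow> ('k, 'b, 'n) preassoc_rep \<Rightarrow> int \<Rightarrow>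
    (('a \<times> 'b \<Rightarrow> 'k) set list \<Rightarrow> ('a \<times> 'n \<Rightarrow> 'k) set) set"
  where "Psi_image K A B N n = Psi K A B N n ` carrier (obj (dend_complex K B N) n)"

end

theory Submission
  imports "HOL-Library.Multiset" Defs
begin

text \<open>
  In a Perm algebra a product depends only on its first factor and on the multiset of the other
  factors, so the differential of \<open>\<Psi> f\<close> can be sorted by the leading factor \<open>a\<^sub>r\<close>; the component
  at \<open>a\<^sub>r\<close> is \<open>(\<delta> f) (r, \<dots>)\<close>.  Two distinct generators make \<open>\<Psi>\<close> injective:
  summing the coefficients of all words that start with \<open>x\<close> gives a functional on the free Perm
  algebra that isolates the component \<open>f (r, \<dots>)\<close> once \<open>a\<^sub>r = x\<close> and all other \<open>a\<^sub>i = y\<close>.  In particular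
  \<open>\<delta> \<delta> = 0\<close> is inherited from the Hochschild complex, and the long exact sequence is the one of
  the short exact sequence of complexes.
\<close>

section \<open>Linear maps and quotient modules\<close>

text \<open>Two generators are what injectivity rests on: over a single generator the free Perm
  algebra is commutative, all the words \<open>word r as\<close> coincide, and \<open>\<Psi>\<close>
  sees only the sum of the components of \<open>f\<close>. The functional that separates components
  is not multiplicative. It satisfies \<open>f (u v) = f u * e v\<close>, where \<open>e\<close>
  sums all coefficients; this twisted rule lets it descend to the quotient by the Perm ideal, and it
  makes every factor behind the first invisible as soon as \<open>e\<close> is 1 there. The other
  obstacle is that tensor products are concrete quotients, while the product of
  \<open>A \<otimes> B\<close>, its actions and \<open>\<Psi>\<close> are given by description
  operators. They can be computed only once multilinear maps with prescribed values on pure tensors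
  are known to exist, and compared only once these are known to be unique. Uniqueness is also what
  makes the choices within the existence proofs linear.\<close>

locale linear_space = module K M
  for K :: "'k ring" and M :: "('k, 'v, 'c) module_scheme" (structure)

lemma lin_mapsI:
  assumes "\<And>x. x \<in> carrier U \<Longrightarrow> h x \<in> carrier V"
    and "\<And>x y. x \<in> carrier U \<Longrightarrow> y \<in> carrier U \<Longrightarrow> h (x \<oplus>\<^bsub>U\<^esub> y) = h x \<oplus>\<^bsub>V\<^esub> h y"
    and "\<And>c x. c \<in> carrier K \<Longrightarrow> x \<in> carrier U \<Longrightarrow> h (c \<odot>\<^bsub>U\<^esub> x) = c \<odot>\<^bsub>V\<^esub> h x"
  shows "h \<in> lin_maps K U V"
  using assms by (auto simp: lin_maps_def hom_def)

lemma lin_maps_closed: "h \<in> lin_maps K U V \<Longrightarrow> x \<in> carrier U \<Longrightarrow> h x \<in> carrier V"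
  by (auto simp: lin_maps_def hom_def)

lemma lin_maps_add:
  "h \<in> lin_maps K U V \<Longrightarrow> x \<in> carrier U \<Longrightarrow> y \<in> carrier U \<Longrightarrow>
    h (x \<oplus>\<^bsub>U\<^esub> y) = h x \<oplus>\<^bsub>V\<^esub> h y"
  by (auto simp: lin_maps_def hom_def)

lemma lin_maps_smult:
  "h \<in> lin_maps K U V \<Longrightarrow> c \<in> carrier K \<Longrightarrow> x \<in> carrier U \<Longrightarrow>
    h (c \<odot>\<^bsub>U\<^esub> x) = c \<odot>\<^bsub>V\<^esub> h x"
  by (auto simp: lin_maps_def)

text \<open>\<open>lin_maps\<close> constrains a function only on the carrier of its domain, so a
  function may be traded for one that agrees with it there. \<open>U\<close> is a linear space so
  that the sums and multiples in the conditions stay in the carrier.\<close>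

lemma lin_maps_cong:
  assumes "h \<in> lin_maps K U V" and "linear_space K U" and "\<And>x. x \<in> carrier U \<Longrightarrow> g x = h x"
  shows "g \<in> lin_maps K U V"
proof -
  interpret U: linear_space K U by fact
  show ?thesis
    using assms(1,3) by (auto intro!: lin_mapsI simp: lin_maps_closed lin_maps_add lin_maps_smult)
qed

lemma lin_maps_comp:
  "h \<in> lin_maps K U V \<Longrightarrow> g \<in> lin_maps K V W \<Longrightarrow> (\<lambda>x. g (h x)) \<in> lin_maps K U W"
  by (rule lin_mapsI) (auto simp: lin_maps_closed lin_maps_add lin_maps_smult)

lemma lin_maps_abelian_group_hom:
  assumes "h \<in> lin_maps K U V" and "linear_space K U" and "linear_space K V"
  shows "abelian_group_hom U V h"
proof -
  interpret U: linear_space K U by fact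
  interpret V: linear_space K V by fact
  have "group_hom (add_monoid U) (add_monoid V) h"
    using assms(1) by (intro group_hom.intro group_hom_axioms.intro U.a_group V.a_group)
      (auto simp: lin_maps_def)
  then show ?thesis
    by (intro abelian_group_homI U.abelian_group_axioms V.abelian_group_axioms)
qed

lemma lin_maps_zero:
  assumes "h \<in> lin_maps K U V" and "linear_space K U" and "linear_space K V"
  shows "h \<zero>\<^bsub>U\<^esub> = \<zero>\<^bsub>V\<^esub>"
  using abelian_group_hom.hom_zero[OF lin_maps_abelian_group_hom[OF assms]] .

lemma lin_maps_neg:
  assumes "h \<in> lin_maps K U V" and "linear_space K U" and "linear_space K V" and "x \<in> carrier U"
  shows "h (\<ominus>\<^bsub>U\<^esub> x) = \<ominus>\<^bsub>V\<^esub> h x"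
  using abelian_group_hom.hom_a_inv[OF lin_maps_abelian_group_hom[OF assms(1-3)] assms(4)] .

lemma lin_maps_minus:
  assumes "h \<in> lin_maps K U V" and "linear_space K U" and "linear_space K V"
    and "x \<in> carrier U" and "y \<in> carrier U"
  shows "h (x \<ominus>\<^bsub>U\<^esub> y) = h x \<ominus>\<^bsub>V\<^esub> h y"
proof -
  interpret U: linear_space K U by fact
  show ?thesis
    using assms by (simp add: a_minus_def lin_maps_add lin_maps_neg)
qed

lemma lin_maps_finsum:
  assumes "h \<in> lin_maps K U V" and "linear_space K U" and "linear_space K V" and "f \<in> I \<rightarrow> carrier U"
  shows "h (finsum U f I) = (\<Oplus>\<^bsub>V\<^esub>i\<in>I. h (f i))"
proof -
  interpret U: linear_space K U by fact
  interpret V: linear_space K V by fact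
  show ?thesis
  proof (cases "finite I")
    case True
    then show ?thesis using assms(4)
    proof (induction I)
      case empty
      show ?case using lin_maps_zero[OF assms(1-3)] by simp
    next
      case (insert i I)
      then have "f i \<in> carrier U" "f \<in> I \<rightarrow> carrier U" "(\<lambda>i. h (f i)) \<in> I \<rightarrow> carrier V"
        "h (f i) \<in> carrier V"
        using lin_maps_closed[OF assms(1)] by auto
      with insert show ?case by (simp add: lin_maps_add[OF assms(1)])
    qed
  next
    case False
    then show ?thesis using lin_maps_zero[OF assms(1-3)]
      by (simp add: U.finsum_infinite V.finsum_infinite)
  qed
qed

lemma submodule_kernel:
  assumes "h \<in> lin_maps K U V" and "linear_space K U" and "linear_space K V"
  shows "submodule (a_kernel U V h) K U"
proof -
  interpret U: linear_space K U by fact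
  interpret V: linear_space K V by fact
  show ?thesis
    using assms
    by (intro U.submoduleI)
      (auto simp: a_kernel_def' lin_maps_zero lin_maps_neg lin_maps_add lin_maps_smult)
qed

lemma submodule_image:
  assumes "h \<in> lin_maps K U V" and "linear_space K U" and "linear_space K V"
  shows "submodule (h ` carrier U) K V"
proof -
  interpret U: linear_space K U by fact
  interpret V: linear_space K V by fact
  show ?thesis
  proof (rule V.submoduleI)
    show "h ` carrier U \<subseteq> carrier V" using lin_maps_closed[OF assms(1)] by auto
    show "\<zero>\<^bsub>V\<^esub> \<in> h ` carrier U"
      using lin_maps_zero[OF assms] by (metis U.zero_closed image_eqI)
    show "\<ominus>\<^bsub>V\<^esub> y \<in> h ` carrier U" if "y \<in> h ` carrier U" for y
      using that lin_maps_neg[OF assms] by (metis (no_types, lifting) U.a_inv_closed imageE image_eqI)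
    show "y \<oplus>\<^bsub>V\<^esub> z \<in> h ` carrier U" if "y \<in> h ` carrier U" "z \<in> h ` carrier U" for y z
      using that lin_maps_add[OF assms(1)]
      by (metis (no_types, lifting) U.a_closed imageE image_eqI)
    show "c \<odot>\<^bsub>V\<^esub> y \<in> h ` carrier U" if "c \<in> carrier K" "y \<in> h ` carrier U" for c y
      using that lin_maps_smult[OF assms(1)]
      by (metis (no_types, lifting) U.smult_closed imageE image_eqI)
  qed
qed

text \<open>Maps on quotients are written as unions over representatives; this collapses such a
  union once all representatives give the same set.\<close>

lemma UN_const_eq: "x \<in> S \<Longrightarrow> (\<And>y. y \<in> S \<Longrightarrow> f y = v) \<Longrightarrow> (\<Union>y\<in>S. f y) = v"
  by auto

context linear_space
begin

lemma minus_eq_zero_iff: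
  assumes "x \<in> carrier M" and "y \<in> carrier M"
  shows "x \<ominus> y = \<zero> \<longleftrightarrow> x = y"
proof
  assume "x \<ominus> y = \<zero>"
  then have "\<ominus> (\<ominus> y) = x"
    using assms by (intro M.minus_equality) (auto simp: a_minus_def)
  then show "x = y" using assms by simp
qed (use assms in \<open>auto simp: a_minus_def M.r_neg\<close>)

lemma submodule_abelian_subgroup:
  assumes "submodule W K M"
  shows "abelian_subgroup W M"
proof -
  interpret W: submodule W K M by fact
  show ?thesis
    by (intro abelian_subgroupI3 additive_subgroupI W.subgroup_axioms abelian_group_axioms)
qed

lemma coset_eq_iff:
  assumes "submodule W K M" and "x \<in> carrier M" and "y \<in> carrier M"
  shows "W +> x = W +> y \<longleftrightarrow> x \<ominus> y \<in> W"
proof -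
  interpret W: abelian_subgroup W M by (rule submodule_abelian_subgroup[OF assms(1)])
  show ?thesis
    using W.a_rcos_module[OF assms(3,2)] W.a_repr_independence'[OF _ assms(3), of x]
      W.a_repr_independenceD[OF assms(2), of y] by (auto simp: a_minus_def)
qed

lemma mem_coset_iff:
  assumes "submodule W K M" and "x \<in> carrier M"
  shows "y \<in> W +> x \<longleftrightarrow> y \<in> carrier M \<and> W +> y = W +> x"
proof -
  interpret W: abelian_subgroup W M by (rule submodule_abelian_subgroup[OF assms(1)])
  show ?thesis
    using W.a_repr_independence'[OF _ assms(2), of y] W.a_rcos_self[of y]
      W.a_elemrcos_carrier[OF assms(2), of y] by auto
qed

lemma carrier_quot_module: "carrier (quot_module M W) = (\<lambda>x. W +> x) ` carrier M"
  by (auto simp: quot_module_def A_RCOSETS_def')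

lemma quot_module_zero:
  assumes "submodule W K M"
  shows "\<zero>\<^bsub>quot_module M W\<^esub> = W +> \<zero>"
proof -
  interpret W: submodule W K M by fact
  show ?thesis using W.subset by (simp add: quot_module_def)
qed

lemma quot_module_add:
  assumes "submodule W K M" and "x \<in> carrier M" and "y \<in> carrier M"
  shows "(W +> x) \<oplus>\<^bsub>quot_module M W\<^esub> (W +> y) = W +> (x \<oplus> y)"
proof -
  interpret W: abelian_subgroup W M by (rule submodule_abelian_subgroup[OF assms(1)])
  show ?thesis using assms W.a_rcos_sum by (simp add: quot_module_def)
qed

lemma coset_lin_map_eq:
  assumes "submodule W K M" and "linear_space K V" and "submodule W' K V" and "h \<in> lin_maps K M V"
    and "h ` W \<subseteq> W'" and "x \<in> carrier M" and "y \<in> carrier M"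
    and "W +> x = W +> y"
  shows "W' +>\<^bsub>V\<^esub> h x = W' +>\<^bsub>V\<^esub> h y"
proof -
  have "h (x \<ominus> y) \<in> W'" using assms coset_eq_iff by blast
  then show ?thesis
    using assms linear_space.coset_eq_iff[OF assms(2,3)] lin_maps_closed[OF assms(4)]
      lin_maps_minus[OF assms(4) linear_space_axioms assms(2)] by simp
qed

text \<open>One form of well-definedness serves three constructions: scalar multiplication on a
  quotient, \<open>coho_map\<close>, and the differential of \<open>quot_complex\<close> are all
  unions of this shape.\<close>

lemma UN_coset_lin_map:
  assumes "submodule W K M" and "linear_space K V" and "submodule W' K V" and "h \<in> lin_maps K M V"
    and "h ` W \<subseteq> W'" and "x \<in> carrier M"
  shows "(\<Union>y\<in>W +> x. W' +>\<^bsub>V\<^esub> h y) = W' +>\<^bsub>V\<^esub> h x"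
proof (rule UN_const_eq[of x])
  show "x \<in> W +> x" using mem_coset_iff[OF assms(1,6), of x] assms(6) by blast
  show "W' +>\<^bsub>V\<^esub> h y = W' +>\<^bsub>V\<^esub> h x" if "y \<in> W +> x" for y
    using mem_coset_iff[OF assms(1,6), of y] coset_lin_map_eq[OF assms(1-5) _ assms(6), of y] that
    by blast
qed

lemma smult_lin_map: "c \<in> carrier K \<Longrightarrow> (\<lambda>x. c \<odot> x) \<in> lin_maps K M M"
  by (rule lin_mapsI) (auto simp: smult_r_distr smult_assoc1[symmetric] R.m_comm)

lemma quot_module_smult:
  assumes "submodule W K M" and "c \<in> carrier K" and "x \<in> carrier M"
  shows "c \<odot>\<^bsub>quot_module M W\<^esub> (W +> x) = W +> (c \<odot> x)"
proof -
  interpret W: submodule W K M by fact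
  show ?thesis
    using UN_coset_lin_map[OF assms(1) linear_space_axioms assms(1) smult_lin_map[OF assms(2)]] assms
    by (simp add: quot_module_def image_subset_iff)
qed

lemma linear_space_quot_module:
  assumes "submodule W K M"
  shows "linear_space K (quot_module M W)"
proof (rule linear_space.intro, rule moduleI)
  note simps = carrier_quot_module quot_module_zero quot_module_add quot_module_smult
  show "cring K" by (rule R.is_cring)
  show "abelian_group (quot_module M W)"
  proof (rule abelian_groupI)
    fix S assume "S \<in> carrier (quot_module M W)"
    then obtain x where x: "x \<in> carrier M" "S = W +> x" by (auto simp: carrier_quot_module)
    then have "(W +> (\<ominus> x)) \<oplus>\<^bsub>quot_module M W\<^esub> S = \<zero>\<^bsub>quot_module M W\<^esub>"
      using assms by (simp add: simps M.l_neg)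
    then show "\<exists>T\<in>carrier (quot_module M W). T \<oplus>\<^bsub>quot_module M W\<^esub> S = \<zero>\<^bsub>quot_module M W\<^esub>"
      using x by (auto simp: carrier_quot_module)
  qed (use assms in \<open>auto simp: simps M.a_ac\<close>)
qed (use assms in \<open>auto simp: carrier_quot_module quot_module_add quot_module_smult
      smult_l_distr smult_r_distr smult_assoc1\<close>)

lemma coset_lin_map:
  assumes "submodule W K M"
  shows "(\<lambda>x. W +> x) \<in> lin_maps K M (quot_module M W)"
  by (rule lin_mapsI)
    (use assms in \<open>auto simp: carrier_quot_module quot_module_add quot_module_smult\<close>)

lemma coset_eq_zero_iff:
  assumes "submodule W K M" and "x \<in> carrier M"
  shows "W +> x = \<zero>\<^bsub>quot_module M W\<^esub> \<longleftrightarrow> x \<in> W"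
proof -
  have "x \<ominus> \<zero> = x" using assms(2) by (simp add: a_minus_def)
  then show ?thesis
    using assms(2) by (simp add: quot_module_zero[OF assms(1)] coset_eq_iff[OF assms(1)])
qed

lemma lin_maps_quotI:
  assumes "submodule W K M" and "g \<in> lin_maps K M V"
    and "\<And>x. x \<in> carrier M \<Longrightarrow> h (W +> x) = g x"
  shows "h \<in> lin_maps K (quot_module M W) V"
  by (rule lin_mapsI)
    (use assms in \<open>auto simp: carrier_quot_module quot_module_add quot_module_smult
      lin_maps_closed lin_maps_add lin_maps_smult\<close>)

text \<open>Apply \<open>g\<close> to any chosen representative; two representatives differ by an
  element of \<open>W\<close>, on which \<open>g\<close> vanishes.\<close>

lemma quot_lift_exists:
  assumes "submodule W K M" and "g \<in> lin_maps K M V" and "linear_space K V"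
    and "\<And>w. w \<in> W \<Longrightarrow> g w = \<zero>\<^bsub>V\<^esub>"
  shows "\<exists>h\<in>lin_maps K (quot_module M W) V. \<forall>x\<in>carrier M. h (W +> x) = g x"
proof -
  interpret V: linear_space K V by fact
  let ?h = "\<lambda>S. g (SOME x. x \<in> S)"
  have "?h (W +> x) = g x" if "x \<in> carrier M" for x
  proof -
    define y where "y = (SOME y. y \<in> W +> x)"
    have "y \<in> W +> x"
      unfolding y_def using mem_coset_iff[OF assms(1) that] that by (metis someI)
    then have y: "y \<in> carrier M" and "y \<ominus> x \<in> W"
      using mem_coset_iff[OF assms(1) that] coset_eq_iff[OF assms(1) _ that] by auto
    then have "g y \<ominus>\<^bsub>V\<^esub> g x = \<zero>\<^bsub>V\<^esub>"
      using assms(4) lin_maps_minus[OF assms(2) linear_space_axioms assms(3) y that] by simp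
    then show ?thesis
      using V.minus_eq_zero_iff lin_maps_closed[OF assms(2)] y that by (simp add: y_def)
  qed
  then show ?thesis by (intro bexI[of _ ?h] lin_maps_quotI[OF assms(1,2)]) auto
qed

text \<open>The hull is the intersection of all submodules that contain \<open>S\<close>; the
  carrier is one of them, which keeps the intersection inside the carrier.\<close>

lemma submodule_hull:
  assumes "S \<subseteq> carrier M"
  shows "submodule ((\<lambda>W. submodule W K M) hull S) K M"
proof (rule submoduleI)
  let ?H = "(\<lambda>W. submodule W K M) hull S"
  show "?H \<subseteq> carrier M"
    using hull_minimal[of S "carrier M" "\<lambda>W. submodule W K M"] assms carrier_is_submodule by blast
  show "\<zero> \<in> ?H"
    using submodule.axioms(1) subgroup.one_closed unfolding hull_def by fastforce
qed (use submoduleE in \<open>auto simp: hull_def\<close>)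

end

section \<open>The long exact cohomology sequence\<close>

text \<open>\<open>coho\<close> divides a record whose carrier is cut down to the cocycles. A coset
  involves only the addition, so it may be computed in the full cochain space.\<close>

lemma a_r_coset_carrier_update [simp]:
  "W +>\<^bsub>M\<lparr>carrier := Z\<rparr>\<^esub> x = W +>\<^bsub>M\<^esub> x"
  by (simp add: a_r_coset_def')

section \<open>Cocycles, coboundaries and cohomology classes of one complex\<close>

locale complex =
  fixes K :: "'k ring" and C :: "('k, 'v) cochains"
  assumes complex: "cochain_complex K C"
begin

lemma linear_space_obj: "linear_space K (obj C n)"
  using complex by (auto simp: cochain_complex_def linear_space_def)

lemma cobd_lin: "cobd C n \<in> lin_maps K (obj C n) (obj C (n + 1))"
  using complex by (auto simp: cochain_complex_def)

text \<open>Coboundaries in degree \<open>n\<close> come from degree \<open>n - 1\<close>, and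
  \<open>n - 1 + 1\<close> does not unify with \<open>n\<close>; hence this shifted copy, and
  likewise \<open>cobd_cobd'\<close> and \<open>map_cobd'\<close>.\<close>

lemma cobd_lin': "cobd C (n - 1) \<in> lin_maps K (obj C (n - 1)) (obj C n)"
  using cobd_lin[of "n - 1"] by simp

lemma cobd_cobd: "x \<in> carrier (obj C n) \<Longrightarrow> cobd C (n + 1) (cobd C n x) = \<zero>\<^bsub>obj C (n + 1 + 1)\<^esub>"
  using complex by (auto simp: cochain_complex_def)

lemma cobd_cobd': "x \<in> carrier (obj C (n - 1)) \<Longrightarrow> cobd C n (cobd C (n - 1) x) = \<zero>\<^bsub>obj C (n + 1)\<^esub>"
  using cobd_cobd[of x "n - 1"] by simp

lemma cocycles_iff: "x \<in> cocycles C n \<longleftrightarrow> x \<in> carrier (obj C n) \<and> cobd C n x = \<zero>\<^bsub>obj C (n + 1)\<^esub>"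
  by (auto simp: cocycles_def a_kernel_def')

lemma submodule_cocycles: "submodule (cocycles C n) K (obj C n)"
  unfolding cocycles_def by (rule submodule_kernel[OF cobd_lin linear_space_obj linear_space_obj])

abbreviation cocycle_module :: "int \<Rightarrow> ('k, 'v) module"
  where "cocycle_module n \<equiv> (obj C n)\<lparr>carrier := cocycles C n\<rparr>"

lemma linear_space_cocycles: "linear_space K (cocycle_module n)"
  using submodule.submodule_is_module[OF submodule_cocycles] linear_space_obj
  by (simp add: linear_space_def)

lemma coboundaries_subset: "coboundaries C n \<subseteq> cocycles C n"
  using cobd_cobd' lin_maps_closed[OF cobd_lin'] by (auto simp: coboundaries_def cocycles_iff)

lemma submodule_coboundaries: "submodule (coboundaries C n) K (obj C n)"
  unfolding coboundaries_def by (rule submodule_image[OF cobd_lin' linear_space_obj linear_space_obj])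

lemma submodule_coboundaries_cocycles: "submodule (coboundaries C n) K (cocycle_module n)"
proof -
  have "linear_space K ((cocycle_module n)\<lparr>carrier := coboundaries C n\<rparr>)"
    using submodule.submodule_is_module[OF submodule_coboundaries] linear_space_obj
    by (simp add: linear_space_def)
  then show ?thesis
    using module.module_incl_imp_submodule[of K "cocycle_module n"] linear_space_cocycles coboundaries_subset by (simp add: linear_space_def)
qed

lemma linear_space_coho: "linear_space K (coho C n)"
  unfolding coho_def
  by (rule linear_space.linear_space_quot_module[OF linear_space_cocycles submodule_coboundaries_cocycles])

text \<open>The cohomology class of a cocycle. The coset is taken in the whole cochain space, where
  it is the same set as in the module of cocycles used by \<open>coho\<close>.\<close>

definition cls :: "int \<Rightarrow> 'v \<Rightarrow> 'v set"
  where "cls n x = coboundaries C n +>\<^bsub>obj C n\<^esub> x"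

lemma carrier_coho: "carrier (coho C n) = cls n ` cocycles C n"
  unfolding coho_def cls_def by (simp add: linear_space.carrier_quot_module[OF linear_space_cocycles])

lemma cls_eq_iff:
  assumes "x \<in> cocycles C n" and "y \<in> cocycles C n"
  shows "cls n x = cls n y \<longleftrightarrow>
    (\<exists>w\<in>carrier (obj C (n - 1)). x \<ominus>\<^bsub>obj C n\<^esub> y = cobd C (n - 1) w)"
proof -
  have "cls n x = cls n y \<longleftrightarrow> x \<ominus>\<^bsub>obj C n\<^esub> y \<in> coboundaries C n"
    using assms unfolding cls_def cocycles_iff
    by (intro linear_space.coset_eq_iff[OF linear_space_obj submodule_coboundaries]) auto
  then show ?thesis by (auto simp: coboundaries_def)
qed

lemma mem_cls_iff:
  assumes "x \<in> cocycles C n"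
  shows "y \<in> cls n x \<longleftrightarrow> y \<in> cocycles C n \<and> cls n y = cls n x"
  using linear_space.mem_coset_iff[OF linear_space_cocycles submodule_coboundaries_cocycles, of x n y] assms
  by (simp add: cls_def)

lemma cls_add:
  assumes "x \<in> cocycles C n" and "y \<in> cocycles C n"
  shows "cls n x \<oplus>\<^bsub>coho C n\<^esub> cls n y = cls n (x \<oplus>\<^bsub>obj C n\<^esub> y)"
  using linear_space.quot_module_add[OF linear_space_cocycles submodule_coboundaries_cocycles, of x n y] assms
  by (simp add: cls_def coho_def)

lemma cls_smult:
  assumes "c \<in> carrier K" and "x \<in> cocycles C n"
  shows "c \<odot>\<^bsub>coho C n\<^esub> cls n x = cls n (c \<odot>\<^bsub>obj C n\<^esub> x)"
  using linear_space.quot_module_smult[OF linear_space_cocycles submodule_coboundaries_cocycles, of c x n] assms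
  by (simp add: cls_def coho_def)

lemma cls_zero_iff:
  assumes "x \<in> cocycles C n"
  shows "cls n x = \<zero>\<^bsub>coho C n\<^esub> \<longleftrightarrow> (\<exists>w\<in>carrier (obj C (n - 1)). x = cobd C (n - 1) w)"
proof -
  have "cls n x = \<zero>\<^bsub>coho C n\<^esub> \<longleftrightarrow> x \<in> coboundaries C n"
    using linear_space.coset_eq_zero_iff[OF linear_space_cocycles submodule_coboundaries_cocycles, of x n] assms
    by (simp add: cls_def coho_def)
  then show ?thesis by (auto simp: coboundaries_def)
qed

lemma lin_maps_cohoI:
  assumes "\<And>x. x \<in> cocycles C n \<Longrightarrow> h (cls n x) \<in> carrier V"
    and "\<And>x y. x \<in> cocycles C n \<Longrightarrow> y \<in> cocycles C n \<Longrightarrow>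
      h (cls n (x \<oplus>\<^bsub>obj C n\<^esub> y)) = h (cls n x) \<oplus>\<^bsub>V\<^esub> h (cls n y)"
    and "\<And>c x. c \<in> carrier K \<Longrightarrow> x \<in> cocycles C n \<Longrightarrow>
      h (cls n (c \<odot>\<^bsub>obj C n\<^esub> x)) = c \<odot>\<^bsub>V\<^esub> h (cls n x)"
  shows "h \<in> lin_maps K (coho C n) V"
  by (rule lin_mapsI) (use assms in \<open>auto simp: carrier_coho cls_add cls_smult\<close>)

end

section \<open>Induced maps on cohomology\<close>

locale complex_map = C: complex K C + D: complex K D
  for K :: "'k ring" and C :: "('k, 'u) cochains" and D :: "('k, 'v) cochains" +
  fixes \<phi> :: "int \<Rightarrow> 'u \<Rightarrow> 'v"
  assumes cochain_map: "cochain_map K C D \<phi>"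
begin

lemma map_lin: "\<phi> n \<in> lin_maps K (obj C n) (obj D n)"
  using cochain_map by (auto simp: cochain_map_def)

lemma map_cobd: "x \<in> carrier (obj C n) \<Longrightarrow> \<phi> (n + 1) (cobd C n x) = cobd D n (\<phi> n x)"
  using cochain_map by (auto simp: cochain_map_def)

lemma map_cobd': "x \<in> carrier (obj C (n - 1)) \<Longrightarrow> \<phi> n (cobd C (n - 1) x) = cobd D (n - 1) (\<phi> (n - 1) x)"
  using map_cobd[of x "n - 1"] by simp

lemma map_zero: "\<phi> n \<zero>\<^bsub>obj C n\<^esub> = \<zero>\<^bsub>obj D n\<^esub>"
  by (rule lin_maps_zero[OF map_lin C.linear_space_obj D.linear_space_obj])

lemma map_minus:
  "x \<in> carrier (obj C n) \<Longrightarrow> y \<in> carrier (obj C n) \<Longrightarrow>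
    \<phi> n (x \<ominus>\<^bsub>obj C n\<^esub> y) = \<phi> n x \<ominus>\<^bsub>obj D n\<^esub> \<phi> n y"
  by (rule lin_maps_minus[OF map_lin C.linear_space_obj D.linear_space_obj])

lemma map_closed: "x \<in> carrier (obj C n) \<Longrightarrow> \<phi> n x \<in> carrier (obj D n)"
  by (rule lin_maps_closed[OF map_lin])

lemma map_cocycles: "x \<in> cocycles C n \<Longrightarrow> \<phi> n x \<in> cocycles D n"
  by (auto simp: C.cocycles_iff D.cocycles_iff map_closed map_cobd[symmetric] map_zero)

text \<open>A cochain map sends coboundaries to coboundaries, so the representatives in the union
  that defines \<open>coho_map\<close> all have the same image class.\<close>

lemma coho_map_cls:
  assumes "x \<in> cocycles C n"
  shows "coho_map D \<phi> n (C.cls n x) = D.cls n (\<phi> n x)"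
proof -
  have "\<phi> n ` coboundaries C n \<subseteq> coboundaries D n"
    by (auto simp: coboundaries_def map_cobd' map_closed)
  then have "(\<Union>y\<in>C.cls n x. D.cls n (\<phi> n y)) = D.cls n (\<phi> n x)"
    unfolding C.cls_def D.cls_def
    using assms by (intro linear_space.UN_coset_lin_map[OF C.linear_space_obj C.submodule_coboundaries
          D.linear_space_obj D.submodule_coboundaries map_lin]) (auto simp: C.cocycles_iff)
  then show ?thesis by (simp add: coho_map_def D.cls_def)
qed

lemma coho_map_lin: "coho_map D \<phi> n \<in> lin_maps K (coho C n) (coho D n)"
proof (rule C.lin_maps_cohoI)
  fix x assume x: "x \<in> cocycles C n"
  show "coho_map D \<phi> n (C.cls n x) \<in> carrier (coho D n)"
    using x by (auto simp: coho_map_cls D.carrier_coho map_cocycles)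
  show "coho_map D \<phi> n (C.cls n (c \<odot>\<^bsub>obj C n\<^esub> x)) = c \<odot>\<^bsub>coho D n\<^esub> coho_map D \<phi> n (C.cls n x)"
    if c: "c \<in> carrier K" for c
  proof -
    have "c \<odot>\<^bsub>obj C n\<^esub> x \<in> cocycles C n"
      using submodule.smult_closed[OF C.submodule_cocycles] x c by auto
    then show ?thesis
      using x c lin_maps_smult[OF map_lin]
      by (simp add: coho_map_cls D.cls_smult map_cocycles C.cocycles_iff[of x])
  qed
  fix y assume y: "y \<in> cocycles C n"
  have "x \<oplus>\<^bsub>obj C n\<^esub> y \<in> cocycles C n"
    using module.submoduleE(5)[OF linear_space.axioms[OF C.linear_space_obj] C.submodule_cocycles] x y by auto
  then show "coho_map D \<phi> n (C.cls n (x \<oplus>\<^bsub>obj C n\<^esub> y)) =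
      coho_map D \<phi> n (C.cls n x) \<oplus>\<^bsub>coho D n\<^esub> coho_map D \<phi> n (C.cls n y)"
    using x y lin_maps_add[OF map_lin]
    by (simp add: coho_map_cls D.cls_add map_cocycles C.cocycles_iff[of x] C.cocycles_iff[of y])
qed

end

lemma (in complex) cocycles_closed:
  assumes "x \<in> cocycles C n"
  shows "y \<in> cocycles C n \<Longrightarrow> x \<oplus>\<^bsub>obj C n\<^esub> y \<in> cocycles C n"
    and "c \<in> carrier K \<Longrightarrow> c \<odot>\<^bsub>obj C n\<^esub> x \<in> cocycles C n"
  using assms module.submoduleE(5)[OF linear_space.axioms[OF linear_space_obj] submodule_cocycles]
    module.submoduleE(4)[OF linear_space.axioms[OF linear_space_obj] submodule_cocycles]
  by auto

section \<open>The snake construction and exactness of the long sequence\<close>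

locale short_exact = C: complex K C + D: complex K D + E: complex K E +
  f: complex_map K C D \<phi> + g: complex_map K D E \<psi>
  for K :: "'k ring" and C :: "('k, 'u) cochains" and D :: "('k, 'v) cochains"
    and E :: "('k, 'w) cochains" and \<phi> \<psi> +
  assumes inj: "inj_on (\<phi> n) (carrier (obj C n))"
    and exact: "\<phi> n ` carrier (obj C n) = a_kernel (obj D n) (obj E n) (\<psi> n)"
    and surj: "\<psi> n ` carrier (obj D n) = carrier (obj E n)"
begin

abbreviation \<delta> :: "int \<Rightarrow> 'w set \<Rightarrow> 'u set"
  where "\<delta> n \<equiv> connecting C \<phi> D \<psi> n"

lemma lift_C:
  assumes "x \<in> carrier (obj D n)" and "\<psi> n x = \<zero>\<^bsub>obj E n\<^esub>"
  obtains y where "y \<in> carrier (obj C n)" and "\<phi> n y = x"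
proof -
  have "x \<in> \<phi> n ` carrier (obj C n)" using assms by (simp add: exact a_kernel_def')
  then show ?thesis using that by blast
qed

lemma lift_E:
  assumes "z \<in> carrier (obj E n)"
  obtains x where "x \<in> carrier (obj D n)" and "\<psi> n x = z"
proof -
  have "z \<in> \<psi> n ` carrier (obj D n)" using assms by (simp add: surj)
  then show ?thesis using that by blast
qed

lemma comp_zero: "y \<in> carrier (obj C n) \<Longrightarrow> \<psi> n (\<phi> n y) = \<zero>\<^bsub>obj E n\<^esub>"
  using exact[of n] by (auto simp: a_kernel_def')

lemma map_eqD:
  "\<phi> n y = \<phi> n y' \<Longrightarrow> y \<in> carrier (obj C n) \<Longrightarrow> y' \<in> carrier (obj C n) \<Longrightarrow> y = y'"
  using inj[of n] by (auto dest: inj_onD)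

text \<open>Surjectivity of \<open>\<psi>\<close> supplies \<open>x\<close>. Since \<open>z\<close>
  is a cocycle, \<open>\<psi>\<close> kills \<open>d x\<close>, and exactness in the middle supplies
  \<open>y\<close>.\<close>

lemma snake_exists:
  assumes "z \<in> cocycles E n"
  obtains x y where "x \<in> carrier (obj D n)" and "\<psi> n x = z"
    and "y \<in> carrier (obj C (n + 1))" and "\<phi> (n + 1) y = cobd D n x"
proof -
  obtain x where x: "x \<in> carrier (obj D n)" "\<psi> n x = z"
    using assms lift_E E.cocycles_iff by blast
  have "cobd D n x \<in> carrier (obj D (n + 1))" using x lin_maps_closed[OF D.cobd_lin] by blast
  moreover have "\<psi> (n + 1) (cobd D n x) = \<zero>\<^bsub>obj E (n + 1)\<^esub>"
    using x assms g.map_cobd E.cocycles_iff by simp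
  ultimately show ?thesis using lift_C x that by metis
qed

text \<open>\<open>\<phi>\<close> maps \<open>d y\<close> to \<open>d (d x) = 0\<close> and is
  injective in degree \<open>n + 2\<close>.\<close>

lemma snake_cocycle:
  assumes "x \<in> carrier (obj D n)" and "y \<in> carrier (obj C (n + 1))"
    and "\<phi> (n + 1) y = cobd D n x"
  shows "y \<in> cocycles C (n + 1)"
proof -
  interpret C2: linear_space K "obj C (n + 1 + 1)" by (rule C.linear_space_obj)
  have dy: "cobd C (n + 1) y \<in> carrier (obj C (n + 1 + 1))"
    using lin_maps_closed[OF C.cobd_lin assms(2)] .
  have "\<phi> (n + 1 + 1) (cobd C (n + 1) y) = \<phi> (n + 1 + 1) \<zero>\<^bsub>obj C (n + 1 + 1)\<^esub>"
    using assms D.cobd_cobd by (simp only: f.map_cobd f.map_zero)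
  then show ?thesis
    using map_eqD[OF _ dy] assms(2) C.cocycles_iff by blast
qed

text \<open>The difference \<open>x' - x\<close> lies over a coboundary \<open>d e\<close>.
  Subtracting \<open>d v\<close> for a lift \<open>v\<close> of \<open>e\<close> moves it into the
  image of \<open>\<phi>\<close>, say to \<open>\<phi> u\<close>, without changing its differential;
  injectivity of \<open>\<phi>\<close> then gives \<open>y' - y = d u\<close>.\<close>

lemma snake_unique:
  assumes "z \<in> cocycles E n" and "z' \<in> E.cls n z"
    and "x \<in> carrier (obj D n)" and "\<psi> n x = z"
    and "y \<in> carrier (obj C (n + 1))" and "\<phi> (n + 1) y = cobd D n x"
    and "x' \<in> carrier (obj D n)" and "\<psi> n x' = z'"
    and "y' \<in> carrier (obj C (n + 1))" and "\<phi> (n + 1) y' = cobd D n x'"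
  shows "C.cls (n + 1) y' = C.cls (n + 1) y"
proof -
  interpret Cn: linear_space K "obj C n" by (rule C.linear_space_obj)
  interpret C1: linear_space K "obj C (n + 1)" by (rule C.linear_space_obj)
  interpret Dn: linear_space K "obj D n" by (rule D.linear_space_obj)
  interpret D1: linear_space K "obj D (n + 1)" by (rule D.linear_space_obj)
  interpret En: linear_space K "obj E n" by (rule E.linear_space_obj)
  have "z' \<in> cocycles E n" "E.cls n z' = E.cls n z" using E.mem_cls_iff[OF assms(1)] assms(2) by auto
  then obtain e where e: "e \<in> carrier (obj E (n - 1))" "z' \<ominus>\<^bsub>obj E n\<^esub> z = cobd E (n - 1) e"
    using E.cls_eq_iff assms(1) by blast
  obtain v where v: "v \<in> carrier (obj D (n - 1))" "\<psi> (n - 1) v = e" using lift_E[OF e(1)] .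
  define d where "d = x' \<ominus>\<^bsub>obj D n\<^esub> x"
  define b where "b = cobd D (n - 1) v"
  have b: "b \<in> carrier (obj D n)" using v lin_maps_closed[OF D.cobd_lin'] by (simp add: b_def)
  have d: "d \<in> carrier (obj D n)" using assms by (simp add: d_def)
  have "\<psi> n d = \<psi> n b"
    using e v assms(3,4,7,8) by (simp add: d_def b_def g.map_minus g.map_cobd')
  then have "\<psi> n (d \<ominus>\<^bsub>obj D n\<^esub> b) = \<zero>\<^bsub>obj E n\<^esub>"
    using b d by (simp add: g.map_minus En.minus_eq_zero_iff g.map_closed)
  then obtain u where u: "u \<in> carrier (obj C n)" "\<phi> n u = d \<ominus>\<^bsub>obj D n\<^esub> b"
    using lift_C b d by blast
  have "cobd D n b = \<zero>\<^bsub>obj D (n + 1)\<^esub>" using v D.cobd_cobd' by (simp add: b_def)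
  then have "cobd D n (d \<ominus>\<^bsub>obj D n\<^esub> b) = cobd D n d"
    using b d lin_maps_closed[OF D.cobd_lin d]
    by (simp add: lin_maps_minus[OF D.cobd_lin D.linear_space_obj D.linear_space_obj])
      (simp add: a_minus_def)
  then have "\<phi> (n + 1) (cobd C n u) = cobd D n x' \<ominus>\<^bsub>obj D (n + 1)\<^esub> cobd D n x"
    using u assms(3,7)
    by (simp add: f.map_cobd d_def lin_maps_minus[OF D.cobd_lin D.linear_space_obj D.linear_space_obj])
  also have "\<dots> = \<phi> (n + 1) (y' \<ominus>\<^bsub>obj C (n + 1)\<^esub> y)"
    using assms by (simp add: f.map_minus)
  finally have "y' \<ominus>\<^bsub>obj C (n + 1)\<^esub> y = cobd C n u"
    using map_eqD u(1) assms(5,9) lin_maps_closed[OF C.cobd_lin u(1)] by (metis C1.minus_closed)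
  then show ?thesis
    using C.cls_eq_iff[OF snake_cocycle[OF assms(7,9,10)] snake_cocycle[OF assms(3,5,6)]] u(1)
    by auto
qed

text \<open>The union that defines \<open>connecting\<close> ranges over every lift of every
  representative. By \<open>snake_unique\<close> all of these give one class, so any single lift
  computes it.\<close>

lemma connecting_cls:
  assumes "z \<in> cocycles E n" and "x \<in> carrier (obj D n)" and "\<psi> n x = z"
    and "y \<in> carrier (obj C (n + 1))" and "\<phi> (n + 1) y = cobd D n x"
  shows "\<delta> n (E.cls n z) = C.cls (n + 1) y"
proof -
  let ?F = "{C.cls (n + 1) y' |x' y'. x' \<in> carrier (obj D n) \<and> \<psi> n x' \<in> E.cls n z \<and>
    y' \<in> carrier (obj C (n + 1)) \<and> \<phi> (n + 1) y' = cobd D n x'}"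
  have "z \<in> E.cls n z" using E.mem_cls_iff[OF assms(1)] assms(1) by auto
  then have "C.cls (n + 1) y \<in> ?F" using assms(2-5) by auto
  moreover have "S = C.cls (n + 1) y" if "S \<in> ?F" for S
    using that snake_unique[OF assms(1) _ assms(2-5)] by blast
  ultimately have "?F = {C.cls (n + 1) y}" by blast
  then show ?thesis by (simp add: connecting_def C.cls_def)
qed

text \<open>Sums and multiples of lifts are again lifts, so they compute the connecting map on sums
  and multiples of classes.\<close>

lemma connecting_lin: "\<delta> n \<in> lin_maps K (coho E n) (coho C (n + 1))"
proof (rule E.lin_maps_cohoI)
  interpret C1: linear_space K "obj C (n + 1)" by (rule C.linear_space_obj)
  interpret Dn: linear_space K "obj D n" by (rule D.linear_space_obj)
  fix z assume z: "z \<in> cocycles E n"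
  obtain x y where xy: "x \<in> carrier (obj D n)" "\<psi> n x = z"
    "y \<in> carrier (obj C (n + 1))" "\<phi> (n + 1) y = cobd D n x"
    using snake_exists[OF z] .
  note d = connecting_cls[OF z xy] and yc = snake_cocycle[OF xy(1,3,4)]
  show "\<delta> n (E.cls n z) \<in> carrier (coho C (n + 1))"
    using yc by (simp add: d C.carrier_coho)
  show "\<delta> n (E.cls n (c \<odot>\<^bsub>obj E n\<^esub> z)) = c \<odot>\<^bsub>coho C (n + 1)\<^esub> \<delta> n (E.cls n z)"
    if c: "c \<in> carrier K" for c
  proof -
    have "\<delta> n (E.cls n (c \<odot>\<^bsub>obj E n\<^esub> z)) = C.cls (n + 1) (c \<odot>\<^bsub>obj C (n + 1)\<^esub> y)"
      using xy c z by (intro connecting_cls[of _ _ "c \<odot>\<^bsub>obj D n\<^esub> x"] E.cocycles_closed)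
        (auto simp: lin_maps_smult[OF f.map_lin] lin_maps_smult[OF g.map_lin] lin_maps_smult[OF D.cobd_lin])
    then show ?thesis using c yc by (simp add: d C.cls_smult)
  qed
  fix z' assume z': "z' \<in> cocycles E n"
  obtain x' y' where xy': "x' \<in> carrier (obj D n)" "\<psi> n x' = z'"
    "y' \<in> carrier (obj C (n + 1))" "\<phi> (n + 1) y' = cobd D n x'"
    using snake_exists[OF z'] .
  note d' = connecting_cls[OF z' xy'] and yc' = snake_cocycle[OF xy'(1,3,4)]
  have "\<delta> n (E.cls n (z \<oplus>\<^bsub>obj E n\<^esub> z')) = C.cls (n + 1) (y \<oplus>\<^bsub>obj C (n + 1)\<^esub> y')"
    using xy xy' z z' by (intro connecting_cls[of _ _ "x \<oplus>\<^bsub>obj D n\<^esub> x'"] E.cocycles_closed)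
      (auto simp: lin_maps_add[OF f.map_lin] lin_maps_add[OF g.map_lin] lin_maps_add[OF D.cobd_lin])
  then show "\<delta> n (E.cls n (z \<oplus>\<^bsub>obj E n\<^esub> z')) = \<delta> n (E.cls n z) \<oplus>\<^bsub>coho C (n + 1)\<^esub> \<delta> n (E.cls n z')"
    using yc yc' by (simp add: d d' C.cls_add)
qed

lemma exact_middle:
  "exact_at K (coho C n) (coho_map D \<phi> n) (coho D n) (coho_map E \<psi> n) (coho E n)"
proof -
  interpret Dn: linear_space K "obj D n" by (rule D.linear_space_obj)
  interpret En: linear_space K "obj E n" by (rule E.linear_space_obj)
  interpret D1: linear_space K "obj D (n + 1)" by (rule D.linear_space_obj)
  interpret HE: linear_space K "coho E n" by (rule E.linear_space_coho)
  have "coho_map D \<phi> n ` carrier (coho C n) = a_kernel (coho D n) (coho E n) (coho_map E \<psi> n)"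
  proof (intro equalityI subsetI)
    fix S assume "S \<in> coho_map D \<phi> n ` carrier (coho C n)"
    then obtain y where y: "y \<in> cocycles C n" "S = D.cls n (\<phi> n y)"
      by (auto simp: C.carrier_coho f.coho_map_cls)
    then have S: "S \<in> carrier (coho D n)" by (auto simp: D.carrier_coho f.map_cocycles)
    have E0: "\<zero>\<^bsub>obj E n\<^esub> \<in> cocycles E n"
      using lin_maps_zero[OF E.cobd_lin E.linear_space_obj E.linear_space_obj]
      by (simp add: E.cocycles_iff)
    interpret Ep: linear_space K "obj E (n - 1)" by (rule E.linear_space_obj)
    have "E.cls n \<zero>\<^bsub>obj E n\<^esub> = \<zero>\<^bsub>coho E n\<^esub>"
      using E.cls_zero_iff[OF E0] lin_maps_zero[OF E.cobd_lin' E.linear_space_obj E.linear_space_obj]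
      by (metis Ep.zero_closed)
    moreover have "coho_map E \<psi> n S = E.cls n \<zero>\<^bsub>obj E n\<^esub>"
      using y by (simp add: g.coho_map_cls f.map_cocycles comp_zero C.cocycles_iff)
    ultimately show "S \<in> a_kernel (coho D n) (coho E n) (coho_map E \<psi> n)"
      using S by (simp add: a_kernel_def')
  next
    fix S assume "S \<in> a_kernel (coho D n) (coho E n) (coho_map E \<psi> n)"
    then obtain x where x: "x \<in> cocycles D n" "S = D.cls n x"
      and "coho_map E \<psi> n S = \<zero>\<^bsub>coho E n\<^esub>"
      by (auto simp: a_kernel_def' D.carrier_coho)
    then obtain w where w: "w \<in> carrier (obj E (n - 1))" "\<psi> n x = cobd E (n - 1) w"
      using E.cls_zero_iff[OF g.map_cocycles[OF x(1)]] by (auto simp: g.coho_map_cls)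
    obtain v where v: "v \<in> carrier (obj D (n - 1))" "\<psi> (n - 1) v = w" using lift_E[OF w(1)] .
    \<comment> \<open>Correcting \<open>x\<close> by the coboundary \<open>b\<close> keeps its class
      and puts it into the kernel of \<open>\<psi>\<close>, hence into the image of
      \<open>\<phi>\<close>.\<close>
    define b where "b = cobd D (n - 1) v"
    have b: "b \<in> carrier (obj D n)" using v lin_maps_closed[OF D.cobd_lin'] by (simp add: b_def)
    have xn: "x \<in> carrier (obj D n)" using x D.cocycles_iff by blast
    have "\<psi> n x = \<psi> n b" using v w by (simp add: b_def g.map_cobd')
    then have "\<psi> n (x \<ominus>\<^bsub>obj D n\<^esub> b) = \<zero>\<^bsub>obj E n\<^esub>"
      using b xn by (simp add: g.map_minus En.minus_eq_zero_iff g.map_closed)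
    then obtain y where y: "y \<in> carrier (obj C n)" "\<phi> n y = x \<ominus>\<^bsub>obj D n\<^esub> b"
      using lift_C b xn by blast
    have b0: "cobd D n b = \<zero>\<^bsub>obj D (n + 1)\<^esub>" using v D.cobd_cobd' by (simp add: b_def)
    interpret C1: linear_space K "obj C (n + 1)" by (rule C.linear_space_obj)
    have "cobd D n (x \<ominus>\<^bsub>obj D n\<^esub> b) = \<zero>\<^bsub>obj D (n + 1)\<^esub>"
      using b xn b0 x
      by (simp add: lin_maps_minus[OF D.cobd_lin D.linear_space_obj D.linear_space_obj]
          D.cocycles_iff) (simp add: a_minus_def)
    then have "\<phi> (n + 1) (cobd C n y) = \<phi> (n + 1) \<zero>\<^bsub>obj C (n + 1)\<^esub>"
      using y by (simp add: f.map_cobd f.map_zero)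
    then have yc: "y \<in> cocycles C n"
      using map_eqD y lin_maps_closed[OF C.cobd_lin y(1)] C.cocycles_iff by (metis C1.zero_closed)
    have "x \<ominus>\<^bsub>obj D n\<^esub> \<phi> n y = b"
      using b xn by (simp add: y a_minus_def Dn.minus_add Dn.a_assoc[symmetric] Dn.r_neg)
    then have "D.cls n x = D.cls n (\<phi> n y)"
      using D.cls_eq_iff[OF x(1) f.map_cocycles[OF yc]] v by (auto simp: b_def)
    then show "S \<in> coho_map D \<phi> n ` carrier (coho C n)"
      using x yc by (auto simp: C.carrier_coho f.coho_map_cls image_image)
  qed
  then show ?thesis unfolding exact_at_def using f.coho_map_lin g.coho_map_lin by blast
qed

lemma exact_quotient:
  "exact_at K (coho D n) (coho_map E \<psi> n) (coho E n) (\<delta> n) (coho C (n + 1))"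
proof -
  interpret Dn: linear_space K "obj D n" by (rule D.linear_space_obj)
  interpret Cn: linear_space K "obj C n" by (rule C.linear_space_obj)
  interpret C1: linear_space K "obj C (n + 1)" by (rule C.linear_space_obj)
  interpret D1: linear_space K "obj D (n + 1)" by (rule D.linear_space_obj)
  interpret En: linear_space K "obj E n" by (rule E.linear_space_obj)
  have "coho_map E \<psi> n ` carrier (coho D n) = a_kernel (coho E n) (coho C (n + 1)) (\<delta> n)"
  proof (intro equalityI subsetI)
    fix S assume "S \<in> coho_map E \<psi> n ` carrier (coho D n)"
    then obtain x where x: "x \<in> cocycles D n" "S = E.cls n (\<psi> n x)"
      by (auto simp: D.carrier_coho g.coho_map_cls)
    \<comment> \<open>Here \<open>d x = 0\<close>, so zero serves as the \<open>y\<close> of the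
      snake.\<close>
    have "\<delta> n S = C.cls (n + 1) \<zero>\<^bsub>obj C (n + 1)\<^esub>"
      unfolding x(2) using x(1)
      by (intro connecting_cls[of _ _ x]) (auto simp: g.map_cocycles D.cocycles_iff f.map_zero)
    moreover have "\<zero>\<^bsub>obj C (n + 1)\<^esub> \<in> cocycles C (n + 1)"
      using lin_maps_zero[OF C.cobd_lin C.linear_space_obj C.linear_space_obj]
      by (simp add: C.cocycles_iff)
    then have "C.cls (n + 1) \<zero>\<^bsub>obj C (n + 1)\<^esub> = \<zero>\<^bsub>coho C (n + 1)\<^esub>"
      using C.cls_zero_iff lin_maps_zero[OF C.cobd_lin C.linear_space_obj C.linear_space_obj, of n]
      by (metis Cn.zero_closed add_diff_cancel_right')
    ultimately show "S \<in> a_kernel (coho E n) (coho C (n + 1)) (\<delta> n)"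
      using x by (auto simp: a_kernel_def' E.carrier_coho g.map_cocycles)
  next
    fix S assume "S \<in> a_kernel (coho E n) (coho C (n + 1)) (\<delta> n)"
    then obtain z where z: "z \<in> cocycles E n" "S = E.cls n z"
      and S: "\<delta> n S = \<zero>\<^bsub>coho C (n + 1)\<^esub>"
      by (auto simp: a_kernel_def' E.carrier_coho)
    obtain x y where xy: "x \<in> carrier (obj D n)" "\<psi> n x = z"
      "y \<in> carrier (obj C (n + 1))" "\<phi> (n + 1) y = cobd D n x"
      using snake_exists[OF z(1)] .
    have "C.cls (n + 1) y = \<zero>\<^bsub>coho C (n + 1)\<^esub>" using S z connecting_cls[OF z(1) xy] by simp
    then obtain u where u: "u \<in> carrier (obj C n)" "y = cobd C n u"
      using C.cls_zero_iff[OF snake_cocycle[OF xy(1,3,4)]] by auto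
    \<comment> \<open>\<open>x\<close> need not be a cocycle, but
      \<open>d x = \<phi> (d u) = d (\<phi> u)\<close>; removing \<open>\<phi> u\<close> makes it
      one and leaves its image under \<open>\<psi>\<close> unchanged.\<close>
    define x' where "x' = x \<ominus>\<^bsub>obj D n\<^esub> \<phi> n u"
    have "cobd D n x = cobd D n (\<phi> n u)" using u xy by (simp add: f.map_cobd)
    then have "x' \<in> cocycles D n"
      using u xy lin_maps_closed[OF D.cobd_lin]
      by (simp add: x'_def D.cocycles_iff f.map_closed D1.minus_eq_zero_iff
          lin_maps_minus[OF D.cobd_lin D.linear_space_obj D.linear_space_obj])
    moreover have "\<psi> n x' = z"
      using u xy z by (simp add: x'_def g.map_minus f.map_closed comp_zero)
        (simp add: a_minus_def E.cocycles_iff)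
    ultimately show "S \<in> coho_map E \<psi> n ` carrier (coho D n)"
      using z by (auto simp: D.carrier_coho image_image g.coho_map_cls intro!: image_eqI[of _ _ x'])
  qed
  then show ?thesis unfolding exact_at_def using connecting_lin g.coho_map_lin by blast
qed

lemma exact_sub:
  "exact_at K (coho E n) (\<delta> n) (coho C (n + 1)) (coho_map D \<phi> (n + 1)) (coho D (n + 1))"
proof -
  have "\<delta> n ` carrier (coho E n) = a_kernel (coho C (n + 1)) (coho D (n + 1)) (coho_map D \<phi> (n + 1))"
  proof (intro equalityI subsetI)
    fix S assume "S \<in> \<delta> n ` carrier (coho E n)"
    then obtain z where z: "z \<in> cocycles E n" "S = \<delta> n (E.cls n z)" by (auto simp: E.carrier_coho)
    obtain x y where xy: "x \<in> carrier (obj D n)" "\<psi> n x = z"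
      "y \<in> carrier (obj C (n + 1))" "\<phi> (n + 1) y = cobd D n x"
      using snake_exists[OF z(1)] .
    have y: "y \<in> cocycles C (n + 1)" by (rule snake_cocycle[OF xy(1,3,4)])
    have "D.cls (n + 1) (\<phi> (n + 1) y) = \<zero>\<^bsub>coho D (n + 1)\<^esub>"
      using D.cls_zero_iff[OF f.map_cocycles[OF y]] xy by auto
    then show "S \<in> a_kernel (coho C (n + 1)) (coho D (n + 1)) (coho_map D \<phi> (n + 1))"
      using y by (auto simp: a_kernel_def' z connecting_cls[OF z(1) xy] C.carrier_coho f.coho_map_cls)
  next
    fix S assume "S \<in> a_kernel (coho C (n + 1)) (coho D (n + 1)) (coho_map D \<phi> (n + 1))"
    then obtain y where y: "y \<in> cocycles C (n + 1)" "S = C.cls (n + 1) y"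
      and "D.cls (n + 1) (\<phi> (n + 1) y) = \<zero>\<^bsub>coho D (n + 1)\<^esub>"
      by (auto simp: a_kernel_def' C.carrier_coho f.coho_map_cls)
    then obtain x where x: "x \<in> carrier (obj D n)" "\<phi> (n + 1) y = cobd D n x"
      using D.cls_zero_iff[OF f.map_cocycles[OF y(1)]] by auto
    have yc: "y \<in> carrier (obj C (n + 1))" using y C.cocycles_iff by blast
    have z: "\<psi> n x \<in> cocycles E n"
      using x comp_zero[OF yc] by (simp add: E.cocycles_iff g.map_closed g.map_cobd[symmetric])
    \<comment> \<open>The equation \<open>\<phi> y = d x\<close> obtained from the vanishing class
      is exactly the snake relation, read with \<open>\<psi> x\<close> as the starting
      cocycle.\<close>
    have "\<delta> n (E.cls n (\<psi> n x)) = S"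
      unfolding y(2) by (rule connecting_cls[OF z x(1) refl yc x(2)])
    then show "S \<in> \<delta> n ` carrier (coho E n)" using z by (auto simp: E.carrier_coho)
  qed
  then show ?thesis unfolding exact_at_def using connecting_lin f.coho_map_lin by blast
qed

end

text \<open>The image of \<open>\<phi>\<close> is a subcomplex because \<open>\<phi>\<close>
  commutes with the differentials. The first conclusion is the claim proper; the second puts the
  same facts into the locale in which the long sequence is derived.\<close>

lemma (in complex_map) short_exact_quotient:
  assumes "\<And>n. inj_on (\<phi> n) (carrier (obj C n))"
  defines "W \<equiv> (\<lambda>n. \<phi> n ` carrier (obj C n))"
  shows "short_exact_complexes K C \<phi> D (quot_proj D W) (quot_complex D W)"
    and "short_exact K C D (quot_complex D W) \<phi> (quot_proj D W)"
proof -
  let ?Q = "quot_complex D W" and ?\<pi> = "quot_proj D W"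
  have W: "submodule (W n) K (obj D n)" for n
    unfolding W_def by (rule submodule_image[OF map_lin C.linear_space_obj D.linear_space_obj])
  have dW: "cobd D n ` W n \<subseteq> W (n + 1)" for n
    using lin_maps_closed[OF C.cobd_lin] by (auto simp: W_def map_cobd[symmetric])
  have Q: "obj ?Q n = quot_module (obj D n) (W n)" for n by (simp add: quot_complex_def)
  have dQ: "cobd ?Q n (?\<pi> n x) = ?\<pi> (n + 1) (cobd D n x)" if "x \<in> carrier (obj D n)" for n x
    using linear_space.UN_coset_lin_map[OF D.linear_space_obj W D.linear_space_obj W D.cobd_lin dW that]
    by (simp add: quot_complex_def quot_proj_def)
  have carr: "carrier (obj ?Q n) = ?\<pi> n ` carrier (obj D n)" for n
    unfolding Q quot_proj_def by (rule linear_space.carrier_quot_module[OF D.linear_space_obj])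
  have \<pi>: "?\<pi> n \<in> lin_maps K (obj D n) (obj ?Q n)" for n
    unfolding Q quot_proj_def[abs_def]
    by (rule linear_space.coset_lin_map[OF D.linear_space_obj W])
  have ls: "linear_space K (obj ?Q n)" for n
    unfolding Q by (rule linear_space.linear_space_quot_module[OF D.linear_space_obj W])
  have "cobd ?Q n \<in> lin_maps K (obj ?Q n) (obj ?Q (n + 1))" for n
  proof -
    have "(\<lambda>x. ?\<pi> (n + 1) (cobd D n x)) \<in> lin_maps K (obj D n) (obj ?Q (n + 1))"
      by (rule lin_maps_comp[OF D.cobd_lin \<pi>])
    then have "cobd ?Q n \<in> lin_maps K (quot_module (obj D n) (W n)) (obj ?Q (n + 1))"
      using dQ by (intro linear_space.lin_maps_quotI[OF D.linear_space_obj W]) (auto simp: quot_proj_def)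
    then show ?thesis by (simp add: Q)
  qed
  moreover have "cobd ?Q (n + 1) (cobd ?Q n S) = \<zero>\<^bsub>obj ?Q (n + 1 + 1)\<^esub>"
    if "S \<in> carrier (obj ?Q n)" for n S
    using that lin_maps_closed[OF D.cobd_lin, of _ n] D.cobd_cobd[of _ n]
      lin_maps_zero[OF \<pi> D.linear_space_obj ls, of "n + 1 + 1"]
    by (auto simp: carr dQ simp del: add.assoc)
  ultimately have cQ: "cochain_complex K ?Q"
    using ls by (auto simp: cochain_complex_def linear_space_def)
  have c\<pi>: "cochain_map K D ?Q ?\<pi>"
    using \<pi> dQ by (auto simp: cochain_map_def)
  have Wker: "W n = a_kernel (obj D n) (obj ?Q n) (?\<pi> n)" for n
  proof -
    have "W n \<subseteq> carrier (obj D n)"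
      by (rule module.submoduleE(1)[OF linear_space.axioms[OF D.linear_space_obj] W])
    moreover have "?\<pi> n x = \<zero>\<^bsub>obj ?Q n\<^esub> \<longleftrightarrow> x \<in> W n" if "x \<in> carrier (obj D n)" for x
      unfolding Q quot_proj_def by (rule linear_space.coset_eq_zero_iff[OF D.linear_space_obj W that])
    ultimately show ?thesis unfolding a_kernel_def' by blast
  qed
  have ker: "\<phi> n ` carrier (obj C n) = a_kernel (obj D n) (obj ?Q n) (?\<pi> n)" for n
    using Wker[of n] by (simp only: W_def)
  show "short_exact_complexes K C \<phi> D ?\<pi> ?Q"
    unfolding short_exact_complexes_def exact_at_def
    by (intro conjI allI C.complex D.complex cQ cochain_map c\<pi> assms(1) map_lin \<pi> ker
        carr[symmetric])
  show "short_exact K C D ?Q \<phi> ?\<pi>"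
    by (intro short_exact.intro complex_map.intro short_exact_axioms.intro complex_map_axioms.intro
        complex.intro C.complex D.complex cQ cochain_map c\<pi> assms(1) ker carr[symmetric])
qed

section \<open>Multilinear maps and tensor products\<close>

lemma bilinear_opI:
  assumes "\<And>u v. u \<in> carrier U \<Longrightarrow> v \<in> carrier V \<Longrightarrow> m u v \<in> carrier W"
    and "\<And>u u' v. u \<in> carrier U \<Longrightarrow> u' \<in> carrier U \<Longrightarrow> v \<in> carrier V \<Longrightarrow>
      m (u \<oplus>\<^bsub>U\<^esub> u') v = m u v \<oplus>\<^bsub>W\<^esub> m u' v"
    and "\<And>u v v'. u \<in> carrier U \<Longrightarrow> v \<in> carrier V \<Longrightarrow> v' \<in> carrier V \<Longrightarrow>
      m u (v \<oplus>\<^bsub>V\<^esub> v') = m u v \<oplus>\<^bsub>W\<^esub> m u v'"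
    and "\<And>c u v. c \<in> carrier K \<Longrightarrow> u \<in> carrier U \<Longrightarrow> v \<in> carrier V \<Longrightarrow>
      m (c \<odot>\<^bsub>U\<^esub> u) v = c \<odot>\<^bsub>W\<^esub> m u v"
    and "\<And>c u v. c \<in> carrier K \<Longrightarrow> u \<in> carrier U \<Longrightarrow> v \<in> carrier V \<Longrightarrow>
      m u (c \<odot>\<^bsub>V\<^esub> v) = c \<odot>\<^bsub>W\<^esub> m u v"
  shows "bilinear_op K U V W m"
  using assms by (auto simp: bilinear_op_def intro!: lin_mapsI)

lemma bilinear_opD:
  assumes "bilinear_op K U V W m"
  shows "u \<in> carrier U \<Longrightarrow> m u \<in> lin_maps K V W"
    and "v \<in> carrier V \<Longrightarrow> (\<lambda>u. m u v) \<in> lin_maps K U W"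
    and "u \<in> carrier U \<Longrightarrow> v \<in> carrier V \<Longrightarrow> m u v \<in> carrier W"
    and "u \<in> carrier U \<Longrightarrow> u' \<in> carrier U \<Longrightarrow> v \<in> carrier V \<Longrightarrow>
      m (u \<oplus>\<^bsub>U\<^esub> u') v = m u v \<oplus>\<^bsub>W\<^esub> m u' v"
    and "u \<in> carrier U \<Longrightarrow> v \<in> carrier V \<Longrightarrow> v' \<in> carrier V \<Longrightarrow>
      m u (v \<oplus>\<^bsub>V\<^esub> v') = m u v \<oplus>\<^bsub>W\<^esub> m u v'"
    and "c \<in> carrier K \<Longrightarrow> u \<in> carrier U \<Longrightarrow> v \<in> carrier V \<Longrightarrow>
      m (c \<odot>\<^bsub>U\<^esub> u) v = c \<odot>\<^bsub>W\<^esub> m u v"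
    and "c \<in> carrier K \<Longrightarrow> u \<in> carrier U \<Longrightarrow> v \<in> carrier V \<Longrightarrow>
      m u (c \<odot>\<^bsub>V\<^esub> v) = c \<odot>\<^bsub>W\<^esub> m u v"
proof -
  show r: "m u \<in> lin_maps K V W" if "u \<in> carrier U" for u
    using assms that by (auto simp: bilinear_op_def)
  show l: "(\<lambda>u. m u v) \<in> lin_maps K U W" if "v \<in> carrier V" for v
    using assms that by (auto simp: bilinear_op_def)
  show "u \<in> carrier U \<Longrightarrow> v \<in> carrier V \<Longrightarrow> m u v \<in> carrier W"
    "u \<in> carrier U \<Longrightarrow> u' \<in> carrier U \<Longrightarrow> v \<in> carrier V \<Longrightarrow>
      m (u \<oplus>\<^bsub>U\<^esub> u') v = m u v \<oplus>\<^bsub>W\<^esub> m u' v"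
    "u \<in> carrier U \<Longrightarrow> v \<in> carrier V \<Longrightarrow> v' \<in> carrier V \<Longrightarrow>
      m u (v \<oplus>\<^bsub>V\<^esub> v') = m u v \<oplus>\<^bsub>W\<^esub> m u v'"
    "c \<in> carrier K \<Longrightarrow> u \<in> carrier U \<Longrightarrow> v \<in> carrier V \<Longrightarrow>
      m (c \<odot>\<^bsub>U\<^esub> u) v = c \<odot>\<^bsub>W\<^esub> m u v"
    "c \<in> carrier K \<Longrightarrow> u \<in> carrier U \<Longrightarrow> v \<in> carrier V \<Longrightarrow>
      m u (c \<odot>\<^bsub>V\<^esub> v) = c \<odot>\<^bsub>W\<^esub> m u v"
    using lin_maps_closed[OF r] lin_maps_add[OF r] lin_maps_smult[OF r]
      lin_maps_add[OF l] lin_maps_smult[OF l] by blast+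
qed

lemma bilinear_op_comp:
  assumes "bilinear_op K U V W m" and "f \<in> lin_maps K U' U" and "g \<in> lin_maps K V' V"
  shows "bilinear_op K U' V' W (\<lambda>u v. m (f u) (g v))"
  by (rule bilinear_opI)
    (use assms in \<open>simp_all add: bilinear_opD lin_maps_closed lin_maps_add lin_maps_smult\<close>)

lemma id_lin_map: "(\<lambda>x. x) \<in> lin_maps K U U"
  by (rule lin_mapsI) auto

context linear_space
begin

lemma lin_maps_plus:
  assumes "linear_space K U" and f: "f \<in> lin_maps K U M" and g: "g \<in> lin_maps K U M"
  shows "(\<lambda>x. f x \<oplus> g x) \<in> lin_maps K U M"
proof -
  interpret U: linear_space K U by fact
  show ?thesis
    by (rule lin_mapsI)
      (simp_all add: lin_maps_closed[OF f] lin_maps_closed[OF g] lin_maps_add[OF f] lin_maps_add[OF g]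
        lin_maps_smult[OF f] lin_maps_smult[OF g] M.a_ac smult_r_distr)
qed

lemma lin_maps_scale:
  assumes "linear_space K U" and f: "f \<in> lin_maps K U M" and c: "c \<in> carrier K"
  shows "(\<lambda>x. c \<odot> f x) \<in> lin_maps K U M"
  by (rule lin_maps_comp[OF f smult_lin_map[OF c]])

lemma lin_maps_const_zero: "(\<lambda>x. \<zero>) \<in> lin_maps K U M"
  by (rule lin_mapsI) auto

lemma neg_lin_map: "(\<lambda>x. \<ominus> x) \<in> lin_maps K M M"
  by (rule lin_mapsI) (auto simp: M.minus_add smult_r_minus)

lemma sgn_smult_lin_map: "sgn_smult M i \<in> lin_maps K M M"
  using neg_lin_map id_lin_map by (cases "even i") (simp_all add: sgn_smult_def[abs_def])

lemma lin_maps_finsum_pointwise: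
  assumes "linear_space K U" and "\<And>i. i \<in> I \<Longrightarrow> f i \<in> lin_maps K U M"
  shows "(\<lambda>x. \<Oplus>i\<in>I. f i x) \<in> lin_maps K U M"
proof (cases "finite I")
  case True
  then show ?thesis using assms(2)
  proof (induction I)
    case empty
    then show ?case using lin_maps_const_zero by simp
  next
    case (insert i I)
    interpret U: linear_space K U by fact
    have "(\<lambda>x. f i x \<oplus> (\<Oplus>i\<in>I. f i x)) \<in> lin_maps K U M"
      using insert by (intro lin_maps_plus[OF assms(1)]) auto
    then show ?case
    proof (rule lin_maps_cong[OF _ assms(1)])
      fix x assume "x \<in> carrier U"
      then show "(\<Oplus>i\<in>insert i I. f i x) = f i x \<oplus> (\<Oplus>i\<in>I. f i x)"
        using insert lin_maps_closed by (intro M.finsum_insert) fastforce+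
    qed
  qed
next
  case False
  then show ?thesis using lin_maps_const_zero by (simp add: M.finsum_infinite)
qed

end

lemma bilinear_op_plus:
  assumes "linear_space K U" and "linear_space K V" and "linear_space K W"
    and m: "bilinear_op K U V W m" and m': "bilinear_op K U V W m'"
  shows "bilinear_op K U V W (\<lambda>u v. m u v \<oplus>\<^bsub>W\<^esub> m' u v)"
proof -
  interpret W: linear_space K W by fact
  show ?thesis
    unfolding bilinear_op_def
    by (intro ballI conjI W.lin_maps_plus assms(1,2) bilinear_opD[OF m] bilinear_opD[OF m'])
qed

subsection \<open>Multilinear maps on lists\<close>

lemma tuples_0 [simp]: "tuples U 0 = {[]}"
  by (auto simp: tuples_def)

lemma tuples_Suc: "tuples U (Suc n) = {x # xs |x xs. x \<in> carrier U \<and> xs \<in> tuples U n}"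
  by (auto simp: tuples_def length_Suc_conv)

lemma Cons_tuples [simp]: "x # xs \<in> tuples U (Suc n) \<longleftrightarrow> x \<in> carrier U \<and> xs \<in> tuples U n"
  by (auto simp: tuples_def)

lemma tuples_length: "xs \<in> tuples U n \<Longrightarrow> length xs = n"
  by (simp add: tuples_def)

lemma tuples_update: "xs \<in> tuples U n \<Longrightarrow> x \<in> carrier U \<Longrightarrow> xs[i := x] \<in> tuples U n"
  using set_update_subset_insert[of xs i x] by (auto simp: tuples_def)

lemma multilinear_closed: "multilinear K U V n F \<Longrightarrow> xs \<in> tuples U n \<Longrightarrow> F xs \<in> carrier V"
  by (auto simp: multilinear_def)

lemma multilinear_slot:
  "multilinear K U V n F \<Longrightarrow> xs \<in> tuples U n \<Longrightarrow> i < n \<Longrightarrow>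
    (\<lambda>x. F (xs[i := x])) \<in> lin_maps K U V"
  by (auto simp: multilinear_def)

lemma multilinear_comp:
  "multilinear K U V n F \<Longrightarrow> h \<in> lin_maps K V W \<Longrightarrow> multilinear K U W n (\<lambda>xs. h (F xs))"
  unfolding multilinear_def
  by (intro ballI conjI allI impI lin_maps_comp[of _ K U V h W]) (auto simp: lin_maps_closed)

lemma multilinear_cong:
  assumes "multilinear K U V n F" and "linear_space K U"
    and "\<And>xs. xs \<in> tuples U n \<Longrightarrow> G xs = F xs"
  shows "multilinear K U V n G"
  unfolding multilinear_def
proof (intro ballI conjI allI impI)
  fix xs i assume xs: "xs \<in> tuples U n"
  show "G xs \<in> carrier V" using multilinear_closed[OF assms(1) xs] assms(3)[OF xs] by simp
  assume "i < n"
  then show "(\<lambda>x. G (xs[i := x])) \<in> lin_maps K U V"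
    by (rule lin_maps_cong[OF multilinear_slot[OF assms(1) xs] assms(2)])
      (simp add: assms(3) tuples_update[OF xs])
qed

context linear_space
begin

lemma multilinear_plus:
  assumes "linear_space K U" and "multilinear K U M n F" and "multilinear K U M n G"
  shows "multilinear K U M n (\<lambda>xs. F xs \<oplus> G xs)"
  using assms lin_maps_plus[OF assms(1)] by (auto simp: multilinear_def)

lemma multilinear_finsum:
  assumes "linear_space K U" and "\<And>i. i \<in> I \<Longrightarrow> multilinear K U M n (F i)"
  shows "multilinear K U M n (\<lambda>xs. \<Oplus>i\<in>I. F i xs)"
  using assms(2) unfolding multilinear_def
  by (intro ballI conjI allI impI M.finsum_closed lin_maps_finsum_pointwise[OF assms(1)]) auto

lemma multilinear_zero: "multilinear K U M n (\<lambda>xs. \<zero>)"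
  using lin_maps_const_zero by (auto simp: multilinear_def)

lemma multilinear_scale:
  "multilinear K U M n F \<Longrightarrow> c \<in> carrier K \<Longrightarrow> multilinear K U M n (\<lambda>xs. c \<odot> F xs)"
  by (rule multilinear_comp[OF _ smult_lin_map])

lemma multilinear_sgn:
  "multilinear K U M n F \<Longrightarrow> multilinear K U M n (\<lambda>xs. sgn_smult M i (F xs))"
  by (rule multilinear_comp[OF _ sgn_smult_lin_map])

end

text \<open>Splits off the first slot, so that multilinearity can follow the recursion on lists; the
  inductions on the number of slots go through this equivalence.\<close>

lemma multilinear_Suc_iff:
  assumes "linear_space K U"
  shows "multilinear K U V (Suc n) F \<longleftrightarrow>
    (\<forall>x\<in>carrier U. multilinear K U V n (\<lambda>xs. F (x # xs))) \<and>
    (\<forall>xs\<in>tuples U n. (\<lambda>x. F (x # xs)) \<in> lin_maps K U V)"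
proof (intro iffI conjI ballI)
  interpret U: linear_space K U by fact
  assume F: "multilinear K U V (Suc n) F"
  show "multilinear K U V n (\<lambda>xs. F (x # xs))" if x: "x \<in> carrier U" for x
    unfolding multilinear_def
  proof (intro ballI conjI allI impI)
    fix xs i assume xs: "xs \<in> tuples U n"
    show "F (x # xs) \<in> carrier V" using multilinear_closed[OF F] x xs by simp
    assume "i < n"
    then show "(\<lambda>y. F (x # xs[i := y])) \<in> lin_maps K U V"
      using multilinear_slot[OF F, of "x # xs" "Suc i"] x xs by simp
  qed
  \<comment> \<open>The slot lemma updates a given tuple; zero is a placeholder head that the update
    overwrites.\<close>
  show "(\<lambda>x. F (x # xs)) \<in> lin_maps K U V" if "xs \<in> tuples U n" for xs
    using multilinear_slot[OF F, of "\<zero>\<^bsub>U\<^esub> # xs" 0] that by simp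
next
  assume F: "(\<forall>x\<in>carrier U. multilinear K U V n (\<lambda>xs. F (x # xs))) \<and>
    (\<forall>xs\<in>tuples U n. (\<lambda>x. F (x # xs)) \<in> lin_maps K U V)"
  show "multilinear K U V (Suc n) F"
    unfolding multilinear_def
  proof (intro ballI conjI allI impI)
    fix xs i assume "xs \<in> tuples U (Suc n)"
    then obtain y ys where xs: "xs = y # ys" "y \<in> carrier U" "ys \<in> tuples U n"
      by (auto simp: tuples_Suc)
    then show "F xs \<in> carrier V" using F multilinear_closed by blast
    assume i: "i < Suc n"
    show "(\<lambda>x. F (xs[i := x])) \<in> lin_maps K U V"
      using F xs i multilinear_slot[of K U V n "\<lambda>xs. F (y # xs)" ys "i - 1"] by (cases i) auto
  qed
qed

lemma multilinear_0_iff: "multilinear K U V 0 F \<longleftrightarrow> F [] \<in> carrier V"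
  by (auto simp: multilinear_def)

subsection \<open>Free modules\<close>

lemma linear_space_free_module:
  fixes K :: "'k ring" and S :: "'s set"
  assumes "cring K"
  shows "linear_space K (free_module K S)"
proof -
  interpret cring K by fact
  have supp: "{s. p s \<oplus>\<^bsub>K\<^esub> q s \<noteq> \<zero>\<^bsub>K\<^esub>} \<subseteq> {s. p s \<noteq> \<zero>\<^bsub>K\<^esub>} \<union> {s. q s \<noteq> \<zero>\<^bsub>K\<^esub>}"
    "c \<in> carrier K \<Longrightarrow> {s. c \<otimes>\<^bsub>K\<^esub> p s \<noteq> \<zero>\<^bsub>K\<^esub>} \<subseteq> {s. p s \<noteq> \<zero>\<^bsub>K\<^esub>}" for p q :: "'s \<Rightarrow> 'k" and c
    by auto
  show ?thesis
  proof (rule linear_space.intro, rule moduleI)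
    show "abelian_group (free_module K S)"
    proof (rule abelian_groupI)
      show "x \<oplus>\<^bsub>free_module K S\<^esub> y \<in> carrier (free_module K S)"
        if "x \<in> carrier (free_module K S)" "y \<in> carrier (free_module K S)" for x y
        using that finite_subset[OF supp(1)[of x y]] supp(1)[of x y]
        by (auto simp: free_module_def)
      show "\<exists>y\<in>carrier (free_module K S). y \<oplus>\<^bsub>free_module K S\<^esub> x = \<zero>\<^bsub>free_module K S\<^esub>"
        if "x \<in> carrier (free_module K S)" for x
      proof (intro bexI)
        have *: "\<ominus>\<^bsub>K\<^esub> x s \<noteq> \<zero>\<^bsub>K\<^esub> \<longleftrightarrow> x s \<noteq> \<zero>\<^bsub>K\<^esub>" for s
          using that add.inv_eq_1_iff[of "x s"] by (simp add: free_module_def)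
        then show "(\<lambda>s. \<ominus>\<^bsub>K\<^esub> x s) \<in> carrier (free_module K S)"
          using that by (simp add: free_module_def)
        show "(\<lambda>s. \<ominus>\<^bsub>K\<^esub> x s) \<oplus>\<^bsub>free_module K S\<^esub> x = \<zero>\<^bsub>free_module K S\<^esub>"
          using that by (simp add: free_module_def l_neg)
      qed
    qed (auto simp: free_module_def a_ac)
    show "c \<odot>\<^bsub>free_module K S\<^esub> x \<in> carrier (free_module K S)"
      if "c \<in> carrier K" "x \<in> carrier (free_module K S)" for c x
      using that finite_subset[OF supp(2)[of c x]] supp(2)[of c x]
      by (auto simp: free_module_def)
  qed (auto simp: free_module_def l_distr r_distr m_assoc intro: assms)
qed

lemma single_closed: "cring K \<Longrightarrow> s \<in> S \<Longrightarrow> single K s \<in> carrier (free_module K S)"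
  by (auto simp: single_def free_module_def cring.cring_simprules)

text \<open>Induction on a finite set \<open>T\<close> around the support, removing one basis vector
  at a time. As \<open>T\<close> is only a superset of the support, no case distinction arises on
  whether the removed coefficient vanishes.\<close>

lemma free_module_ext:
  assumes "linear_space K V" and "h \<in> lin_maps K (free_module K S) V"
    and "g \<in> lin_maps K (free_module K S) V" and "\<And>s. s \<in> S \<Longrightarrow> h (single K s) = g (single K s)"
    and "p \<in> carrier (free_module K S)"
  shows "h p = g p"
proof -
  interpret V: linear_space K V by fact
  interpret F: linear_space K "free_module K S"
    by (rule linear_space_free_module[OF V.R.is_cring])
  have "finite T \<Longrightarrow> T \<subseteq> S \<Longrightarrow> p \<in> carrier (free_module K S) \<Longrightarrow> {s. p s \<noteq> \<zero>\<^bsub>K\<^esub>} \<subseteq> T \<Longrightarrow> h p = g p"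
    for T p
  proof (induction T arbitrary: p rule: finite_induct)
    case empty
    then have "p = \<zero>\<^bsub>free_module K S\<^esub>" by (auto simp: free_module_def)
    then show ?case
      using lin_maps_zero[OF assms(2) F.linear_space_axioms assms(1)]
        lin_maps_zero[OF assms(3) F.linear_space_axioms assms(1)] by simp
  next
    case (insert t T)
    define q where "q = p(t := \<zero>\<^bsub>K\<^esub>)"
    have p: "\<And>s. p s \<in> carrier K" using insert.prems by (simp add: free_module_def)
    have q: "q \<in> carrier (free_module K S)"
    proof -
      have "{s. q s \<noteq> \<zero>\<^bsub>K\<^esub>} \<subseteq> {s. p s \<noteq> \<zero>\<^bsub>K\<^esub>}" by (auto simp: q_def)
      then show ?thesis
        using insert.prems p by (auto simp: free_module_def q_def intro: finite_subset)
    qed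
    have "{s. q s \<noteq> \<zero>\<^bsub>K\<^esub>} \<subseteq> T" using insert.prems by (auto simp: q_def)
    then have "h q = g q" using insert.prems q by (intro insert.IH) auto
    moreover have t: "single K t \<in> carrier (free_module K S)"
      using insert.prems by (intro single_closed V.R.is_cring) auto
    moreover have "p = q \<oplus>\<^bsub>free_module K S\<^esub> (p t \<odot>\<^bsub>free_module K S\<^esub> single K t)"
      using p by (auto simp: q_def free_module_def single_def)
    then have split: "f p = f q \<oplus>\<^bsub>V\<^esub> (p t \<odot>\<^bsub>V\<^esub> f (single K t))" if "f \<in> lin_maps K (free_module K S) V" for f
      using q t p lin_maps_add[OF that] lin_maps_smult[OF that] by (metis F.smult_closed)
    ultimately show ?case
      using split[OF assms(2)] split[OF assms(3)] assms(4)[of t] insert.prems by simp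
  qed
  then show ?thesis using assms(5) by (auto simp: free_module_def)
qed

context linear_space
begin

text \<open>The linear extension of \<open>g\<close> from the basis vectors
  \<open>single K s\<close>. The sum runs over the support of \<open>p\<close>, which is finite for
  elements of a free module.\<close>

definition lin_ext :: "('s \<Rightarrow> 'v) \<Rightarrow> ('s \<Rightarrow> 'k) \<Rightarrow> 'v"
  where "lin_ext g p = (\<Oplus>s\<in>{s. p s \<noteq> \<zero>\<^bsub>K\<^esub>}. p s \<odot> g s)"

text \<open>Enlarging the index set makes sums over different supports comparable, as additivity of
  \<open>lin_ext\<close> requires.\<close>

lemma lin_ext_eq:
  assumes "g \<in> S \<rightarrow> carrier M" and "p \<in> carrier (free_module K S)"
    and "finite T" and "{s. p s \<noteq> \<zero>\<^bsub>K\<^esub>} \<subseteq> T" and "T \<subseteq> S"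
  shows "lin_ext g p = (\<Oplus>s\<in>T. p s \<odot> g s)"
  unfolding lin_ext_def
  using assms
  by (intro M.add.finprod_mono_neutral_cong_left) (auto simp: free_module_def Pi_def subset_iff)

lemma lin_ext_lin:
  assumes "g \<in> S \<rightarrow> carrier M"
  shows "lin_ext g \<in> lin_maps K (free_module K S) M"
proof (rule lin_mapsI)
  interpret F: linear_space K "free_module K S"
    by (rule linear_space_free_module[OF R.is_cring])
  fix p assume p: "p \<in> carrier (free_module K S)"
  have pc: "p s \<in> carrier K" for s using p by (simp add: free_module_def)
  have psupp: "finite {s. p s \<noteq> \<zero>\<^bsub>K\<^esub>}" "{s. p s \<noteq> \<zero>\<^bsub>K\<^esub>} \<subseteq> S" using p by (auto simp: free_module_def)
  have gc: "g s \<in> carrier M" if "s \<in> S" for s using assms that by auto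
  show "lin_ext g p \<in> carrier M"
    unfolding lin_ext_def using pc gc psupp by (intro M.finsum_closed) auto
  show "lin_ext g (c \<odot>\<^bsub>free_module K S\<^esub> p) = c \<odot> lin_ext g p" if c: "c \<in> carrier K" for c
  proof -
    let ?T = "{s. p s \<noteq> \<zero>\<^bsub>K\<^esub>}"
    have "{s. (c \<odot>\<^bsub>free_module K S\<^esub> p) s \<noteq> \<zero>\<^bsub>K\<^esub>} \<subseteq> ?T"
      using c by (auto simp: free_module_def)
    then have "lin_ext g (c \<odot>\<^bsub>free_module K S\<^esub> p) = (\<Oplus>s\<in>?T. (c \<odot>\<^bsub>free_module K S\<^esub> p) s \<odot> g s)"
      using p c psupp by (intro lin_ext_eq[OF assms] F.smult_closed)
    also have "\<dots> = (\<Oplus>s\<in>?T. c \<odot> (p s \<odot> g s))"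
      using c pc gc psupp by (intro M.finsum_cong') (auto simp: free_module_def smult_assoc1)
    also have "\<dots> = c \<odot> lin_ext g p"
      unfolding lin_ext_def using c pc gc psupp by (intro finsum_smult_ldistr[symmetric]) auto
    finally show ?thesis .
  qed
  fix q assume q: "q \<in> carrier (free_module K S)"
  have qc: "q s \<in> carrier K" for s using q by (simp add: free_module_def)
  have qsupp: "finite {s. q s \<noteq> \<zero>\<^bsub>K\<^esub>}" "{s. q s \<noteq> \<zero>\<^bsub>K\<^esub>} \<subseteq> S" using q by (auto simp: free_module_def)
  let ?T = "{s. p s \<noteq> \<zero>\<^bsub>K\<^esub>} \<union> {s. q s \<noteq> \<zero>\<^bsub>K\<^esub>}"
  have "{s. (p \<oplus>\<^bsub>free_module K S\<^esub> q) s \<noteq> \<zero>\<^bsub>K\<^esub>} \<subseteq> ?T" by (auto simp: free_module_def)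
  then have "lin_ext g (p \<oplus>\<^bsub>free_module K S\<^esub> q) = (\<Oplus>s\<in>?T. (p \<oplus>\<^bsub>free_module K S\<^esub> q) s \<odot> g s)"
    using p q psupp qsupp by (intro lin_ext_eq[OF assms] F.a_closed) auto
  also have "\<dots> = (\<Oplus>s\<in>?T. p s \<odot> g s \<oplus> q s \<odot> g s)"
    using pc qc gc psupp qsupp by (intro M.finsum_cong') (auto simp: free_module_def smult_l_distr)
  also have "\<dots> = (\<Oplus>s\<in>?T. p s \<odot> g s) \<oplus> (\<Oplus>s\<in>?T. q s \<odot> g s)"
    using pc qc gc psupp qsupp by (intro M.finsum_addf) auto
  also have "\<dots> = lin_ext g p \<oplus> lin_ext g q"
    using p q psupp qsupp
    by (intro arg_cong2[of _ _ _ _ "add M"] lin_ext_eq[OF assms, symmetric]) auto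
  finally show "lin_ext g (p \<oplus>\<^bsub>free_module K S\<^esub> q) = lin_ext g p \<oplus> lin_ext g q" .
qed

lemma lin_ext_single:
  assumes "g \<in> S \<rightarrow> carrier M" and "s \<in> S"
  shows "lin_ext g (single K s) = g s"
proof -
  have "lin_ext g (single K s) = (\<Oplus>t\<in>{s}. single K s t \<odot> g t)"
    using assms(2) single_closed[OF R.is_cring assms(2)]
    by (intro lin_ext_eq[OF assms(1)]) (auto simp: single_def)
  also have "\<dots> = g s" using assms funcset_mem[OF assms] by (subst M.finsum_insert) (auto simp: single_def)
  finally show ?thesis .
qed

end

subsection \<open>The universal property of the tensor product\<close>

locale tensor_product = U: linear_space K U + V: linear_space K V
  for K :: "'k ring" and U :: "('k, 'u, 'c) module_scheme" and V :: "('k, 'v, 'd) module_scheme"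
begin

abbreviation F :: "('k, 'u \<times> 'v \<Rightarrow> 'k) module"
  where "F \<equiv> free_module K (carrier U \<times> carrier V)"

abbreviation T where "T \<equiv> tensor K U V"
abbreviation pure where "pure \<equiv> pure_tensor K U V"
abbreviation e where "e u v \<equiv> single K (u, v)"

sublocale F: linear_space K F
  by (rule linear_space_free_module[OF U.R.is_cring])

lemma e_closed: "u \<in> carrier U \<Longrightarrow> v \<in> carrier V \<Longrightarrow> e u v \<in> carrier F"
  by (auto intro: single_closed[OF U.R.is_cring])

text \<open>The generating set inside \<open>tensor_relations\<close>, named to separate it from the
  hull around it.\<close>

definition relators :: "('u \<times> 'v \<Rightarrow> 'k) set"
  where "relators =
    {e (u \<oplus>\<^bsub>U\<^esub> u') v \<ominus>\<^bsub>F\<^esub> (e u v \<oplus>\<^bsub>F\<^esub> e u' v) |u u' v.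
          u \<in> carrier U \<and> u' \<in> carrier U \<and> v \<in> carrier V} \<union>
       {e u (v \<oplus>\<^bsub>V\<^esub> v') \<ominus>\<^bsub>F\<^esub> (e u v \<oplus>\<^bsub>F\<^esub> e u v') |u v v'.
          u \<in> carrier U \<and> v \<in> carrier V \<and> v' \<in> carrier V} \<union>
       {e (c \<odot>\<^bsub>U\<^esub> u) v \<ominus>\<^bsub>F\<^esub> c \<odot>\<^bsub>F\<^esub> e u v |c u v.
          c \<in> carrier K \<and> u \<in> carrier U \<and> v \<in> carrier V} \<union>
       {e u (c \<odot>\<^bsub>V\<^esub> v) \<ominus>\<^bsub>F\<^esub> c \<odot>\<^bsub>F\<^esub> e u v |c u v.
          c \<in> carrier K \<and> u \<in> carrier U \<and> v \<in> carrier V}"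

lemma tensor_relations_eq: "tensor_relations K U V = (\<lambda>W. submodule W K F) hull relators"
  by (simp add: tensor_relations_def relators_def Let_def)

lemma relators_subset: "relators \<subseteq> carrier F"
  by (auto simp: relators_def intro!: F.minus_closed F.a_closed F.smult_closed e_closed)

lemma submodule_relations: "submodule (tensor_relations K U V) K F"
  unfolding tensor_relations_eq by (rule F.submodule_hull[OF relators_subset])

lemma linear_space_tensor: "linear_space K T"
  unfolding tensor_def by (rule F.linear_space_quot_module[OF submodule_relations])

sublocale T: linear_space K T
  by (rule linear_space_tensor)

lemma pure_eq: "pure u v = tensor_relations K U V +>\<^bsub>F\<^esub> e u v"
  by (simp add: pure_tensor_def)

lemma relation_eq:
  assumes "x \<in> carrier F" and "y \<in> carrier F" and "x \<ominus>\<^bsub>F\<^esub> y \<in> relators"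
  shows "tensor_relations K U V +>\<^bsub>F\<^esub> x = tensor_relations K U V +>\<^bsub>F\<^esub> y"
proof -
  have "x \<ominus>\<^bsub>F\<^esub> y \<in> tensor_relations K U V"
    unfolding tensor_relations_eq by (rule hull_inc[OF assms(3)])
  then show ?thesis using F.coset_eq_iff[OF submodule_relations assms(1,2)] by blast
qed

lemma coset_lin: "(\<lambda>x. tensor_relations K U V +>\<^bsub>F\<^esub> x) \<in> lin_maps K F T"
  unfolding tensor_def by (rule F.coset_lin_map[OF submodule_relations])

lemma pure_bilinear: "bilinear_op K U V T pure"
proof (rule bilinear_opI)
  note simps = pure_eq lin_maps_add[OF coset_lin, symmetric] lin_maps_smult[OF coset_lin, symmetric]
    e_closed
  fix u v assume u: "u \<in> carrier U" and v: "v \<in> carrier V"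
  show "pure u v \<in> carrier T"
    unfolding pure_eq by (rule lin_maps_closed[OF coset_lin e_closed[OF u v]])
  show "pure (u \<oplus>\<^bsub>U\<^esub> u') v = pure u v \<oplus>\<^bsub>T\<^esub> pure u' v" if "u' \<in> carrier U" for u'
    using u v that by (simp add: simps) (rule relation_eq, auto simp: relators_def e_closed)
  show "pure u (v \<oplus>\<^bsub>V\<^esub> v') = pure u v \<oplus>\<^bsub>T\<^esub> pure u v'" if "v' \<in> carrier V" for v'
    using u v that by (simp add: simps) (rule relation_eq, auto simp: relators_def e_closed)
  show "pure (c \<odot>\<^bsub>U\<^esub> u) v = c \<odot>\<^bsub>T\<^esub> pure u v" if "c \<in> carrier K" for c
    using u v that by (simp add: simps) (rule relation_eq, auto simp: relators_def e_closed)
  show "pure u (c \<odot>\<^bsub>V\<^esub> v) = c \<odot>\<^bsub>T\<^esub> pure u v" if "c \<in> carrier K" for c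
    using u v that by (simp add: simps) (rule relation_eq, auto simp: relators_def e_closed)
qed

lemmas pure_closed = bilinear_opD(3)[OF pure_bilinear]

text \<open>Bilinearity of \<open>g\<close> says precisely that its linear extension kills the four
  families of relators. The kernel is a submodule, so it contains their hull, and the extension
  descends to the quotient.\<close>

lemma tensor_lift:
  assumes "linear_space K W" and "bilinear_op K U V W g"
  shows "\<exists>h. h \<in> lin_maps K T W \<and> (\<forall>u\<in>carrier U. \<forall>v\<in>carrier V. h (pure u v) = g u v)"
proof -
  interpret W: linear_space K W by fact
  let ?g = "\<lambda>(u, v). g u v"
  note g = bilinear_opD[OF assms(2)]
  have gc: "?g \<in> carrier U \<times> carrier V \<rightarrow> carrier W" using g(3) by auto
  have L: "W.lin_ext ?g \<in> lin_maps K F W" by (rule W.lin_ext_lin[OF gc])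
  have Le: "W.lin_ext ?g (e u v) = g u v" if "u \<in> carrier U" "v \<in> carrier V" for u v
    using W.lin_ext_single[OF gc, of "(u, v)"] that by simp
  have "tensor_relations K U V \<subseteq> a_kernel F W (W.lin_ext ?g)"
    unfolding tensor_relations_eq
  proof (rule hull_minimal)
    show "submodule (a_kernel F W (W.lin_ext ?g)) K F"
      by (rule submodule_kernel[OF L F.linear_space_axioms assms(1)])
    have "W.lin_ext ?g r = \<zero>\<^bsub>W\<^esub>" if "r \<in> relators" for r
    proof -
      have "W.lin_ext ?g (x \<ominus>\<^bsub>F\<^esub> y) = W.lin_ext ?g x \<ominus>\<^bsub>W\<^esub> W.lin_ext ?g y"
        if "x \<in> carrier F" "y \<in> carrier F" for x y
        by (rule lin_maps_minus[OF L F.linear_space_axioms assms(1) that])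
      then show ?thesis using that
        by (auto simp: relators_def e_closed lin_maps_add[OF L] lin_maps_smult[OF L] Le g
            W.minus_eq_zero_iff)
    qed
    then show "relators \<subseteq> a_kernel F W (W.lin_ext ?g)"
      using relators_subset by (auto simp: a_kernel_def')
  qed
  then have "\<exists>h\<in>lin_maps K T W. \<forall>x\<in>carrier F. h (tensor_relations K U V +>\<^bsub>F\<^esub> x) = W.lin_ext ?g x"
    unfolding tensor_def
    by (intro F.quot_lift_exists[OF submodule_relations L assms(1)]) (auto simp: a_kernel_def')
  then show ?thesis using Le e_closed unfolding pure_eq by force
qed

lemma tensor_ext:
  assumes "linear_space K W" and "h \<in> lin_maps K T W" and "g \<in> lin_maps K T W"
    and "\<And>u v. u \<in> carrier U \<Longrightarrow> v \<in> carrier V \<Longrightarrow> h (pure u v) = g (pure u v)"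
    and "x \<in> carrier T"
  shows "h x = g x"
proof -
  obtain p where p: "p \<in> carrier F" "x = tensor_relations K U V +>\<^bsub>F\<^esub> p"
    using assms(5) F.carrier_quot_module by (auto simp: tensor_def)
  show ?thesis
    unfolding p(2)
    by (rule free_module_ext[OF assms(1) lin_maps_comp[OF coset_lin assms(2)]
          lin_maps_comp[OF coset_lin assms(3)] _ p(1)])
      (use assms(4) in \<open>auto simp: pure_eq\<close>)
qed

lemma map2_pure_tuples:
  "us \<in> tuples U n \<Longrightarrow> vs \<in> tuples V n \<Longrightarrow> map2 pure us vs \<in> tuples T n"
  by (auto simp: tuples_def set_zip intro!: pure_closed subsetD[OF _ nth_mem])

text \<open>Pure tensors span, one slot at a time: the induction hypothesis frees the tail while the
  head is still pure, and \<open>tensor_ext\<close> then frees the head.\<close>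

lemma multilinear_tensor_ext:
  assumes "linear_space K W" and "multilinear K T W n H" and "multilinear K T W n G"
    and "\<And>us vs. us \<in> tuples U n \<Longrightarrow> vs \<in> tuples V n \<Longrightarrow> H (map2 pure us vs) = G (map2 pure us vs)"
    and "xs \<in> tuples T n"
  shows "H xs = G xs"
  using assms(2-5)
proof (induction n arbitrary: H G xs)
  case 0
  then show ?case by simp
next
  case (Suc n)
  then obtain y ys where xs: "xs = y # ys" "y \<in> carrier T" "ys \<in> tuples T n"
    by (auto simp: tuples_Suc)
  note F = Suc.prems(1)[unfolded multilinear_Suc_iff[OF linear_space_tensor]]
    and G = Suc.prems(2)[unfolded multilinear_Suc_iff[OF linear_space_tensor]]
  have "H (pure u v # ys) = G (pure u v # ys)" if "u \<in> carrier U" "v \<in> carrier V" for u v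
  proof (rule Suc.IH[OF _ _ _ xs(3)])
    show "multilinear K T W n (\<lambda>xs. H (pure u v # xs))" "multilinear K T W n (\<lambda>xs. G (pure u v # xs))"
      using F G pure_closed that by blast+
    show "H (pure u v # map2 pure us vs) = G (pure u v # map2 pure us vs)"
      if "us \<in> tuples U n" "vs \<in> tuples V n" for us vs
      using Suc.prems(3)[of "u # us" "v # vs"] that \<open>u \<in> carrier U\<close> \<open>v \<in> carrier V\<close> by simp
  qed
  then show ?case
    unfolding xs(1) using F G xs
    by (intro tensor_ext[OF assms(1), of "\<lambda>y. H (y # ys)" "\<lambda>y. G (y # ys)" y]) auto
qed

text \<open>Linearity in each of the \<open>2 n\<close> arguments, with the factors from
  \<open>U\<close> and from \<open>V\<close> kept in separate lists, as they appear in the formula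
  for \<open>Psi\<close>.\<close>

definition bimultilinear :: "('k, 'w, 'e) module_scheme \<Rightarrow> nat \<Rightarrow> ('u list \<Rightarrow> 'v list \<Rightarrow> 'w) \<Rightarrow> bool"
  where "bimultilinear W n G \<longleftrightarrow>
    (\<forall>us\<in>tuples U n. multilinear K V W n (G us)) \<and>
    (\<forall>vs\<in>tuples V n. multilinear K U W n (\<lambda>us. G us vs))"

lemma bimultilinear_Suc:
  assumes "bimultilinear W (Suc n) G"
  shows "u \<in> carrier U \<Longrightarrow> v \<in> carrier V \<Longrightarrow> bimultilinear W n (\<lambda>us vs. G (u # us) (v # vs))"
    and "us \<in> tuples U n \<Longrightarrow> vs \<in> tuples V n \<Longrightarrow> bilinear_op K U V W (\<lambda>u v. G (u # us) (v # vs))"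
  using assms
  by (auto simp: bimultilinear_def bilinear_op_def multilinear_Suc_iff[OF U.linear_space_axioms]
      multilinear_Suc_iff[OF V.linear_space_axioms])

text \<open>Fixing the first pair \<open>(u, v)\<close> leaves a problem with one slot less. Its
  solutions depend bilinearly on \<open>(u, v)\<close>, so the first slot can be lifted as
  well.\<close>

lemma multilinear_tensor_lift:
  assumes "linear_space K W" and "bimultilinear W n G"
  shows "\<exists>H. multilinear K T W n H \<and>
    (\<forall>us\<in>tuples U n. \<forall>vs\<in>tuples V n. H (map2 pure us vs) = G us vs)"
  using assms(2)
proof (induction n arbitrary: G)
  case 0
  then have "G [] [] \<in> carrier W" by (auto simp: bimultilinear_def multilinear_0_iff)
  then show ?case by (intro exI[of _ "\<lambda>_. G [] []"]) (auto simp: multilinear_0_iff)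
next
  case (Suc n)
  interpret W: linear_space K W by fact
  have "\<exists>H. \<forall>u\<in>carrier U. \<forall>v\<in>carrier V. multilinear K T W n (H u v) \<and>
    (\<forall>us\<in>tuples U n. \<forall>vs\<in>tuples V n. H u v (map2 pure us vs) = G (u # us) (v # vs))"
    using Suc.IH[OF bimultilinear_Suc(1)[OF Suc.prems]] by metis
  then obtain H where H: "\<And>u v. u \<in> carrier U \<Longrightarrow> v \<in> carrier V \<Longrightarrow> multilinear K T W n (H u v)"
    and Hp: "\<And>u v us vs. u \<in> carrier U \<Longrightarrow> v \<in> carrier V \<Longrightarrow> us \<in> tuples U n \<Longrightarrow> vs \<in> tuples V n \<Longrightarrow>
      H u v (map2 pure us vs) = G (u # us) (v # vs)"
    by blast
  \<comment> \<open>The maps \<open>H u v\<close> were picked separately for each pair, so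
    bilinearity in \<open>(u, v)\<close> is not built in. It follows from uniqueness: both sides of
    each equation are multilinear and agree on pure tensors.\<close>
  have bil: "bilinear_op K U V W (\<lambda>u v. H u v xs)" if xs: "xs \<in> tuples T n" for xs
  proof (rule bilinear_opI)
    note Gb = bilinear_opD[OF bimultilinear_Suc(2)[OF Suc.prems]]
    fix u v assume u: "u \<in> carrier U" and v: "v \<in> carrier V"
    show "H u v xs \<in> carrier W" using multilinear_closed[OF H[OF u v] xs] .
    show "H (u \<oplus>\<^bsub>U\<^esub> u') v xs = H u v xs \<oplus>\<^bsub>W\<^esub> H u' v xs" if "u' \<in> carrier U" for u'
      by (rule multilinear_tensor_ext[OF assms(1) H W.multilinear_plus[OF T.linear_space_axioms H H] _ xs])
        (use u v that in \<open>simp_all add: Hp Gb\<close>)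
    show "H u (v \<oplus>\<^bsub>V\<^esub> v') xs = H u v xs \<oplus>\<^bsub>W\<^esub> H u v' xs" if "v' \<in> carrier V" for v'
      by (rule multilinear_tensor_ext[OF assms(1) H W.multilinear_plus[OF T.linear_space_axioms H H] _ xs])
        (use u v that in \<open>simp_all add: Hp Gb\<close>)
    show "H (c \<odot>\<^bsub>U\<^esub> u) v xs = c \<odot>\<^bsub>W\<^esub> H u v xs" if "c \<in> carrier K" for c
      by (rule multilinear_tensor_ext[OF assms(1) H W.multilinear_scale[OF H] _ xs])
        (use u v that in \<open>simp_all add: Hp Gb\<close>)
    show "H u (c \<odot>\<^bsub>V\<^esub> v) xs = c \<odot>\<^bsub>W\<^esub> H u v xs" if "c \<in> carrier K" for c
      by (rule multilinear_tensor_ext[OF assms(1) H W.multilinear_scale[OF H] _ xs])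
        (use u v that in \<open>simp_all add: Hp Gb\<close>)
  qed
  have "\<exists>h. \<forall>xs\<in>tuples T n. h xs \<in> lin_maps K T W \<and>
    (\<forall>u\<in>carrier U. \<forall>v\<in>carrier V. h xs (pure u v) = H u v xs)"
    using tensor_lift[OF assms(1) bil] by (intro bchoice) blast
  then obtain h where h: "\<And>xs. xs \<in> tuples T n \<Longrightarrow> h xs \<in> lin_maps K T W"
    and hp: "\<And>xs u v. xs \<in> tuples T n \<Longrightarrow> u \<in> carrier U \<Longrightarrow> v \<in> carrier V \<Longrightarrow> h xs (pure u v) = H u v xs"
    by blast
  \<comment> \<open>The same issue in the other slots: \<open>h xs\<close> was chosen for each
    \<open>xs\<close> separately, and \<open>tensor_ext\<close> forces it to depend linearly on each
    entry.\<close>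
  have "multilinear K T W n (\<lambda>xs. h xs x)" if x: "x \<in> carrier T" for x
    unfolding multilinear_def
  proof (intro ballI conjI allI impI)
    fix xs i assume xs: "xs \<in> tuples T n"
    show "h xs x \<in> carrier W" using lin_maps_closed[OF h[OF xs] x] .
    assume i: "i < n"
    note up = tuples_update[OF xs] and sl = multilinear_slot[OF H xs i]
    show "(\<lambda>y. h (xs[i := y]) x) \<in> lin_maps K T W"
    proof (rule lin_mapsI)
      fix y assume y: "y \<in> carrier T"
      show "h (xs[i := y]) x \<in> carrier W" using lin_maps_closed[OF h[OF up[OF y]] x] .
      show "h (xs[i := y \<oplus>\<^bsub>T\<^esub> z]) x = h (xs[i := y]) x \<oplus>\<^bsub>W\<^esub> h (xs[i := z]) x"
        if z: "z \<in> carrier T" for z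
        by (rule tensor_ext[OF assms(1) h W.lin_maps_plus[OF T.linear_space_axioms h h] _ x])
          (use y z in \<open>simp_all add: hp up lin_maps_add[OF sl]\<close>)
      show "h (xs[i := c \<odot>\<^bsub>T\<^esub> y]) x = c \<odot>\<^bsub>W\<^esub> h (xs[i := y]) x" if c: "c \<in> carrier K" for c
        by (rule tensor_ext[OF assms(1) h W.lin_maps_scale[OF T.linear_space_axioms h c] _ x])
          (use y c in \<open>simp_all add: hp up lin_maps_smult[OF sl]\<close>)
    qed
  qed
  then have "multilinear K T W (Suc n) (\<lambda>xs. h (tl xs) (hd xs))"
    using h by (simp add: multilinear_Suc_iff[OF linear_space_tensor])
  then show ?case
    by (intro exI[of _ "\<lambda>xs. h (tl xs) (hd xs)"] conjI)
      (auto simp: tuples_Suc hp Hp map2_pure_tuples)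
qed

end

text \<open>Two rounds of the same scheme: lift in the second argument while the first is a fixed
  pure tensor, show by uniqueness that the result is bilinear in the factors of that pure tensor,
  and lift again.\<close>

lemma bilinear_tensor_lift:
  assumes "tensor_product K A U" and "tensor_product K A' V" and "linear_space K W"
    and b1: "\<And>a u. a \<in> carrier A \<Longrightarrow> u \<in> carrier U \<Longrightarrow> bilinear_op K A' V W (g a u)"
    and b2: "\<And>a' v. a' \<in> carrier A' \<Longrightarrow> v \<in> carrier V \<Longrightarrow> bilinear_op K A U W (\<lambda>a u. g a u a' v)"
  shows "\<exists>m. bilinear_op K (tensor K A U) (tensor K A' V) W m \<and>
    (\<forall>a\<in>carrier A. \<forall>a'\<in>carrier A'. \<forall>u\<in>carrier U. \<forall>v\<in>carrier V.
      m (pure_tensor K A U a u) (pure_tensor K A' V a' v) = g a u a' v)"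
proof -
  interpret P: tensor_product K A U by fact
  interpret Q: tensor_product K A' V by fact
  interpret W: linear_space K W by fact
  have "\<exists>h. \<forall>a\<in>carrier A. \<forall>u\<in>carrier U. h a u \<in> lin_maps K Q.T W \<and>
    (\<forall>a'\<in>carrier A'. \<forall>v\<in>carrier V. h a u (Q.pure a' v) = g a u a' v)"
  proof -
    have "\<forall>a\<in>carrier A. \<forall>u\<in>carrier U. \<exists>h. h \<in> lin_maps K Q.T W \<and>
        (\<forall>a'\<in>carrier A'. \<forall>v\<in>carrier V. h (Q.pure a' v) = g a u a' v)"
      using Q.tensor_lift[OF assms(3) b1] by blast
    then show ?thesis by metis
  qed
  then obtain h where h: "\<And>a u. a \<in> carrier A \<Longrightarrow> u \<in> carrier U \<Longrightarrow> h a u \<in> lin_maps K Q.T W"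
    and hp: "\<And>a u a' v. a \<in> carrier A \<Longrightarrow> u \<in> carrier U \<Longrightarrow> a' \<in> carrier A' \<Longrightarrow> v \<in> carrier V \<Longrightarrow>
      h a u (Q.pure a' v) = g a u a' v"
    by blast
  have bil: "bilinear_op K A U W (\<lambda>a u. h a u t)" if t: "t \<in> carrier Q.T" for t
  proof (rule bilinear_opI)
    note gb = bilinear_opD[OF b2]
    fix a u assume a: "a \<in> carrier A" and u: "u \<in> carrier U"
    show "h a u t \<in> carrier W" using lin_maps_closed[OF h[OF a u] t] .
    show "h (a \<oplus>\<^bsub>A\<^esub> b) u t = h a u t \<oplus>\<^bsub>W\<^esub> h b u t" if "b \<in> carrier A" for b
      by (rule Q.tensor_ext[OF assms(3) h W.lin_maps_plus[OF Q.T.linear_space_axioms h h] _ t])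
        (use a u that in \<open>simp_all add: hp gb\<close>)
    show "h a (u \<oplus>\<^bsub>U\<^esub> u') t = h a u t \<oplus>\<^bsub>W\<^esub> h a u' t" if "u' \<in> carrier U" for u'
      by (rule Q.tensor_ext[OF assms(3) h W.lin_maps_plus[OF Q.T.linear_space_axioms h h] _ t])
        (use a u that in \<open>simp_all add: hp gb\<close>)
    show "h (c \<odot>\<^bsub>A\<^esub> a) u t = c \<odot>\<^bsub>W\<^esub> h a u t" if "c \<in> carrier K" for c
      by (rule Q.tensor_ext[OF assms(3) h W.lin_maps_scale[OF Q.T.linear_space_axioms h that] _ t])
        (use a u that in \<open>simp_all add: hp gb\<close>)
    show "h a (c \<odot>\<^bsub>U\<^esub> u) t = c \<odot>\<^bsub>W\<^esub> h a u t" if "c \<in> carrier K" for c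
      by (rule Q.tensor_ext[OF assms(3) h W.lin_maps_scale[OF Q.T.linear_space_axioms h that] _ t])
        (use a u that in \<open>simp_all add: hp gb\<close>)
  qed
  have "\<exists>k. \<forall>t\<in>carrier Q.T. k t \<in> lin_maps K P.T W \<and>
    (\<forall>a\<in>carrier A. \<forall>u\<in>carrier U. k t (P.pure a u) = h a u t)"
    using P.tensor_lift[OF assms(3) bil] by (intro bchoice) blast
  then obtain k where k: "\<And>t. t \<in> carrier Q.T \<Longrightarrow> k t \<in> lin_maps K P.T W"
    and kp: "\<And>t a u. t \<in> carrier Q.T \<Longrightarrow> a \<in> carrier A \<Longrightarrow> u \<in> carrier U \<Longrightarrow> k t (P.pure a u) = h a u t"
    by blast
  have "bilinear_op K P.T Q.T W (\<lambda>s t. k t s)"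
  proof (rule bilinear_opI)
    fix s t assume s: "s \<in> carrier P.T" and t: "t \<in> carrier Q.T"
    show "k t s \<in> carrier W" using lin_maps_closed[OF k[OF t] s] .
    show "k t (s \<oplus>\<^bsub>P.T\<^esub> s') = k t s \<oplus>\<^bsub>W\<^esub> k t s'" if "s' \<in> carrier P.T" for s'
      using lin_maps_add[OF k[OF t] s that] .
    show "k t (c \<odot>\<^bsub>P.T\<^esub> s) = c \<odot>\<^bsub>W\<^esub> k t s" if "c \<in> carrier K" for c
      using lin_maps_smult[OF k[OF t] that s] .
    show "k (t \<oplus>\<^bsub>Q.T\<^esub> t') s = k t s \<oplus>\<^bsub>W\<^esub> k t' s" if "t' \<in> carrier Q.T" for t'
      by (rule P.tensor_ext[OF assms(3) k W.lin_maps_plus[OF P.T.linear_space_axioms k k] _ s])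
        (use t that in \<open>simp_all add: kp lin_maps_add[OF h]\<close>)
    show "k (c \<odot>\<^bsub>Q.T\<^esub> t) s = c \<odot>\<^bsub>W\<^esub> k t s" if "c \<in> carrier K" for c
      by (rule P.tensor_ext[OF assms(3) k W.lin_maps_scale[OF P.T.linear_space_axioms k that] _ s])
        (use t that in \<open>simp_all add: kp lin_maps_smult[OF h]\<close>)
  qed
  then show ?thesis by (intro exI[of _ "\<lambda>s t. k t s"]) (auto simp: kp hp Q.pure_closed)
qed

section \<open>The Hochschild complex\<close>

text \<open>\<open>contract\<close> counts from 1 and contains a truncated \<open>i - 1\<close>, so
  its index is written \<open>Suc k\<close> from here on; this rule and the next evaluate it by
  recursion on the list.\<close>

lemma contract_one [simp]: "contract m (Suc 0) (x # y # xs) = m x y # xs"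
  by (simp add: contract_def)

lemma contract_Suc [simp]: "contract m (Suc (Suc k)) (x # xs) = x # contract m (Suc k) xs"
  by (simp add: contract_def)

lemma contract_tuples:
  assumes "\<And>x y. x \<in> carrier U \<Longrightarrow> y \<in> carrier U \<Longrightarrow> m x y \<in> carrier U"
  shows "k < n \<Longrightarrow> xs \<in> tuples U (Suc n) \<Longrightarrow> contract m (Suc k) xs \<in> tuples U n"
proof (induction k arbitrary: n xs)
  case 0
  then show ?case using assms by (cases n) (auto simp: tuples_Suc)
next
  case (Suc k)
  then show ?case by (cases n) (auto simp: tuples_Suc[of _ "Suc _"])
qed

lemma tuples_Suc_sel:
  assumes "xs \<in> tuples U (Suc n)"
  shows "xs \<noteq> []" and "hd xs \<in> carrier U" and "last xs \<in> carrier U"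
    and "tl xs \<in> tuples U n" and "butlast xs \<in> tuples U n"
proof -
  show "xs \<noteq> []" using assms by (auto simp: tuples_def)
  then show "hd xs \<in> carrier U" "last xs \<in> carrier U" "tl xs \<in> tuples U n" "butlast xs \<in> tuples U n"
    using assms hd_in_set[of xs] last_in_set[of xs] in_set_butlastD[of _ xs] list.set_sel(2)[of xs]
    by (auto simp: tuples_def)
qed

text \<open>At the front, \<open>F\<close> is linear in its first slot and \<open>m\<close> is
  bilinear, so the composite is linear in each of the two merged slots; later positions are reached
  by splitting off heads.\<close>

lemma multilinear_contract:
  assumes U: "linear_space K U" and m: "bilinear_op K U U U m"
    and "multilinear K U V n F" and "k < n"
  shows "multilinear K U V (Suc n) (\<lambda>xs. F (contract m (Suc k) xs))"
  using assms(3,4)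
proof (induction k arbitrary: n F)
  case 0
  then obtain p where n: "n = Suc p" by (cases n) auto
  note F = 0(1)[unfolded n multilinear_Suc_iff[OF U]] and m' = bilinear_opD[OF m]
  have "multilinear K U V p (\<lambda>xs. F (m x y # xs))" if "x \<in> carrier U" "y \<in> carrier U" for x y
    using F m'(3)[OF that] by blast
  moreover have "(\<lambda>y. F (m x y # xs)) \<in> lin_maps K U V" "(\<lambda>y. F (m y x # xs)) \<in> lin_maps K U V"
    if "x \<in> carrier U" "xs \<in> tuples U p" for x xs
    using F that lin_maps_comp[OF m'(1)[OF that(1)], of "\<lambda>z. F (z # xs)" V]
      lin_maps_comp[OF m'(2)[OF that(1)], of "\<lambda>z. F (z # xs)" V] by auto
  ultimately show ?case
    by (auto simp: n multilinear_Suc_iff[OF U] tuples_Suc)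
next
  case (Suc k)
  then obtain p where n: "n = Suc p" "k < p" by (cases n) auto
  note F = Suc.prems(1)[unfolded n multilinear_Suc_iff[OF U]]
  have "multilinear K U V (Suc p) (\<lambda>xs. F (x # contract m (Suc k) xs))" if "x \<in> carrier U" for x
    using F that n by (intro Suc.IH[of p "\<lambda>xs. F (x # xs)"]) auto
  moreover have "(\<lambda>x. F (x # contract m (Suc k) xs)) \<in> lin_maps K U V" if "xs \<in> tuples U (Suc p)" for xs
    using F contract_tuples[where m = m, OF bilinear_opD(3)[OF m] n(2) that] by blast
  ultimately show ?case
    by (simp add: n multilinear_Suc_iff[OF U, of _ "Suc p"])
qed

lemma multilinear_left_action:
  assumes U: "linear_space K U" and l: "bilinear_op K U V W l" and F: "multilinear K U V n F"
  shows "multilinear K U W (Suc n) (\<lambda>xs. l (hd xs) (F (tl xs)))"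
  using multilinear_comp[OF F] bilinear_opD[OF l] multilinear_closed[OF F]
  by (auto simp: multilinear_Suc_iff[OF U])

text \<open>\<open>butlast\<close> and \<open>last\<close> reach the far end of the list, so the
  induction carries the heads along; both are compatible with \<open>Cons\<close> on the nonempty
  tails that occur.\<close>

lemma multilinear_right_action:
  assumes U: "linear_space K U" and r: "bilinear_op K V U W r" and F: "multilinear K U V n F"
  shows "multilinear K U W (Suc n) (\<lambda>xs. r (F (butlast xs)) (last xs))"
  using F
proof (induction n arbitrary: F)
  case 0
  then show ?case using bilinear_opD(1,3)[OF r]
    by (auto simp: multilinear_Suc_iff[OF U] multilinear_0_iff)
next
  case (Suc n)
  note F = Suc.prems[unfolded multilinear_Suc_iff[OF U]]
  have ne: "xs \<noteq> []" if "xs \<in> tuples U (Suc n)" for xs using that by (auto simp: tuples_def)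
  have "multilinear K U W (Suc n) (\<lambda>xs. r (F (butlast (x # xs))) (last (x # xs)))"
    if "x \<in> carrier U" for x
    using F that by (intro multilinear_cong[OF Suc.IH[of "\<lambda>xs. F (x # xs)"] U]) (auto dest: ne)
  moreover have "(\<lambda>x. r (F (butlast (x # xs))) (last (x # xs))) \<in> lin_maps K U W"
    if xs: "xs \<in> tuples U (Suc n)" for xs
  proof -
    have "butlast xs \<in> tuples U n" "last xs \<in> carrier U"
      using tuples_Suc_sel[OF xs] by auto
    then have "(\<lambda>x. r (F (x # butlast xs)) (last xs)) \<in> lin_maps K U W"
      using F by (intro lin_maps_comp[OF _ bilinear_opD(2)[OF r]]) auto
    then show ?thesis using ne[OF xs] by simp
  qed
  ultimately show ?case by (simp only: multilinear_Suc_iff[OF U, of _ "Suc n"]) blast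
qed

lemma pointwise_simps [simp]:
  "carrier (pointwise M S) = S" "\<zero>\<^bsub>pointwise M S\<^esub> = (\<lambda>_. \<zero>\<^bsub>M\<^esub>)"
  "f \<oplus>\<^bsub>pointwise M S\<^esub> g = (\<lambda>s. f s \<oplus>\<^bsub>M\<^esub> g s)" "c \<odot>\<^bsub>pointwise M S\<^esub> f = (\<lambda>s. c \<odot>\<^bsub>M\<^esub> f s)"
  by (simp_all add: pointwise_def)

context linear_space
begin

lemma linear_space_pointwise:
  assumes "\<And>f s. f \<in> S \<Longrightarrow> f s \<in> carrier M" and "(\<lambda>_. \<zero>) \<in> S"
    and "\<And>f g. f \<in> S \<Longrightarrow> g \<in> S \<Longrightarrow> (\<lambda>s. f s \<oplus> g s) \<in> S"
    and "\<And>c f. c \<in> carrier K \<Longrightarrow> f \<in> S \<Longrightarrow> (\<lambda>s. c \<odot> f s) \<in> S"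
  shows "linear_space K (pointwise M S)"
proof (rule linear_space.intro, rule moduleI)
  show "abelian_group (pointwise M S)"
  proof (rule abelian_groupI)
    fix f assume f: "f \<in> carrier (pointwise M S)"
    \<comment> \<open>Negation is scaling by \<open>- 1\<close>, so the closure of \<open>S\<close>
      under scalars supplies additive inverses.\<close>
    have "(\<lambda>s. (\<ominus>\<^bsub>K\<^esub> \<one>\<^bsub>K\<^esub>) \<odot> f s) \<in> S" using f assms(4) by simp
    moreover have "(\<lambda>s. (\<ominus>\<^bsub>K\<^esub> \<one>\<^bsub>K\<^esub>) \<odot> f s \<oplus> f s) = (\<lambda>_. \<zero>)"
      using f assms(1) by (simp add: smult_l_minus M.l_neg)
    ultimately show "\<exists>g\<in>carrier (pointwise M S). g \<oplus>\<^bsub>pointwise M S\<^esub> f = \<zero>\<^bsub>pointwise M S\<^esub>"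
      by auto
  qed (use assms in \<open>auto simp: M.a_ac\<close>)
qed (use assms in \<open>auto simp: smult_l_distr smult_r_distr smult_assoc1 R.is_cring\<close>)

lemma lin_maps_pointwiseI:
  assumes "\<And>x. x \<in> carrier U \<Longrightarrow> h x \<in> S" and "\<And>s. (\<lambda>x. h x s) \<in> lin_maps K U M"
  shows "h \<in> lin_maps K U (pointwise M S)"
  by (rule lin_mapsI)
    (use assms(1) lin_maps_add[OF assms(2)] lin_maps_smult[OF assms(2)] in auto)

lemma eval_lin_map:
  assumes "\<And>f s. f \<in> S \<Longrightarrow> f s \<in> carrier M"
  shows "(\<lambda>f. f s) \<in> lin_maps K (pointwise M S) M"
  by (rule lin_mapsI) (use assms in auto)

lemma sgn_closed: "x \<in> carrier M \<Longrightarrow> sgn_smult M i x \<in> carrier M"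
  by (simp add: sgn_smult_def)

lemma sgn_sgn: "x \<in> carrier M \<Longrightarrow> sgn_smult M i (sgn_smult M j x) = sgn_smult M (i + j) x"
  by (auto simp: sgn_smult_def)

lemma sgn_Suc: "x \<in> carrier M \<Longrightarrow> sgn_smult M (Suc i) x = \<ominus> sgn_smult M i x"
  by (auto simp: sgn_smult_def)

lemma sgn_finsum:
  assumes "f \<in> I \<rightarrow> carrier M"
  shows "sgn_smult M i (finsum M f I) = (\<Oplus>j\<in>I. sgn_smult M i (f j))"
  by (rule lin_maps_finsum[OF sgn_smult_lin_map linear_space_axioms linear_space_axioms assms])

text \<open>The cosimplicial identities cancel the entries with \<open>i < j\<close> against those with \<open>i \<ge> j\<close>.\<close>

lemma alternating_double_sum:
  assumes "\<And>i j. h j i \<in> carrier M"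
    and "\<And>i j. i < j \<Longrightarrow> j \<le> Suc N \<Longrightarrow> h j i = \<ominus> h i (j - 1)"
  shows "(\<Oplus>j\<in>{..Suc N}. \<Oplus>i\<in>{..N}. h j i) = \<zero>"
  using assms(2)
proof (induction N)
  case 0
  have "h (Suc 0) 0 = \<ominus> h 0 0" using 0[of 0 "Suc 0"] by simp
  then show ?case using assms(1) by (simp add: M.l_neg)
next
  case (Suc N)
  \<comment> \<open>Passing from \<open>N\<close> to \<open>N + 1\<close> adds the row
    \<open>j = N + 2\<close> and the column \<open>i = N + 1\<close>; by the antisymmetry of
    \<open>h\<close> these two cancel entry by entry.\<close>
  have "(\<Oplus>i\<in>{..Suc N}. h (Suc (Suc N)) i) \<oplus> (\<Oplus>j\<in>{..Suc N}. h j (Suc N)) =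
      (\<Oplus>i\<in>{..Suc N}. h (Suc (Suc N)) i \<oplus> h i (Suc N))"
    using assms(1) by (intro M.finsum_addf[symmetric]) auto
  also have "\<dots> = (\<Oplus>i\<in>{..Suc N}. \<zero>)"
    using assms(1) Suc.prems[of _ "Suc (Suc N)"] by (intro M.finsum_cong') (auto simp: M.l_neg)
  finally have 1: "(\<Oplus>i\<in>{..Suc N}. h (Suc (Suc N)) i) \<oplus> (\<Oplus>j\<in>{..Suc N}. h j (Suc N)) = \<zero>"
    by simp
  have "(\<Oplus>j\<in>{..Suc N}. \<Oplus>i\<in>{..Suc N}. h j i) =
      (\<Oplus>j\<in>{..Suc N}. h j (Suc N) \<oplus> (\<Oplus>i\<in>{..N}. h j i))"
    using assms(1) by (intro M.finsum_cong') (auto simp: M.finsum_Suc)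
  also have "\<dots> = (\<Oplus>j\<in>{..Suc N}. h j (Suc N)) \<oplus> (\<Oplus>j\<in>{..Suc N}. \<Oplus>i\<in>{..N}. h j i)"
    using assms(1) by (intro M.finsum_addf) auto
  also have "(\<Oplus>j\<in>{..Suc N}. \<Oplus>i\<in>{..N}. h j i) = \<zero>"
    using Suc.prems by (intro Suc.IH) auto
  finally have 2: "(\<Oplus>j\<in>{..Suc N}. \<Oplus>i\<in>{..Suc N}. h j i) = (\<Oplus>j\<in>{..Suc N}. h j (Suc N))"
    using assms(1) by (simp del: M.finsum_Suc)
  have "(\<Oplus>j\<in>{..Suc (Suc N)}. \<Oplus>i\<in>{..Suc N}. h j i) =
      (\<Oplus>i\<in>{..Suc N}. h (Suc (Suc N)) i) \<oplus> (\<Oplus>j\<in>{..Suc N}. \<Oplus>i\<in>{..Suc N}. h j i)"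
    using assms(1) by (intro M.finsum_Suc) auto
  then show ?case using 1 2 by simp
qed

end

text \<open>Contractions away from each other commute, the later position shifting by one. When
  \<open>b = a + 1\<close> they overlap in one entry, and the equation is associativity.\<close>

lemma contract_contract:
  assumes assoc: "\<And>x y z. x \<in> carrier U \<Longrightarrow> y \<in> carrier U \<Longrightarrow> z \<in> carrier U \<Longrightarrow> m (m x y) z = m x (m y z)"
  shows "a < b \<Longrightarrow> b \<le> n \<Longrightarrow> xs \<in> tuples U (Suc (Suc n)) \<Longrightarrow>
    contract m (Suc a) (contract m (Suc b) xs) = contract m b (contract m (Suc a) xs)"
proof (induction a arbitrary: b n xs)
  case 0
  then obtain c k where bn: "b = Suc c" "n = Suc k" by (cases b; cases n) auto
  with 0 obtain x y z ws where xs: "xs = x # y # z # ws"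
    "x \<in> carrier U" "y \<in> carrier U" "z \<in> carrier U" by (auto simp: tuples_Suc)
  then show ?case by (cases c) (simp_all add: bn assoc)
next
  case (Suc a)
  then obtain c k where bn: "b = Suc (Suc c)" "n = Suc k"
    by (cases b; cases "b - 1"; cases n) auto
  with Suc.prems obtain x ys where xs: "xs = x # ys" "ys \<in> tuples U (Suc (Suc k))"
    by (auto simp: tuples_Suc[of _ "Suc (Suc _)"])
  then show ?case using Suc.IH[of "Suc c" k ys] Suc.prems by (simp add: bn)
qed

lemma contract_butlast:
  "Suc (Suc k) < length xs \<Longrightarrow> contract m (Suc k) (butlast xs) = butlast (contract m (Suc k) xs) \<and>
    last (contract m (Suc k) xs) = last xs"
proof (induction k arbitrary: xs)
  case 0
  then obtain x y z ws where "xs = x # y # z # ws" by (auto simp: Suc_less_eq2 neq_Nil_conv length_Suc_conv)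
  then show ?case by simp
next
  case (Suc k)
  then obtain x y z ws where xs: "xs = x # y # z # ws" by (auto simp: Suc_less_eq2 neq_Nil_conv length_Suc_conv)
  have "contract m (Suc k) (y # z # ws) \<noteq> []" by (simp add: contract_def)
  then show ?case using Suc.IH[of "y # z # ws"] Suc.prems by (simp add: xs)
qed

lemma contract_append_two: "contract m (Suc (length zs)) (zs @ [x, y]) = zs @ [m x y]"
  by (simp add: contract_def nth_append)

section \<open>The Hochschild differential as an alternating sum of faces\<close>

locale hochschild = R: linear_space K R + M: linear_space K M
  for K :: "'k ring" and R :: "('k, 'r) module" and M :: "('k, 'm) module" +
  fixes l :: "'r \<Rightarrow> 'm \<Rightarrow> 'm" and r :: "'m \<Rightarrow> 'r \<Rightarrow> 'm"
  assumes mult_bilinear: "bilinear_op K R R R (mult R)"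
    and l_bilinear: "bilinear_op K R M M l"
    and r_bilinear: "bilinear_op K M R M r"
    and mult_assoc: "\<lbrakk>x \<in> carrier R; y \<in> carrier R; z \<in> carrier R\<rbrakk> \<Longrightarrow>
      (x \<otimes>\<^bsub>R\<^esub> y) \<otimes>\<^bsub>R\<^esub> z = x \<otimes>\<^bsub>R\<^esub> (y \<otimes>\<^bsub>R\<^esub> z)"
    and l_l: "\<lbrakk>x \<in> carrier R; y \<in> carrier R; n \<in> carrier M\<rbrakk> \<Longrightarrow> l (x \<otimes>\<^bsub>R\<^esub> y) n = l x (l y n)"
    and l_r: "\<lbrakk>x \<in> carrier R; y \<in> carrier R; n \<in> carrier M\<rbrakk> \<Longrightarrow> r (l x n) y = l x (r n y)"
    and r_r: "\<lbrakk>x \<in> carrier R; y \<in> carrier R; n \<in> carrier M\<rbrakk> \<Longrightarrow> r (r n x) y = r n (x \<otimes>\<^bsub>R\<^esub> y)"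
begin

abbreviation cochain :: "nat \<Rightarrow> ('r list \<Rightarrow> 'm) set"
  where "cochain n \<equiv> {F. multilinear K R M n F \<and> (\<forall>xs. xs \<notin> tuples R n \<longrightarrow> F xs = \<zero>\<^bsub>M\<^esub>)}"

abbreviation complx where "complx \<equiv> hoch_complex K R M l r"

lemma cochain_closed: "F \<in> cochain n \<Longrightarrow> F xs \<in> carrier M"
  by (cases "xs \<in> tuples R n") (auto simp: multilinear_closed)

lemma obj_complx: "obj complx n = pointwise M (if n < 0 then {\<lambda>_. \<zero>\<^bsub>M\<^esub>} else cochain (nat n))"
  by (simp add: hoch_complex_def hoch_space_def)

lemma linear_space_cochain: "linear_space K (pointwise M (cochain n))"
  by (rule M.linear_space_pointwise)
    (auto simp: cochain_closed[simplified] M.multilinear_zero M.multilinear_plus R.linear_space_axioms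
      M.multilinear_scale)

lemma linear_space_obj_complx: "linear_space K (obj complx n)"
proof (cases "n < 0")
  case True
  have "linear_space K (pointwise M {\<lambda>_. \<zero>\<^bsub>M\<^esub>})"
    by (rule M.linear_space_pointwise) auto
  then show ?thesis using True by (simp add: obj_complx)
qed (simp add: obj_complx linear_space_cochain)

text \<open>The cofaces of the cosimplicial module of Hochschild cochains; \<open>i = 0\<close> and
  \<open>i = n + 1\<close> are the outer actions. Every \<open>i\<close> above \<open>n\<close>
  counts as the right action, so that \<open>face n i F\<close> is multilinear for all
  \<open>i\<close>.\<close>

definition face :: "nat \<Rightarrow> nat \<Rightarrow> ('r list \<Rightarrow> 'm) \<Rightarrow> 'r list \<Rightarrow> 'm"
  where "face n i F xs =
    (if i = 0 then l (hd xs) (F (tl xs))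
     else if i \<le> n then F (contract (mult R) i xs)
     else r (F (butlast xs)) (last xs))"

lemma multilinear_face:
  assumes "multilinear K R M n F"
  shows "multilinear K R M (Suc n) (face n i F)"
proof -
  consider "i = 0" | k where "i = Suc k" "k < n" | "i > n" "i \<noteq> 0"
    by (metis Suc_le_eq linorder_not_le not0_implies_Suc)
  then show ?thesis
    by cases (use multilinear_left_action[OF R.linear_space_axioms l_bilinear assms]
        multilinear_contract[OF R.linear_space_axioms mult_bilinear assms]
        multilinear_right_action[OF R.linear_space_axioms r_bilinear assms]
        in \<open>simp_all add: face_def[abs_def]\<close>)
qed

text \<open>The two outer terms are absorbed into a single alternating sum, the form in which the
  square of the differential can be cancelled.\<close>

lemma hoch_cobd_eq:
  assumes F: "multilinear K R M n F" and xs: "xs \<in> tuples R (Suc n)"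
  shows "hoch_cobd R M l r n F xs = (\<Oplus>\<^bsub>M\<^esub>i\<in>{..Suc n}. sgn_smult M i (face n i F xs))"
proof -
  have c: "face n i F xs \<in> carrier M" for i
    by (rule multilinear_closed[OF multilinear_face[OF F] xs])
  have "{..n} = insert 0 {1..n}" by auto
  then have "(\<Oplus>\<^bsub>M\<^esub>i\<in>{..n}. sgn_smult M i (face n i F xs)) =
      sgn_smult M 0 (face n 0 F xs) \<oplus>\<^bsub>M\<^esub> (\<Oplus>\<^bsub>M\<^esub>i\<in>{1..n}. sgn_smult M i (face n i F xs))"
    using c M.sgn_closed by (simp add: Pi_def)
  also have "(\<Oplus>\<^bsub>M\<^esub>i\<in>{1..n}. sgn_smult M i (face n i F xs)) =
      (\<Oplus>\<^bsub>M\<^esub>i\<in>{1..n}. sgn_smult M i (F (contract (mult R) i xs)))"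
  proof (rule M.finsum_cong')
    fix i assume "i \<in> {1..n}"
    then have "face n i F xs = F (contract (mult R) i xs)" by (simp add: face_def)
    then show "sgn_smult M i (face n i F xs) = sgn_smult M i (F (contract (mult R) i xs))"
      by simp
  next
    show "(\<lambda>i. sgn_smult M i (F (contract (mult R) i xs))) \<in> {1..n} \<rightarrow> carrier M"
    proof
      fix i assume "i \<in> {1..n}"
      then show "sgn_smult M i (F (contract (mult R) i xs)) \<in> carrier M"
        using M.sgn_closed[OF c[of i]] by (simp add: face_def)
    qed
  qed simp
  finally have 1: "(\<Oplus>\<^bsub>M\<^esub>i\<in>{..n}. sgn_smult M i (face n i F xs)) = l (hd xs) (F (tl xs)) \<oplus>\<^bsub>M\<^esub>
      (\<Oplus>\<^bsub>M\<^esub>i\<in>{1..n}. sgn_smult M i (F (contract (mult R) i xs)))"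
    by (simp add: face_def sgn_smult_def)
  have "(\<Oplus>\<^bsub>M\<^esub>i\<in>{..Suc n}. sgn_smult M i (face n i F xs)) =
      sgn_smult M (Suc n) (face n (Suc n) F xs) \<oplus>\<^bsub>M\<^esub> (\<Oplus>\<^bsub>M\<^esub>i\<in>{..n}. sgn_smult M i (face n i F xs))"
    using c M.sgn_closed by (intro M.finsum_Suc) auto
  also have "\<dots> = (\<Oplus>\<^bsub>M\<^esub>i\<in>{..n}. sgn_smult M i (face n i F xs)) \<oplus>\<^bsub>M\<^esub> sgn_smult M (Suc n) (face n (Suc n) F xs)"
    using c M.sgn_closed by (intro M.a_comm M.finsum_closed) auto
  also have "face n (Suc n) F xs = r (F (butlast xs)) (last xs)" by (simp add: face_def)
  finally show ?thesis using xs by (simp add: hoch_cobd_def 1 del: M.finsum_Suc)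
qed

lemma hoch_cobd_closed:
  assumes "F \<in> cochain n"
  shows "hoch_cobd R M l r n F \<in> cochain (Suc n)"
proof -
  have "multilinear K R M n F" using assms by simp
  then have "multilinear K R M (Suc n) (\<lambda>xs. \<Oplus>\<^bsub>M\<^esub>i\<in>{..Suc n}. sgn_smult M i (face n i F xs))"
    by (intro M.multilinear_finsum M.multilinear_sgn multilinear_face R.linear_space_axioms)
  then have "multilinear K R M (Suc n) (hoch_cobd R M l r n F)"
    by (rule multilinear_cong[OF _ R.linear_space_axioms]) (rule hoch_cobd_eq[OF \<open>multilinear K R M n F\<close>])
  then show ?thesis by (simp add: hoch_cobd_def)
qed

lemma face_lin:
  assumes "xs \<in> tuples R (Suc n)"
  shows "(\<lambda>F. face n i F xs) \<in> lin_maps K (pointwise M (cochain n)) M"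
proof -
  have e: "(\<lambda>F. F ys) \<in> lin_maps K (pointwise M (cochain n)) M" for ys
    by (rule M.eval_lin_map) (rule cochain_closed)
  have "hd xs \<in> carrier R" "last xs \<in> carrier R" using tuples_Suc_sel[OF assms] by auto
  then show ?thesis
    using e lin_maps_comp[OF e bilinear_opD(1)[OF l_bilinear]]
      lin_maps_comp[OF e bilinear_opD(2)[OF r_bilinear]]
    by (cases "i = 0"; cases "i \<le> n") (auto simp: face_def)
qed

lemma hoch_cobd_lin:
  "hoch_cobd R M l r n \<in> lin_maps K (pointwise M (cochain n)) (pointwise M (cochain (Suc n)))"
proof (rule M.lin_maps_pointwiseI)
  show "hoch_cobd R M l r n F \<in> cochain (Suc n)" if "F \<in> carrier (pointwise M (cochain n))" for F
    using that hoch_cobd_closed by simp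
  show "(\<lambda>F. hoch_cobd R M l r n F xs) \<in> lin_maps K (pointwise M (cochain n)) M" for xs
  proof (cases "xs \<in> tuples R (Suc n)")
    case True
    have "(\<lambda>F. \<Oplus>\<^bsub>M\<^esub>i\<in>{..Suc n}. sgn_smult M i (face n i F xs)) \<in> lin_maps K (pointwise M (cochain n)) M"
      by (intro M.lin_maps_finsum_pointwise linear_space_cochain
          lin_maps_comp[OF face_lin[OF True] M.sgn_smult_lin_map])
    then show ?thesis
      using True by (rule_tac lin_maps_cong[OF _ linear_space_cochain]) (auto simp: hoch_cobd_eq)
  next
    case False
    then show ?thesis using M.lin_maps_const_zero by (simp add: hoch_cobd_def)
  qed
qed

text \<open>The cosimplicial identities. Two outer faces meet in a bimodule law: \<open>l_l\<close>
  for two left actions, \<open>l_r\<close> for one on each side, \<open>r_r\<close> for two right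
  actions. Two inner faces are \<open>contract_contract\<close>. In the mixed cases the contraction
  misses the entry that acts.\<close>

lemma face_face:
  assumes F: "multilinear K R M n F" and xs: "xs \<in> tuples R (Suc (Suc n))"
    and "i < j" and "j \<le> Suc (Suc n)"
  shows "face (Suc n) j (face n i F) xs = face (Suc n) i (face n (j - 1) F) xs"
proof -
  obtain x y zs where x: "xs = x # y # zs" "x \<in> carrier R" "y \<in> carrier R" "zs \<in> tuples R n"
    using xs by (auto simp: tuples_Suc)
  have Fc: "F ys \<in> carrier M" if "ys \<in> tuples R n" for ys by (rule multilinear_closed[OF F that])
  have len: "length xs = Suc (Suc n)" using xs by (rule tuples_length)
  have bl: "butlast (y # zs) \<in> tuples R n" "last (y # zs) \<in> carrier R"
    using x tuples_Suc_sel[of "y # zs" R n] by (auto simp del: last.simps butlast.simps)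
  consider "i = 0" "j = 1" | k where "i = 0" "j = Suc (Suc k)" "k < n" | "i = 0" "j = Suc (Suc n)"
    | a b where "i = Suc a" "j = Suc b" "a < b" "b \<le> n"
    | a where "i = Suc a" "a < n" "j = Suc (Suc n)" | "i = Suc n" "j = Suc (Suc n)"
    using assms(3,4) by (cases i; cases j; cases "j = Suc (Suc n)"; cases "j - 1") force+
  then show ?thesis
  proof cases
    case 1
    then show ?thesis using x l_l Fc by (simp add: face_def)
  next
    case 2
    then show ?thesis using x by (simp add: face_def)
  next
    case 3
    then show ?thesis using x bl Fc l_r by (simp add: face_def)
  next
    case 4
    then show ?thesis
      using contract_contract[of R "mult R" a b n xs] mult_assoc xs by (simp add: face_def)
  next
    case 5
    then show ?thesis
      using contract_butlast[of a xs "mult R"] len by (simp add: face_def)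
  next
    case 6
    define ws where "ws = take n xs"
    obtain u v where uv: "xs = ws @ [u, v]"
    proof
      show "xs = ws @ [xs ! n, xs ! Suc n]"
        using len Cons_nth_drop_Suc[of n xs] Cons_nth_drop_Suc[of "Suc n" xs]
          append_take_drop_id[of n xs] by (simp add: ws_def)
    qed
    have w: "length ws = n" "ws \<in> tuples R n" "u \<in> carrier R" "v \<in> carrier R"
      using xs by (auto simp: uv tuples_def)
    then have "contract (mult R) (Suc n) xs = ws @ [u \<otimes>\<^bsub>R\<^esub> v]"
      using contract_append_two[of "mult R" ws u v] by (simp add: uv)
    then show ?thesis using 6 w Fc r_r by (simp add: face_def uv butlast_append)
  qed
qed

lemma hoch_cobd_hoch_cobd:
  assumes F: "F \<in> cochain n"
  shows "hoch_cobd R M l r (Suc n) (hoch_cobd R M l r n F) = (\<lambda>_. \<zero>\<^bsub>M\<^esub>)"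
proof
  fix xs
  show "hoch_cobd R M l r (Suc n) (hoch_cobd R M l r n F) xs = \<zero>\<^bsub>M\<^esub>"
  proof (cases "xs \<in> tuples R (Suc (Suc n))")
    case True
    have Fm: "multilinear K R M n F" using F by simp
    let ?G = "\<lambda>i ys. if ys \<in> tuples R (Suc n) then face n i F ys else \<zero>\<^bsub>M\<^esub>"
    define h where "h j i = sgn_smult M (j + i) (face (Suc n) j (face n i F) xs)" for j i
    note Fi = multilinear_face[OF Fm] and Fij = multilinear_face[OF multilinear_face[OF Fm]]
    have fc: "face (Suc n) j (face n i F) xs \<in> carrier M" for i j
      by (rule multilinear_closed[OF Fij True])
    then have hc: "h j i \<in> carrier M" for i j by (simp add: h_def M.sgn_closed)
    have "hoch_cobd R M l r (Suc n) (hoch_cobd R M l r n F) xs =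
      (\<Oplus>\<^bsub>M\<^esub>j\<in>{..Suc (Suc n)}. sgn_smult M j (face (Suc n) j (hoch_cobd R M l r n F) xs))"
      using hoch_cobd_closed[OF F] by (intro hoch_cobd_eq True) blast
    also have "\<dots> = (\<Oplus>\<^bsub>M\<^esub>j\<in>{..Suc (Suc n)}. \<Oplus>\<^bsub>M\<^esub>i\<in>{..Suc n}. h j i)"
    proof (rule M.finsum_cong')
      fix j assume "j \<in> {..Suc (Suc n)}"
      have sub: "tl xs \<in> tuples R (Suc n)" "butlast xs \<in> tuples R (Suc n)" "hd xs \<in> carrier R"
        "last xs \<in> carrier R" "k < Suc n \<Longrightarrow> contract (mult R) (Suc k) xs \<in> tuples R (Suc n)" for k
        using tuples_Suc_sel[OF True] True
          contract_tuples[where m = "mult R", OF bilinear_opD(3)[OF mult_bilinear], of k "Suc n" xs]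
        by auto
      \<comment> \<open>A face evaluates its argument only at tuples of the right length, where the
        differential is the alternating sum of faces.\<close>
      have "face (Suc n) j (hoch_cobd R M l r n F) xs =
          face (Suc n) j (\<lambda>ys. \<Oplus>\<^bsub>M\<^esub>i\<in>{..Suc n}. sgn_smult M i (face n i F ys)) xs"
        using sub(1,2) sub(5)[of "j - 1"]
        by (cases j) (simp_all add: face_def[of "Suc n"] hoch_cobd_eq[OF Fm] del: M.finsum_Suc)
      \<comment> \<open>Outer faces are linear in the value of the cochain and inner ones merely
        evaluate it, so the sum and the signs come out.\<close>
      also have "\<dots> = (\<Oplus>\<^bsub>M\<^esub>i\<in>{..Suc n}. sgn_smult M i (face (Suc n) j (face n i F) xs))"
      proof -
        have s: "(\<lambda>i. sgn_smult M i (face n i F ys)) \<in> {..Suc n} \<rightarrow> carrier M"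
          if "ys \<in> tuples R (Suc n)" for ys
          using multilinear_closed[OF Fi that] M.sgn_closed by auto
        have ls: "l (hd xs) (sgn_smult M i (face n i F (tl xs))) = sgn_smult M i (l (hd xs) (face n i F (tl xs)))" for i
          using lin_maps_neg[OF bilinear_opD(1)[OF l_bilinear sub(3)] M.linear_space_axioms M.linear_space_axioms
              multilinear_closed[OF Fi sub(1)]]
          by (simp add: sgn_smult_def)
        have rs: "r (sgn_smult M i (face n i F (butlast xs))) (last xs) = sgn_smult M i (r (face n i F (butlast xs)) (last xs))" for i
          using lin_maps_neg[OF bilinear_opD(2)[OF r_bilinear sub(4)] M.linear_space_axioms M.linear_space_axioms
              multilinear_closed[OF Fi sub(2)]]
          by (simp add: sgn_smult_def)
        show ?thesis
          unfolding face_def[of "Suc n"]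
          using lin_maps_finsum[OF bilinear_opD(1)[OF l_bilinear sub(3)] M.linear_space_axioms
              M.linear_space_axioms s[OF sub(1)]]
            lin_maps_finsum[OF bilinear_opD(2)[OF r_bilinear sub(4)] M.linear_space_axioms
              M.linear_space_axioms s[OF sub(2)]]
          by (simp add: ls rs del: M.finsum_Suc)
      qed
      finally have "face (Suc n) j (hoch_cobd R M l r n F) xs =
        (\<Oplus>\<^bsub>M\<^esub>i\<in>{..Suc n}. sgn_smult M i (face (Suc n) j (face n i F) xs))" .
      then show "sgn_smult M j (face (Suc n) j (hoch_cobd R M l r n F) xs) = (\<Oplus>\<^bsub>M\<^esub>i\<in>{..Suc n}. h j i)"
        using fc M.sgn_closed
        by (simp only:) (subst M.sgn_finsum, auto simp: h_def[abs_def] M.sgn_sgn simp del: M.finsum_Suc)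
    qed (use hc in auto)
    also have "\<dots> = \<zero>\<^bsub>M\<^esub>"
    proof (rule M.alternating_double_sum[OF hc])
      fix i j :: nat assume ij: "i < j" "j \<le> Suc (Suc n)"
      then obtain k where k: "j = Suc k" by (cases j) auto
      \<comment> \<open>The iterated faces agree by \<open>face_face\<close>, and the exponents
        \<open>j + i\<close> and \<open>i + k\<close> with \<open>k = j - 1\<close> differ by one,
        which gives the minus sign.\<close>
      show "h j i = \<ominus>\<^bsub>M\<^esub> h i (j - 1)"
        using face_face[OF Fm True ij] fc[of i k] by (simp add: h_def k M.sgn_Suc add.commute)
    qed
    finally show ?thesis .
  qed (simp add: hoch_cobd_def)
qed

lemma cochain_complex_complx: "cochain_complex K complx"
  unfolding cochain_complex_def
proof (intro allI conjI ballI)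
  fix n
  show "module K (obj complx n)" by (rule linear_space.axioms[OF linear_space_obj_complx])
  interpret O: linear_space K "obj complx (n + 1)" by (rule linear_space_obj_complx)
  show lin: "cobd complx n \<in> lin_maps K (obj complx n) (obj complx (n + 1))"
  proof (cases "n < 0")
    case True
    have "(\<lambda>_. \<zero>\<^bsub>obj complx (n + 1)\<^esub>) \<in> lin_maps K (obj complx n) (obj complx (n + 1))"
      by (rule O.lin_maps_const_zero)
    then show ?thesis using True by (simp add: hoch_complex_def hoch_space_def)
  next
    case False
    then have "nat (n + 1) = Suc (nat n)" by simp
    then show ?thesis using False hoch_cobd_lin[of "nat n"] by (simp add: obj_complx) (simp add: hoch_complex_def)
  qed
  fix F assume F: "F \<in> carrier (obj complx n)"
  have z: "(\<lambda>_. \<zero>\<^bsub>M\<^esub>) = \<zero>\<^bsub>obj complx k\<^esub>" for k by (simp add: obj_complx)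
  show "cobd complx (n + 1) (cobd complx n F) = \<zero>\<^bsub>obj complx (n + 1 + 1)\<^esub>"
  proof (cases "n < 0")
    case True
    show ?thesis
    proof (cases "n + 1 < 0")
      case True
      then show ?thesis by (simp add: hoch_complex_def hoch_space_def)
    next
      \<comment> \<open>Here \<open>n = -1\<close>: the zero map into degree 0 is followed by a
        genuine Hochschild differential, which sends zero to zero.\<close>
      case n0: False
      have "nat (n + 1 + 1) = Suc (nat (n + 1))" using n0 by simp
      then have "hoch_cobd R M l r (nat (n + 1)) (\<lambda>_. \<zero>\<^bsub>M\<^esub>) = (\<lambda>_. \<zero>\<^bsub>M\<^esub>)"
        using lin_maps_zero[OF hoch_cobd_lin linear_space_cochain linear_space_cochain, of "nat (n + 1)"]
        by simp
      then show ?thesis using True n0 by (simp add: hoch_complex_def hoch_space_def)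
    qed
  next
    case False
    then have "nat (n + 1) = Suc (nat n)" by simp
    then show ?thesis
      using False F hoch_cobd_hoch_cobd[of F "nat n"] by (simp add: obj_complx) (simp add: hoch_complex_def)
  qed
qed

end

section \<open>The bimodule structure on the tensor products\<close>

text \<open>The prescribed values are bilinear in each pair of factors, so
  \<open>bilinear_tensor_lift\<close> provides a witness for the choice operator in
  \<open>tensor_op\<close>.\<close>

lemma tensor_op_spec:
  assumes "linear_space K A" and "bilinear_op K A A A (mult A)" and "linear_space K U"
    and "linear_space K V" and "linear_space K W"
    and p: "bilinear_op K U V W p" and s: "bilinear_op K U V W s"
  shows "bilinear_op K (tensor K A U) (tensor K A V) (tensor K A W) (tensor_op K A U V W p s)"
    and "\<lbrakk>a \<in> carrier A; a' \<in> carrier A; u \<in> carrier U; v \<in> carrier V\<rbrakk> \<Longrightarrow>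
      tensor_op K A U V W p s (pure_tensor K A U a u) (pure_tensor K A V a' v) =
        pure_tensor K A W (a \<otimes>\<^bsub>A\<^esub> a') (p u v) \<oplus>\<^bsub>tensor K A W\<^esub>
        pure_tensor K A W (a' \<otimes>\<^bsub>A\<^esub> a) (s u v)"
proof -
  interpret AU: tensor_product K A U by (intro tensor_product.intro assms)
  interpret AV: tensor_product K A V by (intro tensor_product.intro assms)
  interpret AW: tensor_product K A W by (intro tensor_product.intro assms)
  note A = bilinear_opD[OF assms(2)] and p' = bilinear_opD[OF p] and s' = bilinear_opD[OF s]
  let ?g = "\<lambda>a u a' v. AW.pure (a \<otimes>\<^bsub>A\<^esub> a') (p u v) \<oplus>\<^bsub>AW.T\<^esub> AW.pure (a' \<otimes>\<^bsub>A\<^esub> a) (s u v)"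
  have "\<exists>m. bilinear_op K AU.T AV.T AW.T m \<and>
    (\<forall>a\<in>carrier A. \<forall>a'\<in>carrier A. \<forall>u\<in>carrier U. \<forall>v\<in>carrier V.
      m (AU.pure a u) (AV.pure a' v) = ?g a u a' v)"
    by (intro bilinear_tensor_lift AU.tensor_product_axioms AV.tensor_product_axioms
        AW.linear_space_tensor bilinear_op_plus AU.U.linear_space_axioms AU.V.linear_space_axioms
        AV.V.linear_space_axioms bilinear_op_comp[OF AW.pure_bilinear] A p' s')
  from someI_ex[OF this]
  show "bilinear_op K AU.T AV.T AW.T (tensor_op K A U V W p s)"
    "\<lbrakk>a \<in> carrier A; a' \<in> carrier A; u \<in> carrier U; v \<in> carrier V\<rbrakk> \<Longrightarrow>
      tensor_op K A U V W p s (AU.pure a u) (AV.pure a' v) = ?g a u a' v"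
    unfolding tensor_op_def by blast+
qed

text \<open>Stated for six spaces and four pairs of operations, so that associativity of
  \<open>A \<otimes> B\<close> and the three laws of the bimodule \<open>A \<otimes> N\<close> are
  instances of one computation.\<close>

lemma tensor_op_assoc:
  assumes A: "perm_algebra K A" and "linear_space K U" and "linear_space K V" and "linear_space K W"
    and "linear_space K UV" and "linear_space K VW" and "linear_space K M"
    and b1: "bilinear_op K U V UV p1" "bilinear_op K U V UV s1"
    and b2: "bilinear_op K UV W M p2" "bilinear_op K UV W M s2"
    and b3: "bilinear_op K V W VW p3" "bilinear_op K V W VW s3"
    and b4: "bilinear_op K U VW M p4" "bilinear_op K U VW M s4"
    and pp: "\<And>u v w. u \<in> carrier U \<Longrightarrow> v \<in> carrier V \<Longrightarrow> w \<in> carrier W \<Longrightarrow>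
      p2 (p1 u v) w = p4 u (p3 v w \<oplus>\<^bsub>VW\<^esub> s3 v w)"
    and sp: "\<And>u v w. u \<in> carrier U \<Longrightarrow> v \<in> carrier V \<Longrightarrow> w \<in> carrier W \<Longrightarrow>
      p2 (s1 u v) w = s4 u (p3 v w)"
    and ss: "\<And>u v w. u \<in> carrier U \<Longrightarrow> v \<in> carrier V \<Longrightarrow> w \<in> carrier W \<Longrightarrow>
      s4 u (s3 v w) = s2 (p1 u v \<oplus>\<^bsub>UV\<^esub> s1 u v) w"
    and x: "x \<in> carrier (tensor K A U)" and y: "y \<in> carrier (tensor K A V)"
    and z: "z \<in> carrier (tensor K A W)"
  shows "tensor_op K A UV W M p2 s2 (tensor_op K A U V UV p1 s1 x y) z =
    tensor_op K A U VW M p4 s4 x (tensor_op K A V W VW p3 s3 y z)"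
proof -
  have Al: "linear_space K A" and Ab: "bilinear_op K A A A (mult A)"
    and Aa: "\<And>a b c. \<lbrakk>a \<in> carrier A; b \<in> carrier A; c \<in> carrier A\<rbrakk> \<Longrightarrow>
      (a \<otimes>\<^bsub>A\<^esub> b) \<otimes>\<^bsub>A\<^esub> c = a \<otimes>\<^bsub>A\<^esub> (b \<otimes>\<^bsub>A\<^esub> c)"
    and Ap: "\<And>a b c. \<lbrakk>a \<in> carrier A; b \<in> carrier A; c \<in> carrier A\<rbrakk> \<Longrightarrow>
      a \<otimes>\<^bsub>A\<^esub> (b \<otimes>\<^bsub>A\<^esub> c) = a \<otimes>\<^bsub>A\<^esub> (c \<otimes>\<^bsub>A\<^esub> b)"
    using A by (auto simp: perm_algebra_def algebra_over_def linear_space_def)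
  interpret AU: tensor_product K A U by (intro tensor_product.intro Al assms)
  interpret AV: tensor_product K A V by (intro tensor_product.intro Al assms)
  interpret AW: tensor_product K A W by (intro tensor_product.intro Al assms)
  interpret AUV: tensor_product K A UV by (intro tensor_product.intro Al assms)
  interpret AVW: tensor_product K A VW by (intro tensor_product.intro Al assms)
  interpret AM: tensor_product K A M by (intro tensor_product.intro Al assms)
  let ?o1 = "tensor_op K A U V UV p1 s1" and ?o2 = "tensor_op K A UV W M p2 s2"
  let ?o3 = "tensor_op K A V W VW p3 s3" and ?o4 = "tensor_op K A U VW M p4 s4"
  note o1 = tensor_op_spec[OF Al Ab assms(2,3,5) b1]
  note o2 = tensor_op_spec[OF Al Ab assms(5,4,7) b2]
  note o3 = tensor_op_spec[OF Al Ab assms(3,4,6) b3]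
  note o4 = tensor_op_spec[OF Al Ab assms(2,6,7) b4]
  note o1' = bilinear_opD[OF o1(1)] and o2' = bilinear_opD[OF o2(1)]
    and o3' = bilinear_opD[OF o3(1)] and o4' = bilinear_opD[OF o4(1)]
  note Ac = bilinear_opD(3)[OF Ab]
  note bc = bilinear_opD(3)[OF b1(1)] bilinear_opD(3)[OF b1(2)] bilinear_opD(3)[OF b2(1)]
    bilinear_opD(3)[OF b2(2)] bilinear_opD(3)[OF b3(1)] bilinear_opD(3)[OF b3(2)]
    bilinear_opD(3)[OF b4(1)] bilinear_opD(3)[OF b4(2)]
  have pure: "?o2 (?o1 (AU.pure a u) (AV.pure b v)) (AW.pure c w) =
      ?o4 (AU.pure a u) (?o3 (AV.pure b v) (AW.pure c w))"
    if abc: "a \<in> carrier A" "b \<in> carrier A" "c \<in> carrier A"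
      and uvw: "u \<in> carrier U" "v \<in> carrier V" "w \<in> carrier W" for a b c u v w
  proof -
    note P = AM.pure_closed
    \<comment> \<open>Up to the Perm identities, the products of \<open>a\<close>, \<open>b\<close>,
      \<open>c\<close> in any order have only three values, one for each leading factor.\<close>
    let ?x1 = "a \<otimes>\<^bsub>A\<^esub> (b \<otimes>\<^bsub>A\<^esub> c)" and ?x2 = "b \<otimes>\<^bsub>A\<^esub> (a \<otimes>\<^bsub>A\<^esub> c)" and ?x3 = "c \<otimes>\<^bsub>A\<^esub> (a \<otimes>\<^bsub>A\<^esub> b)"
    have e: "c \<otimes>\<^bsub>A\<^esub> (b \<otimes>\<^bsub>A\<^esub> a) = ?x3" "b \<otimes>\<^bsub>A\<^esub> (c \<otimes>\<^bsub>A\<^esub> a) = ?x2" "a \<otimes>\<^bsub>A\<^esub> (c \<otimes>\<^bsub>A\<^esub> b) = ?x1"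
      using Ap abc by auto
    have "?o2 (?o1 (AU.pure a u) (AV.pure b v)) (AW.pure c w) =
      AM.pure ?x1 (p2 (p1 u v) w) \<oplus>\<^bsub>AM.T\<^esub> AM.pure ?x3 (s2 (p1 u v) w) \<oplus>\<^bsub>AM.T\<^esub>
      (AM.pure ?x2 (p2 (s1 u v) w) \<oplus>\<^bsub>AM.T\<^esub> AM.pure ?x3 (s2 (s1 u v) w))"
      using abc uvw by (simp add: o1(2) o2(2) o2'(4) bc Ac Aa e AUV.pure_closed AW.pure_closed)
    \<comment> \<open>The components at \<open>?x1\<close>, \<open>?x2\<close> and
      \<open>?x3\<close> match by the three dendriform identities \<open>pp\<close>,
      \<open>sp\<close> and \<open>ss\<close>, one for each leading factor.\<close>
    also have "\<dots> = AM.pure ?x1 (p4 u (p3 v w)) \<oplus>\<^bsub>AM.T\<^esub> AM.pure ?x1 (p4 u (s3 v w)) \<oplus>\<^bsub>AM.T\<^esub>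
      AM.pure ?x3 (s2 (p1 u v) w) \<oplus>\<^bsub>AM.T\<^esub>
      (AM.pure ?x2 (s4 u (p3 v w)) \<oplus>\<^bsub>AM.T\<^esub> AM.pure ?x3 (s2 (s1 u v) w))"
      using abc uvw
      by (simp add: pp sp bilinear_opD(5)[OF b4(1)] bilinear_opD(5)[OF AM.pure_bilinear] bc Ac)
    also have "\<dots> = AM.pure ?x1 (p4 u (p3 v w)) \<oplus>\<^bsub>AM.T\<^esub> AM.pure ?x2 (s4 u (p3 v w)) \<oplus>\<^bsub>AM.T\<^esub>
      (AM.pure ?x1 (p4 u (s3 v w)) \<oplus>\<^bsub>AM.T\<^esub>
        (AM.pure ?x3 (s2 (p1 u v) w) \<oplus>\<^bsub>AM.T\<^esub> AM.pure ?x3 (s2 (s1 u v) w)))"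
      using abc uvw by (simp add: AM.T.M.a_ac P bc Ac)
    also have "AM.pure ?x3 (s2 (p1 u v) w) \<oplus>\<^bsub>AM.T\<^esub> AM.pure ?x3 (s2 (s1 u v) w) =
        AM.pure ?x3 (s4 u (s3 v w))"
      using abc uvw by (simp add: ss bilinear_opD(4)[OF b2(2)] bilinear_opD(5)[OF AM.pure_bilinear] bc Ac)
    also have "AM.pure ?x1 (p4 u (p3 v w)) \<oplus>\<^bsub>AM.T\<^esub> AM.pure ?x2 (s4 u (p3 v w)) \<oplus>\<^bsub>AM.T\<^esub>
      (AM.pure ?x1 (p4 u (s3 v w)) \<oplus>\<^bsub>AM.T\<^esub> AM.pure ?x3 (s4 u (s3 v w))) =
      ?o4 (AU.pure a u) (?o3 (AV.pure b v) (AW.pure c w))"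
      using abc uvw by (simp add: o3(2) o4(2) o4'(5) bc Ac Aa e AVW.pure_closed AU.pure_closed)
    finally show ?thesis .
  qed
  \<comment> \<open>Both sides are linear in each argument, so pure tensors are released one at a
    time: \<open>z\<close>, then \<open>y\<close>, then \<open>x\<close>.\<close>
  have 1: "?o2 (?o1 (AU.pure a u) (AV.pure b v)) z = ?o4 (AU.pure a u) (?o3 (AV.pure b v) z)"
    if "a \<in> carrier A" "b \<in> carrier A" "u \<in> carrier U" "v \<in> carrier V" for a b u v
  proof (rule AW.tensor_ext[OF AM.linear_space_tensor _ _ _ z])
    show "?o2 (?o1 (AU.pure a u) (AV.pure b v)) \<in> lin_maps K AW.T AM.T"
      by (intro o2' o1' AU.pure_closed AV.pure_closed that)
    show "(\<lambda>z. ?o4 (AU.pure a u) (?o3 (AV.pure b v) z)) \<in> lin_maps K AW.T AM.T"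
      by (intro lin_maps_comp[OF o3'(1) o4'(1)] AU.pure_closed AV.pure_closed that)
  qed (use that pure in auto)
  have 2: "?o2 (?o1 (AU.pure a u) y) z = ?o4 (AU.pure a u) (?o3 y z)"
    if "a \<in> carrier A" "u \<in> carrier U" for a u
  proof (rule AV.tensor_ext[OF AM.linear_space_tensor _ _ _ y])
    show "(\<lambda>y. ?o2 (?o1 (AU.pure a u) y) z) \<in> lin_maps K AV.T AM.T"
      by (intro lin_maps_comp[OF o1'(1) o2'(2)] AU.pure_closed that z)
    show "(\<lambda>y. ?o4 (AU.pure a u) (?o3 y z)) \<in> lin_maps K AV.T AM.T"
      by (intro lin_maps_comp[OF o3'(2) o4'(1)] AU.pure_closed that z)
  qed (use that 1 in auto)
  show ?thesis
  proof (rule AU.tensor_ext[OF AM.linear_space_tensor _ _ _ x])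
    show "(\<lambda>x. ?o2 (?o1 x y) z) \<in> lin_maps K AU.T AM.T"
      by (intro lin_maps_comp[OF o1'(2) o2'(2)] y z)
    show "(\<lambda>x. ?o4 x (?o3 y z)) \<in> lin_maps K AU.T AM.T"
      by (intro o4' o3' y z)
  qed (use 2 in auto)
qed

section \<open>Words in Perm algebras\<close>

locale perm_alg = linear_space K A
  for K :: "'k ring" and A :: "('k, 'a) module" (structure) +
  assumes perm: "perm_algebra K A"
begin

lemma mult_bil: "bilinear_op K A A A (mult A)"
  using perm by (simp add: perm_algebra_def algebra_over_def)

lemmas mult_closed [simp, intro] = bilinear_opD(3)[OF mult_bil]

lemma mult_assoc:
  "\<lbrakk>a \<in> carrier A; b \<in> carrier A; c \<in> carrier A\<rbrakk> \<Longrightarrow> a \<otimes> (b \<otimes> c) = (a \<otimes> b) \<otimes> c"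
  using perm by (simp add: perm_algebra_def)

lemma mult_swap:
  "\<lbrakk>a \<in> carrier A; b \<in> carrier A; c \<in> carrier A\<rbrakk> \<Longrightarrow> (a \<otimes> b) \<otimes> c = (a \<otimes> c) \<otimes> b"
  using perm by (simp add: perm_algebra_def)

text \<open>Left-normed product with the leading factor kept apart from the tail, since only the
  tail may be permuted.\<close>

abbreviation prods :: "'a \<Rightarrow> 'a list \<Rightarrow> 'a"
  where "prods \<equiv> foldl (mult A)"

lemma prods_closed [intro]: "a \<in> carrier A \<Longrightarrow> set xs \<subseteq> carrier A \<Longrightarrow> prods a xs \<in> carrier A"
  by (induction xs arbitrary: a) auto

lemma prods_mult_left:
  "\<lbrakk>a \<in> carrier A; b \<in> carrier A; set xs \<subseteq> carrier A\<rbrakk> \<Longrightarrow>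
    a \<otimes> prods b xs = prods (a \<otimes> b) xs"
  by (induction xs arbitrary: b) (auto simp: mult_assoc)

lemma prods_move:
  "\<lbrakk>a \<in> carrier A; x \<in> carrier A; set us \<subseteq> carrier A\<rbrakk> \<Longrightarrow>
    prods a (us @ x # vs) = prods (a \<otimes> x) (us @ vs)"
  by (induction us arbitrary: a) (auto simp: mult_swap)

text \<open>By \<open>prods_move\<close> any entry of the tail can be pulled to the front, so
  \<open>ys\<close> is matched with \<open>xs\<close> entry by entry.\<close>

lemma prods_perm:
  "\<lbrakk>a \<in> carrier A; set xs \<subseteq> carrier A; mset xs = mset ys\<rbrakk> \<Longrightarrow> prods a xs = prods a ys"
proof (induction xs arbitrary: a ys)
  case Nil
  then show ?case by simp
next
  case (Cons x xs)
  have sub: "set ys \<subseteq> carrier A"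
    using Cons.prems(2) by (simp only: mset_eq_setD[OF Cons.prems(3)])
  have "x \<in> set ys" using mset_eq_setD[OF Cons.prems(3)] by auto
  then obtain us vs where ys: "ys = us @ x # vs" by (meson split_list)
  then have "mset xs = mset (us @ vs)" using Cons.prems(3) by simp
  then have "prods (a \<otimes> x) xs = prods (a \<otimes> x) (us @ vs)"
    using Cons.prems by (intro Cons.IH) auto
  then show ?case using prods_move[of a x us vs] Cons.prems sub by (simp add: ys)
qed

text \<open>A product inside the tail dissolves in either order. Both orders occur because the
  product of \<open>A \<otimes> B\<close> has a term with \<open>a a'\<close> and one with
  \<open>a' a\<close>.\<close>

lemma prods_merge:
  assumes "p \<in> carrier A" and "x \<in> carrier A" and "y \<in> carrier A"
  shows "prods p ((x \<otimes> y) # ws) = prods p (x # y # ws)"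
    and "prods p ((y \<otimes> x) # ws) = prods p (x # y # ws)"
  using assms by (simp_all add: mult_assoc) (simp add: mult_swap[of p y x])

lemma prods_lin: "set xs \<subseteq> carrier A \<Longrightarrow> (\<lambda>a. prods a xs) \<in> lin_maps K A A"
proof (induction xs)
  case Nil
  then show ?case by (simp add: id_lin_map)
next
  case (Cons x xs)
  then show ?case using lin_maps_comp[OF bilinear_opD(2)[OF mult_bil, of x]] by simp
qed

text \<open>The coefficient of \<open>f (r, bs)\<close> in \<open>Psi\<close>; its leading factor is
  entry number \<open>r\<close>, counting from 1.\<close>

definition word :: "nat \<Rightarrow> 'a list \<Rightarrow> 'a"
  where "word r as = list_mult A (rev (take r as) @ drop r as)"

text \<open>The working form of \<open>word\<close>: identities between words reduce to comparing
  leading factors, and the remaining factors as multisets.\<close>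

lemma word_eq:
  assumes "set (us @ x # vs) \<subseteq> carrier A" and "mset ys = mset (us @ vs)"
  shows "word (Suc (length us)) (us @ x # vs) = prods x ys"
proof -
  have "word (Suc (length us)) (us @ x # vs) = prods x (rev us @ vs)"
    by (simp add: word_def list_mult_def)
  also have "\<dots> = prods x ys"
    using assms by (intro prods_perm) auto
  finally show ?thesis .
qed

lemma split_tuple:
  assumes "as \<in> tuples A n" and "r \<in> {1..n}"
  obtains us x vs where "as = us @ x # vs" and "r = Suc (length us)" and "set us \<subseteq> carrier A"
    and "x \<in> carrier A" and "set vs \<subseteq> carrier A"
proof -
  have len: "r - 1 < length as" using assms by (auto simp: tuples_def)
  have "as = take (r - 1) as @ as ! (r - 1) # drop (Suc (r - 1)) as"
    by (rule id_take_nth_drop[OF len])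
  moreover have "r = Suc (length (take (r - 1) as))" using assms len by auto
  moreover have "set as \<subseteq> carrier A" using assms by (simp add: tuples_def)
  ultimately show ?thesis using that by (metis Un_subset_iff insert_subset list.simps(15) set_append)
qed

lemma word_closed:
  assumes "as \<in> tuples A n" and "r \<in> {1..n}"
  shows "word r as \<in> carrier A"
proof -
  obtain us x vs where d: "as = us @ x # vs" "r = Suc (length us)" "set us \<subseteq> carrier A"
    "x \<in> carrier A" "set vs \<subseteq> carrier A"
    using split_tuple[OF assms] .
  then show ?thesis using word_eq[of us x vs "us @ vs"] by auto
qed

text \<open>Multiplying by \<open>a\<close> on the left makes \<open>a\<close> lead; on the right it
  keeps the old leader. Prepending \<open>a\<close> to the list shifts the old leader by one place,
  appending it does not, which accounts for the four indices.\<close>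

lemma word_left:
  assumes "as \<in> tuples A n" and "r \<in> {1..n}" and a: "a \<in> carrier A"
  shows "a \<otimes> word r as = word 1 (a # as)"
    and "word r as \<otimes> a = word (Suc r) (a # as)"
    and "word r as \<otimes> a = word r (as @ [a])"
    and "a \<otimes> word r as = word (Suc n) (as @ [a])"
proof -
  obtain us x vs where d: "as = us @ x # vs" "r = Suc (length us)" "set us \<subseteq> carrier A"
    "x \<in> carrier A" "set vs \<subseteq> carrier A"
    using split_tuple[OF assms(1,2)] .
  have w: "word r as = prods x (us @ vs)" using word_eq[of us x vs "us @ vs"] d by simp
  have n: "n = length as" using assms(1) by (simp add: tuples_def)
  have l: "a \<otimes> prods x (us @ vs) = prods a (x # us @ vs)"
    using prods_mult_left[of a x "us @ vs"] d a by simp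
  have r: "prods x (us @ vs) \<otimes> a = prods x (us @ vs @ [a])" by simp
  show "a \<otimes> word r as = word 1 (a # as)"
    unfolding w l using word_eq[of "[]" a as "x # us @ vs"] d a by simp
  show "word r as \<otimes> a = word (Suc r) (a # as)"
    unfolding w r using word_eq[of "a # us" x vs "us @ vs @ [a]"] d a by (simp del: foldl_append)
  show "word r as \<otimes> a = word r (as @ [a])"
    unfolding w r using word_eq[of us x "vs @ [a]" "us @ vs @ [a]"] d a by (simp del: foldl_append)
  show "a \<otimes> word r as = word (Suc n) (as @ [a])"
    unfolding w l n using word_eq[of as a "[]" "x # us @ vs"] d a by simp
qed

text \<open>Merging two tail entries in either order leaves the word alone, and only the leading
  position may shift. Merging at the leading position keeps \<open>x\<close> in the lead for
  \<open>x \<otimes> y\<close> and puts its neighbour \<open>y\<close> there for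
  \<open>y \<otimes> x\<close>, hence \<open>r\<close> versus \<open>Suc r\<close>.\<close>

lemma word_contract:
  assumes as: "as \<in> tuples A (Suc n)" and k: "k < n" and r: "r \<in> {1..n}"
    and m: "m = mult A \<or> m = (\<lambda>x y. y \<otimes> x)"
  shows "r \<le> k \<Longrightarrow> word r (contract m (Suc k) as) = word r as"
    and "Suc k < r \<Longrightarrow> word r (contract m (Suc k) as) = word (Suc r) as"
    and "r = Suc k \<Longrightarrow> word r (contract (mult A) (Suc k) as) = word r as"
    and "r = Suc k \<Longrightarrow> word r (contract (\<lambda>x y. y \<otimes> x) (Suc k) as) = word (Suc r) as"
proof -
  have len: "length as = Suc n" and sub: "set as \<subseteq> carrier A" using as by (auto simp: tuples_def)
  define us where "us = take k as"
  define x where "x = as ! k"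
  define y where "y = as ! Suc k"
  define vs where "vs = drop (Suc (Suc k)) as"
  have "as = take k as @ as ! k # drop (Suc k) as"
    using len k by (intro id_take_nth_drop) simp
  moreover have "drop (Suc k) as = as ! Suc k # drop (Suc (Suc k)) as"
    using len k by (intro Cons_nth_drop_Suc[symmetric]) simp
  ultimately have d: "as = us @ x # y # vs" by (simp add: us_def x_def y_def vs_def)
  have lu: "length us = k" using len k by (simp add: us_def)
  have c: "contract f (Suc k) as = us @ f x y # vs" for f
    by (simp add: contract_def us_def x_def y_def vs_def)
  have s: "set us \<subseteq> carrier A" "set vs \<subseteq> carrier A" "x \<in> carrier A" "y \<in> carrier A"
    using sub by (auto simp: d)
  have mxy: "m x y \<in> carrier A" using m s by auto
  have merge: "prods p (m x y # ws) = prods p (x # y # ws)" if "p \<in> carrier A" for p ws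
    using m prods_merge[OF that s(3,4)] by auto
  show "word r (contract m (Suc k) as) = word r as" if "r \<le> k"
  proof -
    have "us \<in> tuples A k" "r \<in> {1..k}" using s lu r that by (auto simp: tuples_def)
    from split_tuple[OF this] obtain ps p qs where p: "us = ps @ p # qs" "r = Suc (length ps)"
      "set ps \<subseteq> carrier A" "p \<in> carrier A" "set qs \<subseteq> carrier A" .
    have "word r (ps @ p # (qs @ m x y # vs)) = prods p (m x y # ps @ qs @ vs)"
      unfolding p(2) using s p mxy by (intro word_eq) auto
    also have "\<dots> = word r (ps @ p # (qs @ x # y # vs))"
      unfolding merge[OF p(4)] p(2) using s p by (intro word_eq[symmetric]) auto
    finally show ?thesis unfolding c by (simp add: d p)
  qed
  show "word r (contract m (Suc k) as) = word (Suc r) as" if "Suc k < r"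
  proof -
    have "vs \<in> tuples A (n - Suc k)" "r - Suc k \<in> {1..n - Suc k}"
      using s len lu r that by (auto simp: tuples_def d)
    from split_tuple[OF this] obtain ps p qs where p: "vs = ps @ p # qs" "r - Suc k = Suc (length ps)"
      "set ps \<subseteq> carrier A" "p \<in> carrier A" "set qs \<subseteq> carrier A" .
    have r: "r = Suc (length (us @ m x y # ps))" "Suc r = Suc (length (us @ x # y # ps))"
      using p(2) lu that by auto
    have "word r ((us @ m x y # ps) @ p # qs) = prods p (m x y # us @ ps @ qs)"
      unfolding r(1) using s p mxy by (intro word_eq) auto
    also have "\<dots> = word (Suc r) ((us @ x # y # ps) @ p # qs)"
      unfolding merge[OF p(4)] r(2) using s p by (intro word_eq[symmetric]) auto
    finally show ?thesis unfolding c by (simp add: d p)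
  qed
  show "word r (contract (mult A) (Suc k) as) = word r as" if "r = Suc k"
  proof -
    have r: "r = Suc (length us)" using that lu by simp
    have "word r (us @ (x \<otimes> y) # vs) = prods x (y # us @ vs)"
      unfolding r using s word_eq[of us "x \<otimes> y" vs "us @ vs"] by simp
    also have "\<dots> = word r (us @ x # (y # vs))"
      unfolding r using s by (intro word_eq[symmetric]) auto
    finally show ?thesis unfolding c by (simp add: d)
  qed
  show "word r (contract (\<lambda>x y. y \<otimes> x) (Suc k) as) = word (Suc r) as" if "r = Suc k"
  proof -
    have r: "r = Suc (length us)" "Suc r = Suc (length (us @ [x]))" using that lu by auto
    have "word r (us @ (y \<otimes> x) # vs) = prods y (x # us @ vs)"
      unfolding r(1) using s word_eq[of us "y \<otimes> x" vs "us @ vs"] by simp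
    also have "\<dots> = word (Suc r) ((us @ [x]) @ y # vs)"
      unfolding r(2) using s by (intro word_eq[symmetric]) auto
    finally show ?thesis unfolding c by (simp add: d)
  qed
qed

lemma multilinear_word:
  assumes r: "r \<in> {1..n}"
  shows "multilinear K A A n (word r)"
  unfolding multilinear_def
proof (intro ballI conjI allI impI)
  fix as i assume as: "as \<in> tuples A n"
  show "word r as \<in> carrier A" by (rule word_closed[OF as r])
  assume i: "i < n"
  obtain us x vs where d: "as = us @ x # vs" "r = Suc (length us)" "set us \<subseteq> carrier A"
    "x \<in> carrier A" "set vs \<subseteq> carrier A"
    using split_tuple[OF as r] .
  obtain ps c qs where e: "as = ps @ c # qs" "Suc i = Suc (length ps)" "set ps \<subseteq> carrier A"
    "c \<in> carrier A" "set qs \<subseteq> carrier A"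
    using split_tuple[OF as, of "Suc i"] i by auto
  have up: "as[i := a] = ps @ a # qs" for a using e by (simp add: list_update_append)
  have ls: "linear_space K A" by (rule linear_space_axioms)
  have main: "(\<lambda>a. word r (as[i := a])) \<in> lin_maps K A A"
    if "g \<in> lin_maps K A A" "\<And>a. a \<in> carrier A \<Longrightarrow> word r (as[i := a]) = g a" for g
    using lin_maps_cong[OF that(1) ls that(2)] .
  \<comment> \<open>An entry of the tail can be moved directly behind the leading factor; linearity
    in it is then bilinearity of the product followed by \<open>prods_lin\<close>.\<close>
  have other: "(\<lambda>a. word r (as[i := a])) \<in> lin_maps K A A"
    if "set ws \<subseteq> carrier A" "p \<in> carrier A"
      and "\<And>a. a \<in> carrier A \<Longrightarrow> word r (as[i := a]) = prods p (a # ws)" for p ws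
    using that lin_maps_comp[OF bilinear_opD(1)[OF mult_bil that(2)] prods_lin[OF that(1)]]
    by (intro main) auto
  consider "i = length us" | "i < length us" | "i > length us" by linarith
  then show "(\<lambda>a. word r (as[i := a])) \<in> lin_maps K A A"
  proof cases
    case 1
    have "set (us @ vs) \<subseteq> carrier A" using d by simp
    moreover have "word r (as[i := a]) = prods a (us @ vs)" if "a \<in> carrier A" for a
      using word_eq[of us a vs "us @ vs"] d that 1 by (simp add: list_update_append)
    ultimately show ?thesis using prods_lin[of "us @ vs"] by (intro main)
  next
    case 2
    define zs where "zs = take i us @ drop (Suc i) us @ vs"
    show ?thesis
    proof (rule other)
      show "set zs \<subseteq> carrier A"
        using d set_take_subset[of i us] set_drop_subset[of "Suc i" us] by (auto simp: zs_def)
      show "x \<in> carrier A" by fact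
      fix a assume a: "a \<in> carrier A"
      have u: "us[i := a] = take i us @ a # drop (Suc i) us"
        using 2 by (simp add: upd_conv_take_nth_drop)
      have "word (Suc (length (us[i := a]))) (us[i := a] @ x # vs) = prods x (a # zs)"
        using d a set_update_subset_insert[of us i a]
        by (intro word_eq) (auto simp: zs_def u)
      then show "word r (as[i := a]) = prods x (a # zs)"
        using 2 d by (simp add: list_update_append)
    qed
  next
    case 3
    define j where "j = i - Suc (length us)"
    have j: "j < length vs" "i = Suc (length us) + j"
      using 3 i as d by (auto simp: j_def tuples_def)
    define zs where "zs = us @ take j vs @ drop (Suc j) vs"
    show ?thesis
    proof (rule other)
      show "set zs \<subseteq> carrier A"
        using d set_take_subset[of j vs] set_drop_subset[of "Suc j" vs] by (auto simp: zs_def)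
      show "x \<in> carrier A" by fact
      fix a assume a: "a \<in> carrier A"
      have u: "vs[j := a] = take j vs @ a # drop (Suc j) vs"
        using j by (simp add: upd_conv_take_nth_drop)
      have "word (Suc (length us)) (us @ x # vs[j := a]) = prods x (a # zs)"
        using d a set_update_subset_insert[of vs j a]
        by (intro word_eq) (auto simp: zs_def u)
      then show "word r (as[i := a]) = prods x (a # zs)"
        using j d by (simp add: list_update_append)
    qed
  qed
qed

text \<open>Each factor behind the leading one contributes a factor \<open>e = 1\<close>, so only
  the value at the leader is left.\<close>

lemma word_functional:
  assumes mult: "\<And>u v. u \<in> carrier A \<Longrightarrow> v \<in> carrier A \<Longrightarrow> f (u \<otimes> v) = f u \<otimes>\<^bsub>K\<^esub> e v"
    and f: "\<And>u. u \<in> carrier A \<Longrightarrow> f u \<in> carrier K"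
    and as: "as \<in> tuples A n" and e: "\<And>a. a \<in> set as \<Longrightarrow> e a = \<one>\<^bsub>K\<^esub>" and r: "r \<in> {1..n}"
  shows "f (word r as) = f (as ! (r - 1))"
proof -
  obtain us x vs where d: "as = us @ x # vs" "r = Suc (length us)" "set us \<subseteq> carrier A"
    "x \<in> carrier A" "set vs \<subseteq> carrier A"
    using split_tuple[OF as r] .
  have "f (prods a ws) = f a" if "a \<in> carrier A" "set ws \<subseteq> carrier A" "\<And>b. b \<in> set ws \<Longrightarrow> e b = \<one>\<^bsub>K\<^esub>" for a ws
    using that
  proof (induction ws arbitrary: a)
    case (Cons b ws)
    then have "f (prods (a \<otimes> b) ws) = f (a \<otimes> b)" by (intro Cons.IH) auto
    then show ?case using Cons.prems mult f by simp
  qed simp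
  from this[of x "us @ vs"] show ?thesis
    using word_eq[of us x vs "us @ vs"] d e by simp
qed

end

section \<open>Functionals on the free Perm algebra\<close>

text \<open>\<open>free_assoc\<close> and \<open>tensor_algebra\<close> only replace the product of
  a linear space, so their linear structure is that of the underlying record.\<close>

lemma linear_space_mult_update [simp]:
  "linear_space K (M\<lparr>mult := m\<rparr>) \<longleftrightarrow> linear_space K M"
  by (simp add: linear_space_def module_def module_axioms_def abelian_group_def abelian_monoid_def
      abelian_group_axioms_def)

lemma mult_update_simps [simp]:
  "lin_maps K (M\<lparr>mult := m\<rparr>) V = lin_maps K M V" "lin_maps K U (M\<lparr>mult := m\<rparr>) = lin_maps K U M"
  "tuples (M\<lparr>mult := m\<rparr>) n = tuples M n"
  by (simp_all add: lin_maps_def tuples_def)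

text \<open>The scalars as a module over themselves, so that functionals are \<open>lin_maps\<close>
  into it.\<close>

definition self_module :: "'k ring \<Rightarrow> ('k, 'k) module"
  where "self_module K = \<lparr>carrier = carrier K, mult = mult K, one = \<one>\<^bsub>K\<^esub>, zero = \<zero>\<^bsub>K\<^esub>,
    add = add K, smult = mult K\<rparr>"

lemma self_module_simps [simp]:
  "carrier (self_module K) = carrier K" "\<zero>\<^bsub>self_module K\<^esub> = \<zero>\<^bsub>K\<^esub>"
  "x \<oplus>\<^bsub>self_module K\<^esub> y = x \<oplus>\<^bsub>K\<^esub> y" "c \<odot>\<^bsub>self_module K\<^esub> x = c \<otimes>\<^bsub>K\<^esub> x"
  by (simp_all add: self_module_def)

lemma linear_space_self_module:
  assumes "cring K"
  shows "linear_space K (self_module K)"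
proof -
  interpret cring K by fact
  show ?thesis
  proof (rule linear_space.intro, rule moduleI)
    show "abelian_group (self_module K)"
      by (rule abelian_groupI) (auto simp: a_ac intro: l_neg)
  qed (auto simp: l_distr r_distr m_assoc intro: assms)
qed

text \<open>The isomorphism in \<open>free_perm_algebra\<close> starts at \<open>Perm K X\<close>;
  functionals travel to \<open>A\<close> along its inverse.\<close>

lemma lin_maps_inv:
  assumes h: "h \<in> lin_maps K U V" and "linear_space K U" and bij: "bij_betw h (carrier U) (carrier V)"
  shows "inv_into (carrier U) h \<in> lin_maps K V U"
proof (rule lin_mapsI)
  interpret U: linear_space K U by fact
  let ?g = "inv_into (carrier U) h"
  have hg: "?g x \<in> carrier U" "h (?g x) = x" if "x \<in> carrier V" for x
    using that bij bij_betw_inv_into_right[OF bij] bij_betwE[OF bij_betw_inv_into[OF bij]] by auto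
  have gh: "?g (h x) = x" if "x \<in> carrier U" for x using bij_betw_inv_into_left[OF bij that] .
  fix x assume x: "x \<in> carrier V"
  show "?g x \<in> carrier U" using hg x by blast
  show "?g (x \<oplus>\<^bsub>V\<^esub> y) = ?g x \<oplus>\<^bsub>U\<^esub> ?g y" if y: "y \<in> carrier V" for y
    using gh[of "?g x \<oplus>\<^bsub>U\<^esub> ?g y"] hg[OF x] hg[OF y] by (simp add: lin_maps_add[OF h])
  show "?g (c \<odot>\<^bsub>V\<^esub> x) = c \<odot>\<^bsub>U\<^esub> ?g x" if c: "c \<in> carrier K" for c
    using gh[of "c \<odot>\<^bsub>U\<^esub> ?g x"] hg[OF x] c by (simp add: lin_maps_smult[OF h])
qed

lemma (in linear_space) submodule_zero:
  assumes "submodule W K M"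
  shows "\<zero> \<in> W"
  using subgroup.one_closed[OF submodule.axioms(1)[OF assms]] by simp

lemma two_sided_ideal_hull:
  assumes ls: "linear_space K F" and b: "bilinear_op K F F F (mult F)" and "S \<subseteq> carrier F"
  shows "two_sided_ideal K F (two_sided_ideal K F hull S)"
proof -
  interpret F: linear_space K F by fact
  let ?H = "two_sided_ideal K F hull S"
  have "two_sided_ideal K F (carrier F)"
    using F.carrier_is_submodule bilinear_opD(3)[OF b] by (auto simp: two_sided_ideal_def)
  then have sub: "?H \<subseteq> carrier F" using assms(3) by (intro hull_minimal)
  have mem: "x \<in> ?H \<longleftrightarrow> (\<forall>T. two_sided_ideal K F T \<and> S \<subseteq> T \<longrightarrow> x \<in> T)" for x
    by (auto simp: hull_def)
  have sT: "submodule T K F" if "two_sided_ideal K F T" for T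
    using that by (simp add: two_sided_ideal_def)
  have "submodule ?H K F"
  proof (rule F.submoduleI[OF sub])
    show "\<zero>\<^bsub>F\<^esub> \<in> ?H" unfolding mem using F.submodule_zero[OF sT] by blast
    show "\<ominus>\<^bsub>F\<^esub> x \<in> ?H" if "x \<in> ?H" for x
      using that F.submoduleE(3)[OF sT] unfolding mem by blast
    show "x \<oplus>\<^bsub>F\<^esub> y \<in> ?H" if "x \<in> ?H" "y \<in> ?H" for x y
      using that F.submoduleE(5)[OF sT] unfolding mem by blast
    show "c \<odot>\<^bsub>F\<^esub> x \<in> ?H" if "c \<in> carrier K" "x \<in> ?H" for c x
      using that F.submoduleE(4)[OF sT] unfolding mem by blast
  qed
  then show ?thesis by (auto simp: two_sided_ideal_def hull_def)
qed

text \<open>The product of cosets is a union over pairs of representatives, and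
  \<open>x y - p q = (x - p) y + p (y - q)\<close> lies in the ideal.\<close>

lemma quot_module_mult:
  assumes ls: "linear_space K F" and b: "bilinear_op K F F F (mult F)" and W: "two_sided_ideal K F W"
    and p: "p \<in> carrier F" and q: "q \<in> carrier F"
  shows "(W +>\<^bsub>F\<^esub> p) \<otimes>\<^bsub>quot_module F W\<^esub> (W +>\<^bsub>F\<^esub> q) = W +>\<^bsub>F\<^esub> (p \<otimes>\<^bsub>F\<^esub> q)"
proof -
  interpret F: linear_space K F by fact
  have sW: "submodule W K F" using W by (simp add: two_sided_ideal_def)
  have mem: "x \<in> carrier F \<and> x \<ominus>\<^bsub>F\<^esub> y \<in> W" if "x \<in> W +>\<^bsub>F\<^esub> y" "y \<in> carrier F" for x y
    using F.mem_coset_iff[OF sW that(2), of x] F.coset_eq_iff[OF sW _ that(2), of x] that(1) by auto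
  have self: "y \<in> W +>\<^bsub>F\<^esub> y" if "y \<in> carrier F" for y
    using F.mem_coset_iff[OF sW that, of y] that by auto
  have eq: "W +>\<^bsub>F\<^esub> (x \<otimes>\<^bsub>F\<^esub> y) = W +>\<^bsub>F\<^esub> (p \<otimes>\<^bsub>F\<^esub> q)"
    if x: "x \<in> W +>\<^bsub>F\<^esub> p" and y: "y \<in> W +>\<^bsub>F\<^esub> q" for x y
  proof -
    note xm = mem[OF x p] and ym = mem[OF y q]
    have "(x \<ominus>\<^bsub>F\<^esub> p) \<otimes>\<^bsub>F\<^esub> y \<in> W" "p \<otimes>\<^bsub>F\<^esub> (y \<ominus>\<^bsub>F\<^esub> q) \<in> W"
      using W xm ym p by (auto simp: two_sided_ideal_def)
    then have "x \<otimes>\<^bsub>F\<^esub> y \<ominus>\<^bsub>F\<^esub> p \<otimes>\<^bsub>F\<^esub> y \<in> W" "p \<otimes>\<^bsub>F\<^esub> y \<ominus>\<^bsub>F\<^esub> p \<otimes>\<^bsub>F\<^esub> q \<in> W"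
      using xm ym p q lin_maps_minus[OF bilinear_opD(1)[OF b] ls ls]
        lin_maps_minus[OF bilinear_opD(2)[OF b] ls ls] by auto
    then show ?thesis
      using F.coset_eq_iff[OF sW] xm ym p q bilinear_opD(3)[OF b] by metis
  qed
  have "(\<Union>x\<in>W +>\<^bsub>F\<^esub> p. \<Union>y\<in>W +>\<^bsub>F\<^esub> q. W +>\<^bsub>F\<^esub> (x \<otimes>\<^bsub>F\<^esub> y)) = W +>\<^bsub>F\<^esub> (p \<otimes>\<^bsub>F\<^esub> q)"
    by (rule UN_const_eq[OF self[OF p]], rule UN_const_eq[OF self[OF q]], rule eq)
  then show ?thesis by (simp add: quot_module_def rcoset_mult_def)
qed

locale free_associative = cring K for K :: "'k ring" +
  fixes X :: "'x set"
begin

abbreviation S where "S \<equiv> lists X - {[]}"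
abbreviation F where "F \<equiv> free_assoc K X"
abbreviation V where "V \<equiv> free_module K S"

lemma F_simps: "carrier F = carrier V" "add F = add V" "zero F = zero V" "smult F = smult V"
  by (simp_all add: free_assoc_def)

lemma linear_space_F: "linear_space K F"
  unfolding free_assoc_def by (simp add: linear_space_free_module[OF is_cring])

lemma lin_maps_F [simp]: "lin_maps K F U = lin_maps K V U" "lin_maps K U F = lin_maps K U V"
  by (simp_all add: free_assoc_def)

sublocale F: linear_space K F by (rule linear_space_F)
sublocale V: linear_space K V by (rule linear_space_free_module[OF is_cring])

lemma F_apply:
  "p \<otimes>\<^bsub>F\<^esub> q = (\<lambda>w. \<Oplus>\<^bsub>K\<^esub>i\<in>{..length w}. p (take i w) \<otimes>\<^bsub>K\<^esub> q (drop i w))"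
  by (simp add: free_assoc_def)

lemma F_coeff: "p \<in> carrier F \<Longrightarrow> p w \<in> carrier K"
  by (simp add: F_simps free_module_def)

lemma F_mult_closed:
  assumes p: "p \<in> carrier F" and q: "q \<in> carrier F"
  shows "p \<otimes>\<^bsub>F\<^esub> q \<in> carrier F"
proof -
  let ?s = "\<lambda>p. {w. p w \<noteq> \<zero>\<^bsub>K\<^esub>}"
  \<comment> \<open>A nonzero coefficient at \<open>w\<close> needs a cut of \<open>w\<close> into
    words from the two supports. This makes the support finite and, both parts being nonempty, keeps
    the empty word out of it.\<close>
  have sub: "?s (p \<otimes>\<^bsub>F\<^esub> q) \<subseteq> (\<lambda>(u, v). u @ v) ` (?s p \<times> ?s q)"
  proof
    fix w assume w: "w \<in> ?s (p \<otimes>\<^bsub>F\<^esub> q)"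
    have "\<exists>i\<in>{..length w}. p (take i w) \<otimes>\<^bsub>K\<^esub> q (drop i w) \<noteq> \<zero>\<^bsub>K\<^esub>"
    proof (rule ccontr)
      assume "\<not> ?thesis"
      then have "(p \<otimes>\<^bsub>F\<^esub> q) w = \<zero>\<^bsub>K\<^esub>" unfolding F_apply by (intro add.finprod_one_eqI) auto
      then show False using w by simp
    qed
    then obtain i where "p (take i w) \<otimes>\<^bsub>K\<^esub> q (drop i w) \<noteq> \<zero>\<^bsub>K\<^esub>" by blast
    then have "take i w \<in> ?s p" "drop i w \<in> ?s q"
      using F_coeff[OF p] F_coeff[OF q] by auto
    then show "w \<in> (\<lambda>(u, v). u @ v) ` (?s p \<times> ?s q)"
      by (intro image_eqI[of _ _ "(take i w, drop i w)"]) auto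
  qed
  have sp: "finite (?s p)" "?s p \<subseteq> S" "finite (?s q)" "?s q \<subseteq> S"
    using p q by (auto simp: F_simps free_module_def)
  have "finite (?s (p \<otimes>\<^bsub>F\<^esub> q))" by (rule finite_subset[OF sub]) (use sp in auto)
  moreover have "?s (p \<otimes>\<^bsub>F\<^esub> q) \<subseteq> S" using sub sp by fastforce
  moreover have "(p \<otimes>\<^bsub>F\<^esub> q) w \<in> carrier K" for w
    unfolding F_apply using F_coeff[OF p] F_coeff[OF q] by (intro finsum_closed) auto
  ultimately show ?thesis by (simp add: F_simps free_module_def)
qed

lemma F_mult_bilinear: "bilinear_op K F F F (mult F)"
proof (rule bilinear_opI)
  have add: "(p \<oplus>\<^bsub>F\<^esub> q) w = p w \<oplus>\<^bsub>K\<^esub> q w" for p q w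
    by (simp add: F_simps free_module_def)
  have sm: "(c \<odot>\<^bsub>F\<^esub> p) w = c \<otimes>\<^bsub>K\<^esub> p w" for p c w
    by (simp add: F_simps free_module_def)
  fix p q assume p: "p \<in> carrier F" and q: "q \<in> carrier F"
  note pc = F_coeff[OF p] and qc = F_coeff[OF q]
  show "p \<otimes>\<^bsub>F\<^esub> q \<in> carrier F" by (rule F_mult_closed[OF p q])
  show "(p \<oplus>\<^bsub>F\<^esub> p') \<otimes>\<^bsub>F\<^esub> q = p \<otimes>\<^bsub>F\<^esub> q \<oplus>\<^bsub>F\<^esub> p' \<otimes>\<^bsub>F\<^esub> q" if "p' \<in> carrier F" for p'
    using pc qc F_coeff[OF that]
    by (intro ext) (simp add: add F_apply l_distr Pi_def)
  show "p \<otimes>\<^bsub>F\<^esub> (q \<oplus>\<^bsub>F\<^esub> q') = p \<otimes>\<^bsub>F\<^esub> q \<oplus>\<^bsub>F\<^esub> p \<otimes>\<^bsub>F\<^esub> q'" if "q' \<in> carrier F" for q'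
    using pc qc F_coeff[OF that]
    by (intro ext) (simp add: add F_apply r_distr Pi_def)
  show "(c \<odot>\<^bsub>F\<^esub> p) \<otimes>\<^bsub>F\<^esub> q = c \<odot>\<^bsub>F\<^esub> (p \<otimes>\<^bsub>F\<^esub> q)" if "c \<in> carrier K" for c
    using pc qc that
    by (intro ext) (simp add: sm F_apply m_assoc finsum_rdistr Pi_def)
  show "p \<otimes>\<^bsub>F\<^esub> (c \<odot>\<^bsub>F\<^esub> q) = c \<odot>\<^bsub>F\<^esub> (p \<otimes>\<^bsub>F\<^esub> q)" if "c \<in> carrier K" for c
    using pc qc that
    by (intro ext) (simp add: sm F_apply m_lcomm finsum_rdistr Pi_def)
qed

text \<open>Among the cuts of a word only the one at \<open>length u\<close> can give back
  \<open>u\<close> and \<open>v\<close>.\<close>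

lemma single_mult: "single K u \<otimes>\<^bsub>F\<^esub> single K v = single K (u @ v)"
proof
  fix w
  show "(single K u \<otimes>\<^bsub>F\<^esub> single K v) w = single K (u @ v) w"
  proof (cases "w = u @ v")
    case True
    have "(\<Oplus>\<^bsub>K\<^esub>i\<in>{..length w}. single K u (take i w) \<otimes>\<^bsub>K\<^esub> single K v (drop i w)) =
      (\<Oplus>\<^bsub>K\<^esub>i\<in>{..length w}. if length u = i then \<one>\<^bsub>K\<^esub> else \<zero>\<^bsub>K\<^esub>)"
    proof (rule finsum_cong')
      fix i assume i: "i \<in> {..length w}"
      have "take i w = u \<Longrightarrow> length u = i" using i by auto
      then show "single K u (take i w) \<otimes>\<^bsub>K\<^esub> single K v (drop i w) = (if length u = i then \<one>\<^bsub>K\<^esub> else \<zero>\<^bsub>K\<^esub>)"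
        using True by (auto simp: single_def)
    qed auto
    also have "\<dots> = \<one>\<^bsub>K\<^esub>"
      using True by (subst finsum_singleton) auto
    finally show ?thesis using True by (simp add: F_apply single_def)
  next
    case False
    have "(\<Oplus>\<^bsub>K\<^esub>i\<in>{..length w}. single K u (take i w) \<otimes>\<^bsub>K\<^esub> single K v (drop i w)) = \<zero>\<^bsub>K\<^esub>"
    proof (rule add.finprod_one_eqI)
      fix i
      have "take i w \<noteq> u \<or> drop i w \<noteq> v" using False append_take_drop_id[of i w] by auto
      then show "single K u (take i w) \<otimes>\<^bsub>K\<^esub> single K v (drop i w) = \<zero>\<^bsub>K\<^esub>"
        by (auto simp: single_def)
    qed
    then show ?thesis using False by (simp add: F_apply single_def)
  qed
qed

sublocale S: linear_space K "self_module K" by (rule linear_space_self_module[OF is_cring])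

text \<open>The augmentation, which sums all coefficients: the multiplicative functional that sends
  every letter to 1.\<close>

abbreviation aug :: "('x list \<Rightarrow> 'k) \<Rightarrow> 'k"
  where "aug \<equiv> S.lin_ext (\<lambda>_. \<one>\<^bsub>K\<^esub>)"

text \<open>On basis words the claim is \<open>g (u @ v) = g u * 1\<close>, and bilinearity does the
  rest. The constant \<open>g = 1\<close> gives multiplicativity of \<open>aug\<close>; a
  \<open>g\<close> that reads only the first letter gives the functional needed for
  injectivity.\<close>

lemma functional_mult:
  assumes g: "\<And>w. g w \<in> carrier K" and gm: "\<And>u v. u \<noteq> [] \<Longrightarrow> g (u @ v) = g u"
    and p: "p \<in> carrier F" and q: "q \<in> carrier F"
  shows "S.lin_ext g (p \<otimes>\<^bsub>F\<^esub> q) = S.lin_ext g p \<otimes>\<^bsub>K\<^esub> aug q"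
proof -
  have gS: "g \<in> S \<rightarrow> carrier (self_module K)" and oS: "(\<lambda>_. \<one>\<^bsub>K\<^esub>) \<in> S \<rightarrow> carrier (self_module K)"
    using g by auto
  note G = S.lin_ext_lin[OF gS] and E = S.lin_ext_lin[OF oS]
  note Gs = S.lin_ext_single[OF gS] and Es = S.lin_ext_single[OF oS]
  note lsK = linear_space_self_module[OF is_cring]
  have mK: "bilinear_op K (self_module K) (self_module K) (self_module K) (mult K)"
    by (rule bilinear_opI) (auto simp: l_distr r_distr m_assoc m_lcomm)
  note m = bilinear_opD[OF mK] and Fm = bilinear_opD[OF F_mult_bilinear]
  have Gc: "S.lin_ext g p \<in> carrier (self_module K)" if "p \<in> carrier V" for p
    using lin_maps_closed[OF G that] .
  have Ec: "aug p \<in> carrier (self_module K)" if "p \<in> carrier V" for p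
    using lin_maps_closed[OF E that] .
  have sc: "single K u \<in> carrier V" if "u \<in> S" for u by (rule single_closed[OF is_cring that])
  have 1: "S.lin_ext g (single K u \<otimes>\<^bsub>F\<^esub> q) = S.lin_ext g (single K u) \<otimes>\<^bsub>K\<^esub> aug q" if u: "u \<in> S" for u
  proof (rule free_module_ext[OF lsK, of "\<lambda>q. S.lin_ext g (single K u \<otimes>\<^bsub>F\<^esub> q)" S
        "\<lambda>q. S.lin_ext g (single K u) \<otimes>\<^bsub>K\<^esub> aug q"])
    show "(\<lambda>q. S.lin_ext g (single K u \<otimes>\<^bsub>F\<^esub> q)) \<in> lin_maps K V (self_module K)"
      using lin_maps_comp[OF Fm(1)[unfolded lin_maps_F] G] sc[OF u] by (simp add: F_simps)
    show "(\<lambda>q. S.lin_ext g (single K u) \<otimes>\<^bsub>K\<^esub> aug q) \<in> lin_maps K V (self_module K)"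
      by (rule lin_maps_comp[OF E m(1)[OF Gc[OF sc[OF u]]]])
    show "S.lin_ext g (single K u \<otimes>\<^bsub>F\<^esub> single K v) = S.lin_ext g (single K u) \<otimes>\<^bsub>K\<^esub> aug (single K v)"
      if v: "v \<in> S" for v
    proof -
      have "u @ v \<in> S" using u v by auto
      then show ?thesis using u v gm g by (simp add: single_mult Gs Es)
    qed
    show "q \<in> carrier V" using q by (simp add: F_simps)
  qed
  have q': "q \<in> carrier V" using q by (simp add: F_simps)
  show ?thesis
  proof (rule free_module_ext[OF lsK, of "\<lambda>p. S.lin_ext g (p \<otimes>\<^bsub>F\<^esub> q)" S "\<lambda>p. S.lin_ext g p \<otimes>\<^bsub>K\<^esub> aug q"])
    show "(\<lambda>p. S.lin_ext g (p \<otimes>\<^bsub>F\<^esub> q)) \<in> lin_maps K V (self_module K)"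
      using lin_maps_comp[OF Fm(2)[unfolded lin_maps_F] G] q by simp
    show "(\<lambda>p. S.lin_ext g p \<otimes>\<^bsub>K\<^esub> aug q) \<in> lin_maps K V (self_module K)"
      by (rule lin_maps_comp[OF G m(2)[OF Ec[OF q']]])
    show "p \<in> carrier V" using p by (simp add: F_simps)
  qed (rule 1)
qed

lemma perm_ideal_gens:
  "{x \<otimes>\<^bsub>F\<^esub> (y \<otimes>\<^bsub>F\<^esub> z) \<ominus>\<^bsub>F\<^esub> x \<otimes>\<^bsub>F\<^esub> (z \<otimes>\<^bsub>F\<^esub> y) |x y z.
    x \<in> carrier F \<and> y \<in> carrier F \<and> z \<in> carrier F} \<subseteq> carrier F"
  using F_mult_closed by auto

lemma perm_ideal_ideal: "two_sided_ideal K F (perm_ideal K X)"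
  unfolding perm_ideal_def Let_def
  by (rule two_sided_ideal_hull[OF linear_space_F F_mult_bilinear perm_ideal_gens])

lemma functional_vanishes:
  assumes g: "\<And>w. g w \<in> carrier K" and gm: "\<And>u v. u \<noteq> [] \<Longrightarrow> g (u @ v) = g u"
    and p: "p \<in> perm_ideal K X"
  shows "S.lin_ext g p = \<zero>\<^bsub>K\<^esub>"
proof -
  have gS: "g \<in> S \<rightarrow> carrier (self_module K)" and oS: "(\<lambda>_. \<one>\<^bsub>K\<^esub>) \<in> S \<rightarrow> carrier (self_module K)"
    using g by auto
  have G: "S.lin_ext g \<in> lin_maps K F (self_module K)" and E: "aug \<in> lin_maps K F (self_module K)"
    using S.lin_ext_lin[OF gS] S.lin_ext_lin[OF oS] by simp_all
  note lsK = linear_space_self_module[OF is_cring]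
  note Gm = functional_mult[of g, OF g gm] and Em = functional_mult[of "\<lambda>_. \<one>\<^bsub>K\<^esub>", OF one_closed refl]
  note Gc = lin_maps_closed[OF G, simplified] and Ec = lin_maps_closed[OF E, simplified]
  \<comment> \<open>On \<open>a j\<close> the functional is its value at \<open>a\<close> times
    \<open>aug j\<close>, so absorption from the left needs \<open>aug j = 0\<close>. The
    intersection with the kernel of \<open>aug\<close> is therefore the ideal to work with.\<close>
  let ?J = "a_kernel F (self_module K) (S.lin_ext g) \<inter> a_kernel F (self_module K) aug"
  have mem: "p \<in> ?J \<longleftrightarrow> p \<in> carrier F \<and> S.lin_ext g p = \<zero>\<^bsub>K\<^esub> \<and> aug p = \<zero>\<^bsub>K\<^esub>" for p
    by (auto simp: a_kernel_def')
  have s1: "submodule (a_kernel F (self_module K) (S.lin_ext g)) K F"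
    by (rule submodule_kernel[OF G linear_space_F lsK])
  have s2: "submodule (a_kernel F (self_module K) aug) K F"
    by (rule submodule_kernel[OF E linear_space_F lsK])
  have "submodule ?J K F"
    by (rule F.submoduleI)
      (use F.submoduleE[OF s1] F.submoduleE[OF s2] lin_maps_zero[OF G linear_space_F lsK]
        lin_maps_zero[OF E linear_space_F lsK] in \<open>auto simp: a_kernel_def'\<close>)
  then have "two_sided_ideal K F ?J"
    unfolding two_sided_ideal_def
    using Gm Em F_mult_closed Gc Ec by (auto simp: mem simp del: Int_iff)
  moreover have "x \<otimes>\<^bsub>F\<^esub> (y \<otimes>\<^bsub>F\<^esub> z) \<ominus>\<^bsub>F\<^esub> x \<otimes>\<^bsub>F\<^esub> (z \<otimes>\<^bsub>F\<^esub> y) \<in> ?J"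
    if "x \<in> carrier F" "y \<in> carrier F" "z \<in> carrier F" for x y z
  proof -
    \<comment> \<open>Both sides are the value at \<open>x\<close> times \<open>aug y\<close> and
      \<open>aug z\<close> in some order, and scalars commute.\<close>
    have "S.lin_ext g (x \<otimes>\<^bsub>F\<^esub> (y \<otimes>\<^bsub>F\<^esub> z)) = S.lin_ext g (x \<otimes>\<^bsub>F\<^esub> (z \<otimes>\<^bsub>F\<^esub> y))"
      "aug (x \<otimes>\<^bsub>F\<^esub> (y \<otimes>\<^bsub>F\<^esub> z)) = aug (x \<otimes>\<^bsub>F\<^esub> (z \<otimes>\<^bsub>F\<^esub> y))"
      using that by (simp_all add: Gm Em F_mult_closed m_comm[OF Ec Ec])
    then show ?thesis
      using that S.minus_eq_zero_iff Gc Ec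
      by (simp add: mem F_mult_closed lin_maps_minus[OF G linear_space_F lsK]
          lin_maps_minus[OF E linear_space_F lsK] del: Int_iff)
  qed
  ultimately have "perm_ideal K X \<subseteq> ?J"
    unfolding perm_ideal_def Let_def by (intro hull_minimal) auto
  then show ?thesis using p mem by blast
qed

lemma linear_space_Perm: "linear_space K (Perm K X)"
  unfolding Perm_def
  by (rule F.linear_space_quot_module) (use perm_ideal_ideal in \<open>simp add: two_sided_ideal_def\<close>)

lemma Perm_functional:
  assumes g: "\<And>w. g w \<in> carrier K" and gm: "\<And>u v. u \<noteq> [] \<Longrightarrow> g (u @ v) = g u"
  shows "\<exists>f\<in>lin_maps K (Perm K X) (self_module K).
    \<forall>p\<in>carrier F. f (perm_ideal K X +>\<^bsub>F\<^esub> p) = S.lin_ext g p"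
proof -
  have gS: "g \<in> S \<rightarrow> carrier (self_module K)" using g by auto
  have G: "S.lin_ext g \<in> lin_maps K F (self_module K)" using S.lin_ext_lin[OF gS] by simp
  show ?thesis
    unfolding Perm_def
    by (rule F.quot_lift_exists[OF _ G linear_space_self_module[OF is_cring]])
      (use perm_ideal_ideal functional_vanishes[of g, OF g gm] in \<open>auto simp: two_sided_ideal_def\<close>)
qed

end

text \<open>\<open>f\<close> sums the coefficients of the words that begin with \<open>x\<close>,
  and \<open>e\<close> is the augmentation; \<open>a\<close> and \<open>b\<close> are the images of
  the two letters, which \<open>f\<close> tells apart while \<open>e\<close> is 1 on both.\<close>

lemma free_perm_functionals:
  assumes K: "cring K" and A: "free_perm_algebra K X A" and "x \<in> X" and "y \<in> X" and "x \<noteq> y"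
  obtains f e a b where "f \<in> lin_maps K A (self_module K)"
    and "\<And>u v. u \<in> carrier A \<Longrightarrow> v \<in> carrier A \<Longrightarrow> f (u \<otimes>\<^bsub>A\<^esub> v) = f u \<otimes>\<^bsub>K\<^esub> e v"
    and "a \<in> carrier A" and "b \<in> carrier A" and "f a = \<one>\<^bsub>K\<^esub>" and "f b = \<zero>\<^bsub>K\<^esub>"
    and "e a = \<one>\<^bsub>K\<^esub>" and "e b = \<one>\<^bsub>K\<^esub>"
proof -
  interpret free_associative K X by (intro free_associative.intro K)
  obtain h where h: "h \<in> lin_maps K (Perm K X) A" and bij: "bij_betw h (carrier (Perm K X)) (carrier A)"
    and hm: "\<And>s t. s \<in> carrier (Perm K X) \<Longrightarrow> t \<in> carrier (Perm K X) \<Longrightarrow>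
      h (s \<otimes>\<^bsub>Perm K X\<^esub> t) = h s \<otimes>\<^bsub>A\<^esub> h t"
    using A by (auto simp: free_perm_algebra_def algebra_isos_def)
  define g where "g w = (if w \<noteq> [] \<and> hd w = x then \<one>\<^bsub>K\<^esub> else \<zero>\<^bsub>K\<^esub>)" for w
  have g: "g w \<in> carrier K" for w by (simp add: g_def)
  have gm: "g (u @ v) = g u" if "u \<noteq> []" for u v using that by (simp add: g_def)
  obtain f where f: "f \<in> lin_maps K (Perm K X) (self_module K)"
    "\<And>p. p \<in> carrier F \<Longrightarrow> f (perm_ideal K X +>\<^bsub>F\<^esub> p) = S.lin_ext g p"
    using Perm_functional[of g, OF g gm] by blast
  obtain e where e: "e \<in> lin_maps K (Perm K X) (self_module K)"
    "\<And>p. p \<in> carrier F \<Longrightarrow> e (perm_ideal K X +>\<^bsub>F\<^esub> p) = aug p"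
    using Perm_functional[of "\<lambda>_. \<one>\<^bsub>K\<^esub>"] by auto
  let ?i = "inv_into (carrier (Perm K X)) h" and ?c = "\<lambda>p. h (perm_ideal K X +>\<^bsub>F\<^esub> p)"
  have carr: "carrier (Perm K X) = (\<lambda>p. perm_ideal K X +>\<^bsub>F\<^esub> p) ` carrier F"
    unfolding Perm_def by (rule F.carrier_quot_module)
  have ic: "?i (?c p) = perm_ideal K X +>\<^bsub>F\<^esub> p" if "p \<in> carrier F" for p
    using bij that by (intro bij_betw_inv_into_left) (auto simp: carr)
  have A_carr: "carrier A = ?c ` carrier F" using bij by (auto simp: bij_betw_def carr image_image)
  have cm: "?c p \<otimes>\<^bsub>A\<^esub> ?c q = ?c (p \<otimes>\<^bsub>F\<^esub> q)" if "p \<in> carrier F" "q \<in> carrier F" for p q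
    using hm[of "perm_ideal K X +>\<^bsub>F\<^esub> p" "perm_ideal K X +>\<^bsub>F\<^esub> q"] that
      quot_module_mult[OF linear_space_F F_mult_bilinear perm_ideal_ideal that]
    by (simp add: carr) (simp add: Perm_def)
  have s: "single K [z] \<in> carrier F" if "z \<in> X" for z
    using that single_closed[OF is_cring, of "[z]" S] by (simp add: F_simps)
  have gs: "S.lin_ext g (single K [z]) = g [z]" "aug (single K [z]) = \<one>\<^bsub>K\<^esub>" if "z \<in> X" for z
    using that g by (auto intro!: S.lin_ext_single[of _ S])
  show ?thesis
  proof (rule that[of "\<lambda>a. f (?i a)" "\<lambda>a. e (?i a)" "?c (single K [x])" "?c (single K [y])"])
    show "(\<lambda>a. f (?i a)) \<in> lin_maps K A (self_module K)"
      by (rule lin_maps_comp[OF lin_maps_inv[OF h linear_space_Perm bij] f(1)])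
    show "f (?i (u \<otimes>\<^bsub>A\<^esub> v)) = f (?i u) \<otimes>\<^bsub>K\<^esub> e (?i v)" if "u \<in> carrier A" "v \<in> carrier A" for u v
      using that functional_mult[of g, OF g gm]
      by (auto simp: A_carr cm ic F_mult_closed f(2) e(2))
  qed (use assms(3-5) s gs in \<open>auto simp: A_carr ic f(2) e(2) g_def\<close>)
qed

section \<open>The cochain map \<open>\<Psi>\<close>\<close>

lemma bilinear_op_mult_update1 [simp]:
  "bilinear_op K (U\<lparr>mult := m\<rparr>) V W b = bilinear_op K U V W b"
  by (simp add: bilinear_op_def)

lemma bilinear_op_mult_update2 [simp]:
  "bilinear_op K U (V\<lparr>mult := m\<rparr>) W b = bilinear_op K U V W b"
  by (simp add: bilinear_op_def)

lemma bilinear_op_mult_update3 [simp]: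
  "bilinear_op K U V (W\<lparr>mult := m\<rparr>) b = bilinear_op K U V W b"
  by (simp add: bilinear_op_def)

lemma lin_maps_if:
  "(P \<Longrightarrow> f \<in> lin_maps K U V) \<Longrightarrow> (\<not> P \<Longrightarrow> g \<in> lin_maps K U V) \<Longrightarrow>
    (\<lambda>x. if P then f x else g x) \<in> lin_maps K U V"
  by (cases P) auto

lemma multilinear_if:
  "(P \<Longrightarrow> multilinear K U V n F) \<Longrightarrow> (\<not> P \<Longrightarrow> multilinear K U V n G) \<Longrightarrow>
    multilinear K U V n (\<lambda>xs. if P then F xs else G xs)"
  by (cases P) auto

context linear_space
begin

lemma finsum_swap:
  assumes "finite I" and "finite J" and "\<And>i j. i \<in> I \<Longrightarrow> j \<in> J \<Longrightarrow> g i j \<in> carrier M"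
  shows "(\<Oplus>i\<in>I. \<Oplus>j\<in>J. g i j) = (\<Oplus>j\<in>J. \<Oplus>i\<in>I. g i j)"
  using assms(1,3)
proof (induction I)
  case empty
  then show ?case by simp
next
  case (insert i I)
  have c: "(\<lambda>j. g k j) \<in> J \<rightarrow> carrier M" if "k \<in> insert i I" for k using insert.prems that by auto
  have c': "(\<lambda>k. g k j) \<in> I \<rightarrow> carrier M" if "j \<in> J" for j using insert.prems that by auto
  have "(\<Oplus>k\<in>insert i I. \<Oplus>j\<in>J. g k j) = (\<Oplus>j\<in>J. g i j) \<oplus> (\<Oplus>k\<in>I. \<Oplus>j\<in>J. g k j)"
    using insert.hyps c by (intro M.finsum_insert) (auto intro!: M.finsum_closed)
  also have "\<dots> = (\<Oplus>j\<in>J. g i j) \<oplus> (\<Oplus>j\<in>J. \<Oplus>k\<in>I. g k j)"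
    using insert.prems by (subst insert.IH) auto
  also have "\<dots> = (\<Oplus>j\<in>J. g i j \<oplus> (\<Oplus>k\<in>I. g k j))"
    using c c' by (intro M.finsum_addf[symmetric]) (auto intro!: M.finsum_closed)
  also have "\<dots> = (\<Oplus>j\<in>J. \<Oplus>k\<in>insert i I. g k j)"
  proof (rule M.finsum_cong')
    show "g i j \<oplus> (\<Oplus>k\<in>I. g k j) = (\<Oplus>k\<in>insert i I. g k j)" if "j \<in> J" for j
      using insert.hyps insert.prems c' that by (intro M.finsum_insert[symmetric]) auto
  qed (use insert.prems in \<open>auto intro!: M.finsum_closed\<close>)
  finally show ?case .
qed

lemma finsum_upto_Suc:
  assumes "\<And>s. f s \<in> carrier M"
  shows "(\<Oplus>s\<in>{1..Suc n}. f s) = f (Suc n) \<oplus> (\<Oplus>s\<in>{1..n}. f s)"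
proof -
  have "{1..Suc n} = insert (Suc n) {1..n}" by auto
  then show ?thesis using assms by (simp add: Pi_def del: One_nat_def)
qed

text \<open>A contraction shortens a list from \<open>n + 1\<close> to \<open>n\<close> entries, and
  the merged position stands for two leading positions of the longer list. This is the resulting
  reindexing, with \<open>i\<close> the place of the contraction.\<close>

lemma finsum_split_at:
  assumes G: "\<And>s. G s \<in> carrier M" and i: "1 \<le> i" and "i \<le> n"
  shows "(\<Oplus>s\<in>{1..n}. if s < i then G s else if s = i then G i \<oplus> G (Suc i) else G (Suc s)) =
    (\<Oplus>s\<in>{1..Suc n}. G s)"
  using assms(3)
proof (induction n rule: dec_induct)
  let ?E = "\<lambda>s. if s < i then G s else if s = i then G i \<oplus> G (Suc i) else G (Suc s)"
  have E: "?E s \<in> carrier M" for s using G by simp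
  {
    case base
    obtain k where k: "i = Suc k" using i by (cases i) auto
    have "(\<Oplus>s\<in>{1..k}. ?E s) = (\<Oplus>s\<in>{1..k}. G s)"
      using G k by (intro M.finsum_cong') auto
    moreover have "(\<Oplus>s\<in>{1..Suc k}. ?E s) = ?E (Suc k) \<oplus> (\<Oplus>s\<in>{1..k}. ?E s)"
      by (rule finsum_upto_Suc) (rule E)
    moreover have "(\<Oplus>s\<in>{1..Suc m}. G s) = G (Suc m) \<oplus> (\<Oplus>s\<in>{1..m}. G s)" for m
      by (rule finsum_upto_Suc) (rule G)
    ultimately show ?case
      using G unfolding k by (simp add: M.a_ac del: One_nat_def)
  next
    case (step n)
    have "(\<Oplus>s\<in>{1..Suc n}. ?E s) = ?E (Suc n) \<oplus> (\<Oplus>s\<in>{1..n}. ?E s)"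
      by (rule finsum_upto_Suc) (rule E)
    moreover have "(\<Oplus>s\<in>{1..Suc (Suc n)}. G s) = G (Suc (Suc n)) \<oplus> (\<Oplus>s\<in>{1..Suc n}. G s)"
      by (rule finsum_upto_Suc) (rule G)
    ultimately show ?case using step by simp
  }
qed

end

section \<open>The algebra A tensor B, its bimodule, and the two cochain spaces\<close>

locale perm_dendriform =
  A: perm_alg K A + B: linear_space K B + N: linear_space K N + D: preassoc_bimodule K B N
  for K :: "'k ring" and A :: "('k, 'a) module" and B :: "('k, 'b) preassoc"
    and N :: "('k, 'b, 'n) preassoc_rep"
begin

sublocale AB: tensor_product K A B
  by (intro tensor_product.intro A.linear_space_axioms B.linear_space_axioms)
sublocale AN: tensor_product K A N
  by (intro tensor_product.intro A.linear_space_axioms N.linear_space_axioms)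

abbreviation R where "R \<equiv> tensor_algebra K A B"
abbreviation M where "M \<equiv> tensor K A N"

lemmas lsA = A.linear_space_axioms and lsB = B.linear_space_axioms and lsN = N.linear_space_axioms

lemmas spec_R = tensor_op_spec[OF lsA A.mult_bil lsB lsB lsB D.B.prec_bilinear D.B.succ_bilinear]
lemmas spec_l = tensor_op_spec[OF lsA A.mult_bil lsB lsN lsN D.lprec_bilinear D.lsucc_bilinear]
lemmas spec_r = tensor_op_spec[OF lsA A.mult_bil lsN lsB lsN D.rprec_bilinear D.rsucc_bilinear]

lemma R_simps: "carrier R = carrier AB.T" "mult R = tensor_op K A B B B (prec B) (succ B)"
  "tuples R n = tuples AB.T n"
  by (simp_all add: tensor_algebra_def)

lemma multilinear_R [simp]: "multilinear K R V n F = multilinear K AB.T V n F"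
  by (simp add: tensor_algebra_def multilinear_def)

text \<open>All four laws are instances of \<open>tensor_op_assoc\<close>. In the bimodule laws the
  position of \<open>N\<close> among the three arguments selects the dendriform identities numbered
  1, 2 or 3.\<close>

sublocale H: hochschild K R M "tensor_lact K A B N" "tensor_ract K A B N"
proof (intro hochschild.intro hochschild_axioms.intro)
  note assoc = tensor_op_assoc[OF A.perm]
  show "linear_space K R" using AB.linear_space_tensor by (simp add: tensor_algebra_def)
  show "linear_space K M" by (rule AN.linear_space_tensor)
  show "bilinear_op K R R R (mult R)" using spec_R(1) by (simp add: tensor_algebra_def)
  show "bilinear_op K R M M (tensor_lact K A B N)"
    using spec_l(1) by (simp add: tensor_algebra_def tensor_lact_def)
  show "bilinear_op K M R M (tensor_ract K A B N)"
    using spec_r(1) by (simp add: tensor_algebra_def tensor_ract_def)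
  show "(x \<otimes>\<^bsub>R\<^esub> y) \<otimes>\<^bsub>R\<^esub> z = x \<otimes>\<^bsub>R\<^esub> (y \<otimes>\<^bsub>R\<^esub> z)"
    if "x \<in> carrier R" "y \<in> carrier R" "z \<in> carrier R" for x y z
    using that unfolding R_simps
    by (intro assoc[OF lsB lsB lsB lsB lsB lsB] D.B.prec_bilinear D.B.succ_bilinear
        D.B.prec_prec D.B.succ_prec D.B.succ_succ)
  show "tensor_lact K A B N (x \<otimes>\<^bsub>R\<^esub> y) n = tensor_lact K A B N x (tensor_lact K A B N y n)"
    if "x \<in> carrier R" "y \<in> carrier R" "n \<in> carrier M" for x y n
    using that unfolding R_simps tensor_lact_def
    by (intro assoc[OF lsB lsB lsN lsB lsN lsN] D.B.prec_bilinear D.B.succ_bilinear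
        D.lprec_bilinear D.lsucc_bilinear D.prec_prec_3 D.succ_prec_3 D.succ_succ_3)
  show "tensor_ract K A B N (tensor_lact K A B N x n) y = tensor_lact K A B N x (tensor_ract K A B N n y)"
    if "x \<in> carrier R" "y \<in> carrier R" "n \<in> carrier M" for x y n
    using that unfolding R_simps tensor_lact_def tensor_ract_def
    by (intro assoc[OF lsB lsN lsB lsN lsN lsN] D.rprec_bilinear D.rsucc_bilinear
        D.lprec_bilinear D.lsucc_bilinear D.prec_prec_2 D.succ_prec_2 D.succ_succ_2)
  show "tensor_ract K A B N (tensor_ract K A B N n x) y = tensor_ract K A B N n (x \<otimes>\<^bsub>R\<^esub> y)"
    if "x \<in> carrier R" "y \<in> carrier R" "n \<in> carrier M" for x y n
    using that unfolding R_simps tensor_ract_def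
    by (intro assoc[OF lsN lsB lsB lsN lsB lsN] D.B.prec_bilinear D.B.succ_bilinear
        D.rprec_bilinear D.rsucc_bilinear D.prec_prec_1 D.succ_prec_1 D.succ_succ_1)
qed

lemma complx_eq: "tensor_hoch_complex K A B N = H.complx"
  by (simp add: tensor_hoch_complex_def)

text \<open>Hochschild cochains vanish off the tuples, so their values on pure tensors determine
  them as functions; equations between cochains become computations with \<open>as\<close> and
  \<open>bs\<close>.\<close>

lemma H_cochain_ext:
  assumes "F \<in> H.cochain n" and "G \<in> H.cochain n"
    and "\<And>as bs. as \<in> tuples A n \<Longrightarrow> bs \<in> tuples B n \<Longrightarrow>
      F (map2 AB.pure as bs) = G (map2 AB.pure as bs)"
  shows "F = G"
proof
  fix xs
  show "F xs = G xs"
  proof (cases "xs \<in> tuples R n")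
    case True
    then show ?thesis
      using assms(1,2)
      by (intro AB.multilinear_tensor_ext[OF AN.linear_space_tensor, of n F G xs] assms(3))
        (simp_all add: R_simps)
  qed (use assms in auto)
qed

abbreviation dcochain :: "nat \<Rightarrow> (nat \<times> 'b list \<Rightarrow> 'n) set"
  where "dcochain n \<equiv> {f. (\<forall>r\<in>{1..n}. multilinear K B N n (\<lambda>bs. f (r, bs))) \<and>
    (\<forall>r bs. (r, bs) \<notin> {1..n} \<times> tuples B n \<longrightarrow> f (r, bs) = \<zero>\<^bsub>N\<^esub>)}"

lemma dcochain_closed: "f \<in> dcochain n \<Longrightarrow> f z \<in> carrier N"
proof (cases z)
  case (Pair r bs)
  assume "f \<in> dcochain n"
  then show ?thesis
    by (cases "(r, bs) \<in> {1..n} \<times> tuples B n") (use multilinear_closed[of K B N n "\<lambda>bs. f (r, bs)" bs] in \<open>auto simp: Pair\<close>)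
qed

lemma dcochain_multilinear: "f \<in> dcochain n \<Longrightarrow> r \<in> {1..n} \<Longrightarrow> multilinear K B N n (\<lambda>bs. f (r, bs))"
  by blast

lemma linear_space_dcochain: "linear_space K (pointwise N (dcochain n))"
proof (rule N.linear_space_pointwise)
  show "(\<lambda>s. f s \<oplus>\<^bsub>N\<^esub> g s) \<in> dcochain n" if "f \<in> dcochain n" "g \<in> dcochain n" for f g
    using that by (auto intro: N.multilinear_plus[OF lsB])
  show "(\<lambda>s. c \<odot>\<^bsub>N\<^esub> f s) \<in> dcochain n" if "c \<in> carrier K" "f \<in> dcochain n" for c f
    using that by (auto intro: N.multilinear_scale)
qed (use dcochain_closed N.multilinear_zero in auto)

abbreviation C where "C \<equiv> dend_complex K B N"

lemma obj_C: "obj C n = pointwise N (if n \<le> 0 then {\<lambda>_. \<zero>\<^bsub>N\<^esub>} else dcochain (nat n))"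
  by (simp add: dend_complex_def dend_space_def)

lemma linear_space_obj_C: "linear_space K (obj C n)"
proof (cases "n \<le> 0")
  case True
  have "linear_space K (pointwise N {\<lambda>_. \<zero>\<^bsub>N\<^esub>})"
    by (rule N.linear_space_pointwise) auto
  then show ?thesis using True by (simp add: obj_C)
qed (simp only: obj_C if_False linear_space_dcochain)

text \<open>
  A uniform shape for the three cases of \<^const>\<open>dend_cobd\<close>: the summands come from the left action,
  from the contractions at \<open>i = 1, \<dots>, n\<close>, and from the right action.
\<close>

definition left_part :: "nat \<Rightarrow> (nat \<times> 'b list \<Rightarrow> 'n) \<Rightarrow> nat \<Rightarrow> 'b list \<Rightarrow> 'n"
  where "left_part n f r bs =
    (if r = 1 then (\<Oplus>\<^bsub>N\<^esub>i\<in>{1..n}. hd bs \<prec>l\<^bsub>N\<^esub> f (i, tl bs)) else hd bs \<succ>l\<^bsub>N\<^esub> f (r - 1, tl bs))"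

text \<open>Contracting at \<open>i\<close> sends the leading position \<open>r\<close> of the
  longer list to \<open>r\<close> if \<open>r \<le> i\<close> and to \<open>r - 1\<close> otherwise.
  The operation is \<open>prec\<close> if the leader is the left factor of the merged pair,
  \<open>succ\<close> if it is the right one, and \<open>star\<close> away from it.\<close>

definition inner_part :: "(nat \<times> 'b list \<Rightarrow> 'n) \<Rightarrow> nat \<Rightarrow> nat \<Rightarrow> 'b list \<Rightarrow> 'n"
  where "inner_part f r i bs =
    (if r < i then f (r, contract (star B) i bs)
     else if r = i then f (r, contract (prec B) i bs)
     else if r = Suc i then f (r - 1, contract (succ B) i bs)
     else f (r - 1, contract (star B) i bs))"

definition right_part :: "nat \<Rightarrow> (nat \<times> 'b list \<Rightarrow> 'n) \<Rightarrow> nat \<Rightarrow> 'b list \<Rightarrow> 'n"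
  where "right_part n f r bs =
    (if r \<le> n then f (r, butlast bs) \<prec>r\<^bsub>N\<^esub> last bs
     else (\<Oplus>\<^bsub>N\<^esub>i\<in>{1..n}. f (i, butlast bs) \<succ>r\<^bsub>N\<^esub> last bs))"

lemma part_closed:
  assumes f: "f \<in> dcochain n" and bs: "bs \<in> tuples B (Suc n)"
  shows "left_part n f r bs \<in> carrier N" and "inner_part f r i bs \<in> carrier N"
    and "right_part n f r bs \<in> carrier N"
  using dcochain_closed[OF f] tuples_Suc_sel[OF bs] bilinear_opD(3)[OF D.lprec_bilinear]
    bilinear_opD(3)[OF D.lsucc_bilinear] bilinear_opD(3)[OF D.rprec_bilinear]
    bilinear_opD(3)[OF D.rsucc_bilinear]
  by (auto simp: left_part_def inner_part_def right_part_def intro!: N.M.finsum_closed)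

text \<open>In each case of \<open>dend_cobd\<close> the positions \<open>r - 1\<close> and
  \<open>r\<close>, as far as they lie in \<open>{1..n}\<close>, are split off from the sum; at the
  remaining indices \<open>inner_part\<close> contracts by \<open>star\<close>.\<close>

lemma dend_cobd_eq:
  assumes n: "1 \<le> n" and f: "f \<in> dcochain n" and r: "r \<in> {1..Suc n}" and bs: "bs \<in> tuples B (Suc n)"
  shows "dend_cobd B N n f (r, bs) =
    left_part n f r bs \<oplus>\<^bsub>N\<^esub> (\<Oplus>\<^bsub>N\<^esub>i\<in>{1..n}. sgn_smult N i (inner_part f r i bs)) \<oplus>\<^bsub>N\<^esub>
    sgn_smult N (Suc n) (right_part n f r bs)"
proof -
  have sc: "sgn_smult N i (f z) \<in> carrier N" for i z using N.sgn_closed[OF dcochain_closed[OF f]] .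
  have ic: "sgn_smult N i (inner_part f r i bs) \<in> carrier N" for i
    using N.sgn_closed[OF part_closed(2)[OF f bs]] .
  have Lc: "left_part n f r bs \<in> carrier N" and Rc: "sgn_smult N (Suc n) (right_part n f r bs) \<in> carrier N"
    using part_closed[OF f bs] N.sgn_closed by auto
  have cong: "(\<Oplus>\<^bsub>N\<^esub>i\<in>I. sgn_smult N i (inner_part f r i bs)) = (\<Oplus>\<^bsub>N\<^esub>i\<in>I. sgn_smult N i (f (g i)))"
    if "\<And>i. i \<in> I \<Longrightarrow> inner_part f r i bs = f (g i)" for I g
    using that sc by (intro N.M.finsum_cong') auto
  have sumc: "(\<Oplus>\<^bsub>N\<^esub>i\<in>I. sgn_smult N i (f (g i))) \<in> carrier N" for I g
    using sc by (intro N.M.finsum_closed) auto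
  have ins: "(\<Oplus>\<^bsub>N\<^esub>i\<in>insert k I. sgn_smult N i (inner_part f r i bs)) =
      sgn_smult N k (inner_part f r k bs) \<oplus>\<^bsub>N\<^esub> (\<Oplus>\<^bsub>N\<^esub>i\<in>I. sgn_smult N i (inner_part f r i bs))"
    if "k \<notin> I" "finite I" for k and I :: "nat set"
    using that ic by (intro N.M.finsum_insert) auto
  have sum: "(\<Oplus>\<^bsub>N\<^esub>i\<in>I. sgn_smult N i (inner_part f r i bs)) \<in> carrier N" for I
    using ic by (intro N.M.finsum_closed) auto
  have fc: "f z \<in> carrier N" for z by (rule dcochain_closed[OF f])
  consider "r = 1" | "2 \<le> r" "r \<le> n" | "r = Suc n" "2 \<le> r" using r n by fastforce
  then show ?thesis
  proof cases
    case 1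
    have e: "{1..n} = insert 1 {2..n}" using n by auto
    have "(\<Oplus>\<^bsub>N\<^esub>i\<in>{1..n}. sgn_smult N i (inner_part f r i bs)) =
      \<ominus>\<^bsub>N\<^esub> f (1, contract (prec B) 1 bs) \<oplus>\<^bsub>N\<^esub>
      (\<Oplus>\<^bsub>N\<^esub>i\<in>{2..n}. sgn_smult N i (f (1, contract (star B) i bs)))"
      unfolding e using 1 cong[of "{2..n}" "\<lambda>i. (1, contract (star B) i bs)"]
      by (subst ins) (auto simp: inner_part_def sgn_smult_def)
    moreover have "left_part n f r bs \<ominus>\<^bsub>N\<^esub> x \<oplus>\<^bsub>N\<^esub> y = left_part n f r bs \<oplus>\<^bsub>N\<^esub> (\<ominus>\<^bsub>N\<^esub> x \<oplus>\<^bsub>N\<^esub> y)"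
      if "x \<in> carrier N" "y \<in> carrier N" for x y
      using that Lc by (simp add: a_minus_def N.M.a_assoc)
    ultimately show ?thesis
      using 1 bs n fc sumc by (simp add: dend_cobd_def left_part_def right_part_def)
  next
    case 2
    have e: "{1..n} = {1..r - 2} \<union> insert (r - 1) (insert r {r + 1..n})" using 2 by auto
    have "(\<Oplus>\<^bsub>N\<^esub>i\<in>{1..n}. sgn_smult N i (inner_part f r i bs)) =
      (\<Oplus>\<^bsub>N\<^esub>i\<in>{1..r - 2}. sgn_smult N i (inner_part f r i bs)) \<oplus>\<^bsub>N\<^esub>
      (\<Oplus>\<^bsub>N\<^esub>i\<in>insert (r - 1) (insert r {r + 1..n}). sgn_smult N i (inner_part f r i bs))"
      unfolding e using ic 2 by (intro N.M.finsum_Un_disjoint) auto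
    also have "(\<Oplus>\<^bsub>N\<^esub>i\<in>insert (r - 1) (insert r {r + 1..n}). sgn_smult N i (inner_part f r i bs)) =
      sgn_smult N (r - 1) (inner_part f r (r - 1) bs) \<oplus>\<^bsub>N\<^esub> (sgn_smult N r (inner_part f r r bs) \<oplus>\<^bsub>N\<^esub>
      (\<Oplus>\<^bsub>N\<^esub>i\<in>{r + 1..n}. sgn_smult N i (inner_part f r i bs)))"
    proof -
      have a: "r - 1 \<notin> insert r {r + 1..n}" "r \<notin> {r + 1..n}" using 2 by auto
      show ?thesis by (subst ins[OF a(1)], simp, subst ins[OF a(2)], simp, rule refl)
    qed
    also have "(\<Oplus>\<^bsub>N\<^esub>i\<in>{1..r - 2}. sgn_smult N i (inner_part f r i bs)) =
        (\<Oplus>\<^bsub>N\<^esub>i\<in>{1..r - 2}. sgn_smult N i (f (r - 1, contract (star B) i bs)))"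
      by (rule cong) (auto simp: inner_part_def)
    also have "(\<Oplus>\<^bsub>N\<^esub>i\<in>{r + 1..n}. sgn_smult N i (inner_part f r i bs)) =
        (\<Oplus>\<^bsub>N\<^esub>i\<in>{r + 1..n}. sgn_smult N i (f (r, contract (star B) i bs)))"
      by (rule cong) (auto simp: inner_part_def)
    also have "inner_part f r (r - 1) bs = f (r - 1, contract (succ B) (r - 1) bs)"
      using 2 by (auto simp: inner_part_def)
    also have "inner_part f r r bs = f (r, contract (prec B) r bs)"
      by (simp add: inner_part_def)
    finally show ?thesis
      using 2 bs sc sumc Lc Rc
      by (simp add: dend_cobd_def left_part_def right_part_def N.M.a_assoc)
  next
    case 3
    have e: "{1..n} = insert n {1..n - 1}" using n by auto
    have "(\<Oplus>\<^bsub>N\<^esub>i\<in>{1..n}. sgn_smult N i (inner_part f r i bs)) =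
      sgn_smult N n (f (n, contract (succ B) n bs)) \<oplus>\<^bsub>N\<^esub>
      (\<Oplus>\<^bsub>N\<^esub>i\<in>{1..n - 1}. sgn_smult N i (f (n, contract (star B) i bs)))"
    proof -
      have "(\<Oplus>\<^bsub>N\<^esub>i\<in>{1..n - 1}. sgn_smult N i (inner_part f r i bs)) =
          (\<Oplus>\<^bsub>N\<^esub>i\<in>{1..n - 1}. sgn_smult N i (f (n, contract (star B) i bs)))"
        by (rule cong) (use 3 in \<open>auto simp: inner_part_def\<close>)
      moreover have "inner_part f r n bs = f (n, contract (succ B) n bs)"
        using 3 by (simp add: inner_part_def)
      moreover have "n \<notin> {1..n - 1}" using n by auto
      ultimately show ?thesis unfolding e by (subst ins) (simp_all del: One_nat_def)
    qed
    then show ?thesis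
      using 3 bs n sc sumc Lc Rc
      by (simp add: dend_cobd_def left_part_def right_part_def N.M.a_ac)
  qed
qed

lemma star_bilinear: "bilinear_op K B B B (star B)"
  unfolding star_def[abs_def]
  by (rule bilinear_op_plus[OF lsB lsB lsB D.B.prec_bilinear D.B.succ_bilinear])

lemma dend_cobd_closed:
  assumes n: "1 \<le> n" and f: "f \<in> dcochain n"
  shows "dend_cobd B N n f \<in> dcochain (Suc n)"
proof -
  note fm = dcochain_multilinear[OF f]
  have "multilinear K B N (Suc n) (\<lambda>bs. dend_cobd B N n f (r, bs))" if r: "r \<in> {1..Suc n}" for r
  proof -
    have L: "multilinear K B N (Suc n) (left_part n f r)"
      unfolding left_part_def[abs_def]
      by (intro multilinear_if N.multilinear_finsum[OF lsB]
          multilinear_left_action[OF lsB D.lprec_bilinear fm]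
          multilinear_left_action[OF lsB D.lsucc_bilinear fm]) (use r in auto)
    have Rr: "multilinear K B N (Suc n) (right_part n f r)"
      unfolding right_part_def[abs_def]
      by (intro multilinear_if N.multilinear_finsum[OF lsB]
          multilinear_right_action[OF lsB D.rprec_bilinear fm]
          multilinear_right_action[OF lsB D.rsucc_bilinear fm]) (use r in auto)
    have I: "multilinear K B N (Suc n) (inner_part f r i)" if i: "i \<in> {1..n}" for i
    proof -
      obtain k where k: "i = Suc k" "k < n" using i by (cases i) auto
      have c: "multilinear K B N (Suc n) (\<lambda>bs. f (s, contract m i bs))"
        if "s \<in> {1..n}" "bilinear_op K B B B m" for s m
        using multilinear_contract[OF lsB that(2) fm[OF that(1)] k(2)] by (simp add: k)
      show ?thesis
        unfolding inner_part_def[abs_def]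
        by (intro multilinear_if c star_bilinear D.B.prec_bilinear D.B.succ_bilinear)
          (use i r in auto)
    qed
    have "multilinear K B N (Suc n) (\<lambda>bs. left_part n f r bs \<oplus>\<^bsub>N\<^esub>
        (\<Oplus>\<^bsub>N\<^esub>i\<in>{1..n}. sgn_smult N i (inner_part f r i bs)) \<oplus>\<^bsub>N\<^esub>
        sgn_smult N (Suc n) (right_part n f r bs))"
      by (intro N.multilinear_plus N.multilinear_finsum N.multilinear_sgn lsB L I Rr)
    then show ?thesis
      by (rule multilinear_cong[OF _ lsB]) (rule dend_cobd_eq[OF n f r])
  qed
  then show ?thesis by (auto simp: dend_cobd_def)
qed

lemma dend_cobd_lin:
  assumes n: "1 \<le> n"
  shows "dend_cobd B N n \<in> lin_maps K (pointwise N (dcochain n)) (pointwise N (dcochain (Suc n)))"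
proof (rule N.lin_maps_pointwiseI)
  show "dend_cobd B N n f \<in> dcochain (Suc n)" if "f \<in> carrier (pointwise N (dcochain n))" for f
    using dend_cobd_closed[OF n] that by simp
  let ?U = "pointwise N (dcochain n)"
  show "(\<lambda>f. dend_cobd B N n f z) \<in> lin_maps K ?U N" for z
  proof (cases z)
    case (Pair r bs)
    show ?thesis
    proof (cases "(r, bs) \<in> {1..Suc n} \<times> tuples B (Suc n)")
      case True
      then have r: "r \<in> {1..Suc n}" and bs: "bs \<in> tuples B (Suc n)" by auto
      have e: "(\<lambda>f. f y) \<in> lin_maps K ?U N" for y
        by (rule N.eval_lin_map) (rule dcochain_closed)
      note ls = linear_space_dcochain
      note l = lin_maps_comp[OF e bilinear_opD(1)[OF D.lprec_bilinear tuples_Suc_sel(2)[OF bs]]]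
        lin_maps_comp[OF e bilinear_opD(1)[OF D.lsucc_bilinear tuples_Suc_sel(2)[OF bs]]]
      note r' = lin_maps_comp[OF e bilinear_opD(2)[OF D.rprec_bilinear tuples_Suc_sel(3)[OF bs]]]
        lin_maps_comp[OF e bilinear_opD(2)[OF D.rsucc_bilinear tuples_Suc_sel(3)[OF bs]]]
      have L: "(\<lambda>f. left_part n f r bs) \<in> lin_maps K ?U N"
        unfolding left_part_def by (intro lin_maps_if l N.lin_maps_finsum_pointwise[OF ls])
      have Rr: "(\<lambda>f. right_part n f r bs) \<in> lin_maps K ?U N"
        unfolding right_part_def by (intro lin_maps_if r' N.lin_maps_finsum_pointwise[OF ls])
      have I: "(\<lambda>f. inner_part f r i bs) \<in> lin_maps K ?U N" for i
        unfolding inner_part_def by (intro lin_maps_if e)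
      have "(\<lambda>f. left_part n f r bs \<oplus>\<^bsub>N\<^esub>
        (\<Oplus>\<^bsub>N\<^esub>i\<in>{1..n}. sgn_smult N i (inner_part f r i bs)) \<oplus>\<^bsub>N\<^esub>
        sgn_smult N (Suc n) (right_part n f r bs)) \<in> lin_maps K ?U N"
        by (intro N.lin_maps_plus N.lin_maps_finsum_pointwise lin_maps_comp[OF _ N.sgn_smult_lin_map] ls L I Rr)
      then show ?thesis
        unfolding Pair by (rule lin_maps_cong[OF _ ls]) (simp add: dend_cobd_eq[OF n _ r bs] del: One_nat_def)
    next
      case False
      then show ?thesis using N.lin_maps_const_zero by (auto simp: dend_cobd_def Pair)
    qed
  qed
qed

text \<open>The values prescribed for \<open>Psi\<close> on pure tensors, before any lifting to the
  tensor product.\<close>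

definition psi_val :: "nat \<Rightarrow> (nat \<times> 'b list \<Rightarrow> 'n) \<Rightarrow> 'a list \<Rightarrow> 'b list \<Rightarrow> ('a \<times> 'n \<Rightarrow> 'k) set"
  where "psi_val n f as bs = (\<Oplus>\<^bsub>M\<^esub>r\<in>{1..n}. AN.pure (A.word r as) (f (r, bs)))"

lemma psi_val_bimultilinear:
  assumes f: "f \<in> dcochain n"
  shows "AB.bimultilinear M n (psi_val n f)"
  unfolding AB.bimultilinear_def psi_val_def[abs_def]
proof (intro conjI ballI)
  fix as assume as: "as \<in> tuples A n"
  show "multilinear K B M n (\<lambda>bs. \<Oplus>\<^bsub>M\<^esub>r\<in>{1..n}. AN.pure (A.word r as) (f (r, bs)))"
    by (intro AN.T.multilinear_finsum[OF lsB] multilinear_comp[OF dcochain_multilinear[OF f]]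
        bilinear_opD(1)[OF AN.pure_bilinear] A.word_closed[OF as])
next
  fix bs assume "bs \<in> tuples B n"
  show "multilinear K A M n (\<lambda>as. \<Oplus>\<^bsub>M\<^esub>r\<in>{1..n}. AN.pure (A.word r as) (f (r, bs)))"
    by (intro AN.T.multilinear_finsum[OF lsA] multilinear_comp[OF A.multilinear_word, where h = "\<lambda>a. AN.pure a (f (_, bs))"]
        bilinear_opD(2)[OF AN.pure_bilinear] dcochain_closed[OF f])
qed

abbreviation \<Psi> where "\<Psi> \<equiv> Psi K A B N"

text \<open>Justifies the definite description in \<open>Psi\<close>: existence is the multilinear
  lift of \<open>psi_val\<close>, uniqueness is \<open>H_cochain_ext\<close>.\<close>

lemma Psi_spec:
  assumes n: "1 \<le> n" and f: "f \<in> dcochain n"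
  shows "\<Psi> (int n) f \<in> H.cochain n"
    and "as \<in> tuples A n \<Longrightarrow> bs \<in> tuples B n \<Longrightarrow> \<Psi> (int n) f (map2 AB.pure as bs) = psi_val n f as bs"
proof -
  let ?P = "\<lambda>F. F \<in> H.cochain n \<and> (\<forall>as\<in>tuples A n. \<forall>bs\<in>tuples B n. F (map2 AB.pure as bs) = psi_val n f as bs)"
  have eq: "\<Psi> (int n) f = (THE F. ?P F)"
    using n by (simp add: Psi_def complx_eq H.obj_complx psi_val_def A.word_def)
  obtain G where G: "multilinear K AB.T M n G"
    "\<And>as bs. as \<in> tuples A n \<Longrightarrow> bs \<in> tuples B n \<Longrightarrow> G (map2 AB.pure as bs) = psi_val n f as bs"
    using AB.multilinear_tensor_lift[OF AN.linear_space_tensor psi_val_bimultilinear[OF f]] by blast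
  \<comment> \<open>The lift is arbitrary off the tuples and has to be cut off there to become a
    cochain.\<close>
  define F where "F xs = (if xs \<in> tuples R n then G xs else \<zero>\<^bsub>M\<^esub>)" for xs
  have "multilinear K AB.T M n F"
    by (rule multilinear_cong[OF G(1) AB.linear_space_tensor]) (simp add: F_def R_simps)
  then have F: "?P F"
    using G(2) AB.map2_pure_tuples by (auto simp: F_def R_simps)
  have "?P (THE F. ?P F)"
  proof (rule theI[of ?P F])
    show "?P F" by (rule F)
    show "F' = F" if "?P F'" for F'
      by (rule H_cochain_ext[of _ n]) (use F that in blast)+
  qed
  then show "\<Psi> (int n) f \<in> H.cochain n"
    "as \<in> tuples A n \<Longrightarrow> bs \<in> tuples B n \<Longrightarrow> \<Psi> (int n) f (map2 AB.pure as bs) = psi_val n f as bs"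
    unfolding eq by blast+
qed

lemma psi_val_lin: "(\<lambda>f. psi_val n f as bs) \<in> lin_maps K (pointwise N (dcochain n)) M"
  if as: "as \<in> tuples A n"
  unfolding psi_val_def
proof (rule AN.T.lin_maps_finsum_pointwise[OF linear_space_dcochain])
  fix r assume r: "r \<in> {1..n}"
  have "(\<lambda>f. f (r, bs)) \<in> lin_maps K (pointwise N (dcochain n)) N"
    by (rule N.eval_lin_map) (rule dcochain_closed)
  then show "(\<lambda>f. AN.pure (A.word r as) (f (r, bs))) \<in> lin_maps K (pointwise N (dcochain n)) M"
    by (rule lin_maps_comp[OF _ bilinear_opD(1)[OF AN.pure_bilinear A.word_closed[OF as r]]])
qed

lemma Psi_lin_nat:
  assumes n: "1 \<le> n"
  shows "\<Psi> (int n) \<in> lin_maps K (pointwise N (dcochain n)) (pointwise M (H.cochain n))"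
proof (rule lin_mapsI)
  interpret U: linear_space K "pointwise N (dcochain n)" by (rule linear_space_dcochain)
  interpret V: linear_space K "pointwise M (H.cochain n)" by (rule H.linear_space_cochain)
  note S = Psi_spec[OF n]
  fix f assume f: "f \<in> carrier (pointwise N (dcochain n))"
  then have f': "f \<in> dcochain n" by simp
  have Pf: "\<Psi> (int n) f \<in> carrier (pointwise M (H.cochain n))" using S(1)[OF f'] by simp
  then show "\<Psi> (int n) f \<in> carrier (pointwise M (H.cochain n))" .
  show "\<Psi> (int n) (f \<oplus>\<^bsub>pointwise N (dcochain n)\<^esub> g) = \<Psi> (int n) f \<oplus>\<^bsub>pointwise M (H.cochain n)\<^esub> \<Psi> (int n) g"
    if g: "g \<in> carrier (pointwise N (dcochain n))" for g
  proof (rule H_cochain_ext)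
    have g': "g \<in> dcochain n" using g by simp
    have fg: "f \<oplus>\<^bsub>pointwise N (dcochain n)\<^esub> g \<in> dcochain n" using U.M.a_closed[OF f g] by simp
    show "\<Psi> (int n) (f \<oplus>\<^bsub>pointwise N (dcochain n)\<^esub> g) \<in> H.cochain n" by (rule S(1)[OF fg])
    show "\<Psi> (int n) f \<oplus>\<^bsub>pointwise M (H.cochain n)\<^esub> \<Psi> (int n) g \<in> H.cochain n"
      using V.M.a_closed[OF Pf, of "\<Psi> (int n) g"] S(1)[OF g'] by simp
    show "\<Psi> (int n) (f \<oplus>\<^bsub>pointwise N (dcochain n)\<^esub> g) (map2 AB.pure as bs) =
        (\<Psi> (int n) f \<oplus>\<^bsub>pointwise M (H.cochain n)\<^esub> \<Psi> (int n) g) (map2 AB.pure as bs)"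
      if "as \<in> tuples A n" "bs \<in> tuples B n" for as bs
      using that S(2)[OF fg] S(2)[OF f'] S(2)[OF g'] lin_maps_add[OF psi_val_lin f g] by simp
  qed
  show "\<Psi> (int n) (c \<odot>\<^bsub>pointwise N (dcochain n)\<^esub> f) = c \<odot>\<^bsub>pointwise M (H.cochain n)\<^esub> \<Psi> (int n) f"
    if c: "c \<in> carrier K" for c
  proof (rule H_cochain_ext)
    have cf: "c \<odot>\<^bsub>pointwise N (dcochain n)\<^esub> f \<in> dcochain n" using U.smult_closed[OF c f] by simp
    show "\<Psi> (int n) (c \<odot>\<^bsub>pointwise N (dcochain n)\<^esub> f) \<in> H.cochain n" by (rule S(1)[OF cf])
    show "c \<odot>\<^bsub>pointwise M (H.cochain n)\<^esub> \<Psi> (int n) f \<in> H.cochain n"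
      using V.smult_closed[OF c Pf] by simp
    show "\<Psi> (int n) (c \<odot>\<^bsub>pointwise N (dcochain n)\<^esub> f) (map2 AB.pure as bs) =
        (c \<odot>\<^bsub>pointwise M (H.cochain n)\<^esub> \<Psi> (int n) f) (map2 AB.pure as bs)"
      if "as \<in> tuples A n" "bs \<in> tuples B n" for as bs
      using that S(2)[OF cf] S(2)[OF f'] lin_maps_smult[OF psi_val_lin c f] by simp
  qed
qed

end

section \<open>Compatibility of Psi with the differentials\<close>

lemma contract_append:
  "length us = k \<Longrightarrow> contract m (Suc k) (us @ x # y # vs) = us @ m x y # vs"
  by (simp add: contract_def nth_append)

lemma split_two:
  assumes "xs \<in> tuples U (Suc n)" and "k < n"
  obtains us x y vs where "xs = us @ x # y # vs" and "length us = k"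
proof
  have len: "length xs = Suc n" using assms(1) by (simp add: tuples_def)
  have "xs = take k xs @ xs ! k # drop (Suc k) xs"
    using len assms(2) by (intro id_take_nth_drop) simp
  moreover have "drop (Suc k) xs = xs ! Suc k # drop (Suc (Suc k)) xs"
    using len assms(2) by (intro Cons_nth_drop_Suc[symmetric]) simp
  ultimately show "xs = take k xs @ xs ! k # xs ! Suc k # drop (Suc (Suc k)) xs" by simp
  show "length (take k xs) = k" using len assms(2) by simp
qed

lemma append_Cons_tuples:
  "us @ x # vs \<in> tuples U n \<longleftrightarrow> set us \<subseteq> carrier U \<and> x \<in> carrier U \<and> set vs \<subseteq> carrier U \<and>
    n = Suc (length us + length vs)"
  by (auto simp: tuples_def)

lemma multilinear_slot_plus:
  assumes F: "multilinear K U V n F" and xs: "us @ x # vs \<in> tuples U n" and y: "y \<in> carrier U"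
  shows "F (us @ (x \<oplus>\<^bsub>U\<^esub> y) # vs) = F (us @ x # vs) \<oplus>\<^bsub>V\<^esub> F (us @ y # vs)"
proof -
  have "x \<in> carrier U" "length us < n" using xs by (auto simp: append_Cons_tuples)
  then show ?thesis
    using lin_maps_add[OF multilinear_slot[OF F xs, of "length us"], of x y] y by simp
qed

lemma lin_maps_sgn:
  assumes "h \<in> lin_maps K U V" and "linear_space K U" and "linear_space K V" and "x \<in> carrier U"
  shows "h (sgn_smult U i x) = sgn_smult V i (h x)"
  using lin_maps_neg[OF assms] by (simp add: sgn_smult_def)

lemma (in linear_space) finsum_first:
  assumes "\<And>s. f s \<in> carrier M"
  shows "(\<Oplus>s\<in>{1..Suc n}. f s) = f 1 \<oplus> (\<Oplus>s\<in>{1..n}. f (Suc s))"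
proof -
  have e: "{1..Suc n} = insert 1 (Suc ` {1..n})"
    by (auto simp: image_iff)
  have "(\<Oplus>s\<in>Suc ` {1..n}. f s) = (\<Oplus>s\<in>{1..n}. f (Suc s))"
    using assms by (intro M.finsum_reindex) auto
  moreover have "(\<Oplus>s\<in>insert 1 (Suc ` {1..n}). f s) = f 1 \<oplus> (\<Oplus>s\<in>Suc ` {1..n}. f s)"
    using assms by (intro M.finsum_insert) auto
  ultimately show ?thesis unfolding e by simp
qed

text \<open>The list inside \<open>word\<close> is a permutation of \<open>as\<close> for every
  natural number \<open>r\<close>. Sum lemmas such as \<open>finsum_upto_Suc\<close> and
  \<open>finsum_split_at\<close> ask for closure at all indices.\<close>

lemma (in perm_alg) word_closed':
  assumes "as \<in> tuples A (Suc n)"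
  shows "word r as \<in> carrier A"
proof -
  let ?l = "rev (take r as) @ drop r as"
  have "set ?l = set (take r as @ drop r as)" unfolding set_append set_rev ..
  then have s: "set ?l = set as" unfolding append_take_drop_id .
  then have "?l \<in> tuples A (Suc n)" using assms by (auto simp: tuples_def simp del: set_append)
  then obtain y ys where "?l = y # ys" "y \<in> carrier A" "ys \<in> tuples A n" by (auto simp: tuples_Suc)
  then show ?thesis by (auto simp: word_def list_mult_def tuples_def)
qed

context perm_dendriform
begin

text \<open>Acting on the summand with index \<open>s\<close> gives a \<open>\<prec>\<close> term
  led by \<open>a\<close> and a \<open>\<succ>\<close> term with the old leader, now in position
  \<open>s + 1\<close>. All the \<open>\<prec>\<close> terms share one word, which is why the case
  \<open>r = 1\<close> sums over all components of \<open>f\<close>.\<close>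

lemma psi_left:
  assumes n: "1 \<le> n" and f: "f \<in> dcochain n" and as: "as \<in> tuples A n" and bs: "bs \<in> tuples B n"
    and a: "a \<in> carrier A" and b: "b \<in> carrier B"
  shows "tensor_lact K A B N (AB.pure a b) (psi_val n f as bs) =
    (\<Oplus>\<^bsub>M\<^esub>r\<in>{1..Suc n}. AN.pure (A.word r (a # as)) (left_part n f r (b # bs)))"
proof -
  note fc = dcochain_closed[OF f] and pc = AN.pure_closed and wc = A.word_closed[OF as]
  note blp = bilinear_opD(3)[OF D.lprec_bilinear] and bls = bilinear_opD(3)[OF D.lsucc_bilinear]
  have abs: "a # as \<in> tuples A (Suc n)" "b # bs \<in> tuples B (Suc n)" using a as b bs by auto
  note wc' = A.word_closed'[OF abs(1)] and lc = part_closed(1)[OF f abs(2)]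
  have l: "tensor_lact K A B N (AB.pure a b) \<in> lin_maps K M M"
    using bilinear_opD(1)[OF spec_l(1) AB.pure_closed[OF a b]] by (simp add: tensor_lact_def)
  have "tensor_lact K A B N (AB.pure a b) (psi_val n f as bs) =
      (\<Oplus>\<^bsub>M\<^esub>s\<in>{1..n}. tensor_lact K A B N (AB.pure a b) (AN.pure (A.word s as) (f (s, bs))))"
    unfolding psi_val_def using fc pc wc
    by (intro lin_maps_finsum[OF l AN.linear_space_tensor AN.linear_space_tensor]) auto
  also have "\<dots> = (\<Oplus>\<^bsub>M\<^esub>s\<in>{1..n}. AN.pure (A.word 1 (a # as)) (b \<prec>l\<^bsub>N\<^esub> f (s, bs)) \<oplus>\<^bsub>M\<^esub>
      AN.pure (A.word (Suc s) (a # as)) (b \<succ>l\<^bsub>N\<^esub> f (s, bs)))"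
  proof (rule AN.T.M.finsum_cong')
    fix s assume s: "s \<in> {1..n}"
    show "tensor_lact K A B N (AB.pure a b) (AN.pure (A.word s as) (f (s, bs))) =
      AN.pure (A.word 1 (a # as)) (b \<prec>l\<^bsub>N\<^esub> f (s, bs)) \<oplus>\<^bsub>M\<^esub>
      AN.pure (A.word (Suc s) (a # as)) (b \<succ>l\<^bsub>N\<^esub> f (s, bs))"
      unfolding tensor_lact_def spec_l(2)[OF a wc[OF s] b fc] A.word_left(1,2)[OF as s a] ..
  qed (use pc wc' fc blp bls b in auto)
  also have "\<dots> = (\<Oplus>\<^bsub>M\<^esub>s\<in>{1..n}. AN.pure (A.word 1 (a # as)) (b \<prec>l\<^bsub>N\<^esub> f (s, bs))) \<oplus>\<^bsub>M\<^esub>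
      (\<Oplus>\<^bsub>M\<^esub>s\<in>{1..n}. AN.pure (A.word (Suc s) (a # as)) (b \<succ>l\<^bsub>N\<^esub> f (s, bs)))"
    using pc wc' fc blp bls b by (intro AN.T.M.finsum_addf) auto
  also have "(\<Oplus>\<^bsub>M\<^esub>s\<in>{1..n}. AN.pure (A.word 1 (a # as)) (b \<prec>l\<^bsub>N\<^esub> f (s, bs))) =
      AN.pure (A.word 1 (a # as)) (\<Oplus>\<^bsub>N\<^esub>s\<in>{1..n}. b \<prec>l\<^bsub>N\<^esub> f (s, bs))"
    using fc blp b
    by (intro lin_maps_finsum[OF bilinear_opD(1)[OF AN.pure_bilinear wc'] lsN AN.linear_space_tensor, symmetric])
      auto
  also have "(\<Oplus>\<^bsub>N\<^esub>s\<in>{1..n}. b \<prec>l\<^bsub>N\<^esub> f (s, bs)) = left_part n f 1 (b # bs)"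
    by (simp add: left_part_def)
  also have "(\<Oplus>\<^bsub>M\<^esub>s\<in>{1..n}. AN.pure (A.word (Suc s) (a # as)) (b \<succ>l\<^bsub>N\<^esub> f (s, bs))) =
      (\<Oplus>\<^bsub>M\<^esub>s\<in>{1..n}. AN.pure (A.word (Suc s) (a # as)) (left_part n f (Suc s) (b # bs)))"
    using pc wc' fc bls b by (intro AN.T.M.finsum_cong') (auto simp: left_part_def)
  also have "AN.pure (A.word 1 (a # as)) (left_part n f 1 (b # bs)) \<oplus>\<^bsub>M\<^esub> \<dots> =
      (\<Oplus>\<^bsub>M\<^esub>r\<in>{1..Suc n}. AN.pure (A.word r (a # as)) (left_part n f r (b # bs)))"
    using pc wc' lc by (intro AN.T.finsum_first[symmetric]) auto
  finally show ?thesis .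
qed

text \<open>Mirror image of \<open>psi_left\<close>: the \<open>\<prec>\<close> terms keep leader
  and position, while all the \<open>\<succ>\<close> terms are led by the appended \<open>a\<close>
  and collect in component \<open>n + 1\<close>.\<close>

lemma psi_right:
  assumes n: "1 \<le> n" and f: "f \<in> dcochain n" and as: "as \<in> tuples A n" and bs: "bs \<in> tuples B n"
    and a: "a \<in> carrier A" and b: "b \<in> carrier B"
  shows "tensor_ract K A B N (psi_val n f as bs) (AB.pure a b) =
    (\<Oplus>\<^bsub>M\<^esub>r\<in>{1..Suc n}. AN.pure (A.word r (as @ [a])) (right_part n f r (bs @ [b])))"
proof -
  note fc = dcochain_closed[OF f] and pc = AN.pure_closed and wc = A.word_closed[OF as]
  note brp = bilinear_opD(3)[OF D.rprec_bilinear] and brs = bilinear_opD(3)[OF D.rsucc_bilinear]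
  have abs: "as @ [a] \<in> tuples A (Suc n)" "bs @ [b] \<in> tuples B (Suc n)"
    using a as b bs by (auto simp: tuples_def)
  note wc' = A.word_closed'[OF abs(1)] and rc = part_closed(3)[OF f abs(2)]
  have r: "(\<lambda>x. tensor_ract K A B N x (AB.pure a b)) \<in> lin_maps K M M"
    using bilinear_opD(2)[OF spec_r(1) AB.pure_closed[OF a b]] by (simp add: tensor_ract_def)
  have "tensor_ract K A B N (psi_val n f as bs) (AB.pure a b) =
      (\<Oplus>\<^bsub>M\<^esub>s\<in>{1..n}. tensor_ract K A B N (AN.pure (A.word s as) (f (s, bs))) (AB.pure a b))"
    unfolding psi_val_def using fc pc wc
    by (intro lin_maps_finsum[OF r AN.linear_space_tensor AN.linear_space_tensor]) auto
  also have "\<dots> = (\<Oplus>\<^bsub>M\<^esub>s\<in>{1..n}. AN.pure (A.word s (as @ [a])) (f (s, bs) \<prec>r\<^bsub>N\<^esub> b) \<oplus>\<^bsub>M\<^esub>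
      AN.pure (A.word (Suc n) (as @ [a])) (f (s, bs) \<succ>r\<^bsub>N\<^esub> b))"
  proof (rule AN.T.M.finsum_cong')
    fix s assume s: "s \<in> {1..n}"
    show "tensor_ract K A B N (AN.pure (A.word s as) (f (s, bs))) (AB.pure a b) =
      AN.pure (A.word s (as @ [a])) (f (s, bs) \<prec>r\<^bsub>N\<^esub> b) \<oplus>\<^bsub>M\<^esub>
      AN.pure (A.word (Suc n) (as @ [a])) (f (s, bs) \<succ>r\<^bsub>N\<^esub> b)"
      unfolding tensor_ract_def spec_r(2)[OF wc[OF s] a fc b] A.word_left(3,4)[OF as s a] ..
  qed (use pc wc' fc brp brs b in auto)
  also have "\<dots> = (\<Oplus>\<^bsub>M\<^esub>s\<in>{1..n}. AN.pure (A.word s (as @ [a])) (f (s, bs) \<prec>r\<^bsub>N\<^esub> b)) \<oplus>\<^bsub>M\<^esub>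
      (\<Oplus>\<^bsub>M\<^esub>s\<in>{1..n}. AN.pure (A.word (Suc n) (as @ [a])) (f (s, bs) \<succ>r\<^bsub>N\<^esub> b))"
    using pc wc' fc brp brs b by (intro AN.T.M.finsum_addf) auto
  also have "(\<Oplus>\<^bsub>M\<^esub>s\<in>{1..n}. AN.pure (A.word (Suc n) (as @ [a])) (f (s, bs) \<succ>r\<^bsub>N\<^esub> b)) =
      AN.pure (A.word (Suc n) (as @ [a])) (\<Oplus>\<^bsub>N\<^esub>s\<in>{1..n}. f (s, bs) \<succ>r\<^bsub>N\<^esub> b)"
    using fc brs b
    by (intro lin_maps_finsum[OF bilinear_opD(1)[OF AN.pure_bilinear wc'] lsN AN.linear_space_tensor, symmetric])
      auto
  also have "(\<Oplus>\<^bsub>N\<^esub>s\<in>{1..n}. f (s, bs) \<succ>r\<^bsub>N\<^esub> b) = right_part n f (Suc n) (bs @ [b])"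
    by (simp add: right_part_def)
  also have "(\<Oplus>\<^bsub>M\<^esub>s\<in>{1..n}. AN.pure (A.word s (as @ [a])) (f (s, bs) \<prec>r\<^bsub>N\<^esub> b)) =
      (\<Oplus>\<^bsub>M\<^esub>s\<in>{1..n}. AN.pure (A.word s (as @ [a])) (right_part n f s (bs @ [b])))"
    using pc wc' fc brp b by (intro AN.T.M.finsum_cong') (auto simp: right_part_def)
  also have "\<dots> \<oplus>\<^bsub>M\<^esub> AN.pure (A.word (Suc n) (as @ [a])) (right_part n f (Suc n) (bs @ [b])) =
      AN.pure (A.word (Suc n) (as @ [a])) (right_part n f (Suc n) (bs @ [b])) \<oplus>\<^bsub>M\<^esub>
      (\<Oplus>\<^bsub>M\<^esub>s\<in>{1..n}. AN.pure (A.word s (as @ [a])) (right_part n f s (bs @ [b])))"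
    using pc wc' rc by (intro AN.T.M.a_comm AN.T.M.finsum_closed) auto
  also have "\<dots> = (\<Oplus>\<^bsub>M\<^esub>r\<in>{1..Suc n}. AN.pure (A.word r (as @ [a])) (right_part n f r (bs @ [b])))"
    using pc wc' rc by (intro AN.T.finsum_upto_Suc[symmetric]) auto
  finally show ?thesis .
qed

text \<open>Additivity of \<open>f\<close> in the merged slot. When a contraction misses the leader,
  both orders of the merged factors give the same word, and the two terms combine into one
  contraction by \<open>star\<close>.\<close>

lemma dcochain_contract_star:
  assumes f: "f \<in> dcochain n" and bs: "bs \<in> tuples B (Suc n)" and k: "k < n" and s: "s \<in> {1..n}"
  shows "f (s, contract (star B) (Suc k) bs) =
    f (s, contract (prec B) (Suc k) bs) \<oplus>\<^bsub>N\<^esub> f (s, contract (succ B) (Suc k) bs)"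
proof -
  obtain us x y vs where d: "bs = us @ x # y # vs" "length us = k" using split_two[OF bs k] .
  have xy: "x \<in> carrier B" "y \<in> carrier B" using bs by (auto simp: d tuples_def)
  then have "us @ (x \<prec>\<^bsub>B\<^esub> y) # vs \<in> tuples B n" "x \<succ>\<^bsub>B\<^esub> y \<in> carrier B"
    using bs bilinear_opD(3)[OF D.B.prec_bilinear] bilinear_opD(3)[OF D.B.succ_bilinear]
    by (auto simp: d tuples_def)
  then show ?thesis
    using multilinear_slot_plus[OF dcochain_multilinear[OF f s]]
    by (simp add: d contract_append star_def)
qed

text \<open>The product of neighbouring pure tensors is a sum of two pure tensors, one for
  \<open>\<prec>\<close> and one for \<open>\<succ>\<close>, so the contraction evaluates to two
  copies of \<open>psi_val\<close>. Sorted by leader, their terms are the \<open>n + 1\<close>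
  components of \<open>inner_part\<close>.\<close>

lemma psi_inner:
  assumes n: "1 \<le> n" and f: "f \<in> dcochain n" and as: "as \<in> tuples A (Suc n)"
    and bs: "bs \<in> tuples B (Suc n)" and k: "k < n"
  shows "\<Psi> (int n) f (contract (mult R) (Suc k) (map2 AB.pure as bs)) =
    (\<Oplus>\<^bsub>M\<^esub>r\<in>{1..Suc n}. AN.pure (A.word r as) (inner_part f r (Suc k) bs))"
proof -
  let ?op = "\<lambda>x y. y \<otimes>\<^bsub>A\<^esub> x"
  let ?as1 = "contract (mult A) (Suc k) as" and ?as2 = "contract ?op (Suc k) as"
  let ?bs1 = "contract (prec B) (Suc k) bs" and ?bs2 = "contract (succ B) (Suc k) bs"
  note fc = dcochain_closed[OF f] and pc = AN.pure_closed
  note Bp = bilinear_opD(3)[OF D.B.prec_bilinear] and Bs = bilinear_opD(3)[OF D.B.succ_bilinear]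
  have t: "?as1 \<in> tuples A n" "?as2 \<in> tuples A n" "?bs1 \<in> tuples B n" "?bs2 \<in> tuples B n"
    using contract_tuples[where m = "mult A", OF _ k as] contract_tuples[where m = ?op, OF _ k as]
      contract_tuples[where m = "prec B", OF _ k bs] contract_tuples[where m = "succ B", OF _ k bs]
      Bp Bs by blast+
  have main: "\<Psi> (int n) f (contract (mult R) (Suc k) (map2 AB.pure as bs)) =
      psi_val n f ?as1 ?bs1 \<oplus>\<^bsub>M\<^esub> psi_val n f ?as2 ?bs2"
  proof -
    obtain us x y vs where d: "as = us @ x # y # vs" "length us = k" using split_two[OF as k] .
    obtain us' u v vs' where d': "bs = us' @ u # v # vs'" "length us' = k" using split_two[OF bs k] .
    have c: "x \<in> carrier A" "y \<in> carrier A" "u \<in> carrier B" "v \<in> carrier B"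
      using as bs by (auto simp: d d' tuples_def)
    let ?U = "map2 AB.pure us us'" and ?V = "map2 AB.pure vs vs'"
    let ?p = "AB.pure (x \<otimes>\<^bsub>A\<^esub> y) (u \<prec>\<^bsub>B\<^esub> v)" and ?q = "AB.pure (y \<otimes>\<^bsub>A\<^esub> x) (u \<succ>\<^bsub>B\<^esub> v)"
    have z: "zip (us @ ws) (us' @ ws') = zip us us' @ zip ws ws'" for ws ws'
      using d(2) d'(2) by (simp add: zip_append)
    have "contract (mult R) (Suc k) (map2 AB.pure as bs) =
        contract (mult R) (Suc k) (?U @ AB.pure x u # AB.pure y v # ?V)"
      by (simp add: d d' z)
    also have "\<dots> = ?U @ (AB.pure x u \<otimes>\<^bsub>R\<^esub> AB.pure y v) # ?V"
      using d(2) d'(2) by (intro contract_append) simp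
    also have "AB.pure x u \<otimes>\<^bsub>R\<^esub> AB.pure y v = ?p \<oplus>\<^bsub>AB.T\<^esub> ?q"
      unfolding R_simps by (rule spec_R(2)[OF c])
    finally have e: "contract (mult R) (Suc k) (map2 AB.pure as bs) = ?U @ (?p \<oplus>\<^bsub>AB.T\<^esub> ?q) # ?V" .
    have e1: "map2 AB.pure ?as1 ?bs1 = ?U @ ?p # ?V" "map2 AB.pure ?as2 ?bs2 = ?U @ ?q # ?V"
      using d(2) d'(2) by (simp_all add: d d' contract_append z)
    have "multilinear K AB.T M n (\<Psi> (int n) f)" using Psi_spec(1)[OF n f] by simp
    then have "\<Psi> (int n) f (?U @ (?p \<oplus>\<^bsub>AB.T\<^esub> ?q) # ?V) =
        \<Psi> (int n) f (?U @ ?p # ?V) \<oplus>\<^bsub>M\<^esub> \<Psi> (int n) f (?U @ ?q # ?V)"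
      using AB.map2_pure_tuples[OF t(1,3)] AB.map2_pure_tuples[OF t(2,4)]
      by (intro multilinear_slot_plus[of K AB.T M n]) (auto simp: e1 append_Cons_tuples)
    then show ?thesis
      unfolding e by (simp only: e1[symmetric] Psi_spec(2)[OF n f t(1,3)] Psi_spec(2)[OF n f t(2,4)])
  qed
  define G where "G r = AN.pure (A.word r as) (inner_part f r (Suc k) bs)" for r
  have Gc: "G r \<in> carrier M" for r
    unfolding G_def by (rule pc[OF A.word_closed'[OF as] part_closed(2)[OF f bs]])
  have "psi_val n f ?as1 ?bs1 \<oplus>\<^bsub>M\<^esub> psi_val n f ?as2 ?bs2 =
      (\<Oplus>\<^bsub>M\<^esub>s\<in>{1..n}. AN.pure (A.word s ?as1) (f (s, ?bs1)) \<oplus>\<^bsub>M\<^esub> AN.pure (A.word s ?as2) (f (s, ?bs2)))"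
    unfolding psi_val_def
    using pc fc A.word_closed[OF t(1)] A.word_closed[OF t(2)]
    by (intro AN.T.M.finsum_addf[symmetric]) auto
  \<comment> \<open>For \<open>s\<close> other than \<open>k + 1\<close> the two words coincide and
    the terms merge by \<open>star\<close>; at \<open>s = k + 1\<close> they have different leaders
    and fill two components. This is the shape that \<open>finsum_split_at\<close> unrolls.\<close>
  also have "\<dots> = (\<Oplus>\<^bsub>M\<^esub>s\<in>{1..n}. if s < Suc k then G s
      else if s = Suc k then G (Suc k) \<oplus>\<^bsub>M\<^esub> G (Suc (Suc k)) else G (Suc s))"
  proof (rule AN.T.M.finsum_cong')
    fix s assume s: "s \<in> {1..n}"
    note w1 = A.word_contract[OF as k s, of "mult A"] and w2 = A.word_contract[OF as k s, of ?op]
    note st = dcochain_contract_star[OF f bs k s]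
    note add = bilinear_opD(5)[OF AN.pure_bilinear A.word_closed'[OF as] fc fc]
    show "AN.pure (A.word s ?as1) (f (s, ?bs1)) \<oplus>\<^bsub>M\<^esub> AN.pure (A.word s ?as2) (f (s, ?bs2)) =
      (if s < Suc k then G s else if s = Suc k then G (Suc k) \<oplus>\<^bsub>M\<^esub> G (Suc (Suc k)) else G (Suc s))"
    proof -
      consider "s < Suc k" | "s = Suc k" | "Suc k < s" by linarith
      then show ?thesis
      proof cases
        case 1
        then have "A.word s ?as1 = A.word s as" "A.word s ?as2 = A.word s as" using w1(1) w2(1) by auto
        then show ?thesis using 1 by (simp add: G_def inner_part_def st add)
      next
        case 2
        then have "A.word s ?as1 = A.word s as" "A.word s ?as2 = A.word (Suc s) as" using w1(3) w2(4) by auto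
        then show ?thesis using 2 by (simp add: G_def inner_part_def)
      next
        case 3
        then have "A.word s ?as1 = A.word (Suc s) as" "A.word s ?as2 = A.word (Suc s) as"
          using w1(2) w2(2) by auto
        then show ?thesis using 3 by (simp add: G_def inner_part_def st add)
      qed
    qed
  qed (use Gc in auto)
  also have "\<dots> = (\<Oplus>\<^bsub>M\<^esub>r\<in>{1..Suc n}. G r)"
    using k by (intro AN.T.finsum_split_at[OF Gc]) auto
  finally show ?thesis using main by (simp only: G_def)
qed

text \<open>It is enough to compare pure tensors, where the left, inner and right parts of the two
  differentials match one by one.\<close>

lemma Psi_cobd:
  assumes n: "1 \<le> n" and f: "f \<in> dcochain n"
  shows "\<Psi> (int (Suc n)) (dend_cobd B N n f) =
    hoch_cobd R M (tensor_lact K A B N) (tensor_ract K A B N) n (\<Psi> (int n) f)"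
proof (rule H_cochain_ext[of _ "Suc n"])
  have df: "dend_cobd B N n f \<in> dcochain (Suc n)" by (rule dend_cobd_closed[OF n f])
  have n': "1 \<le> Suc n" by simp
  show "\<Psi> (int (Suc n)) (dend_cobd B N n f) \<in> H.cochain (Suc n)" by (rule Psi_spec(1)[OF n' df])
  show "hoch_cobd R M (tensor_lact K A B N) (tensor_ract K A B N) n (\<Psi> (int n) f) \<in> H.cochain (Suc n)"
    by (rule H.hoch_cobd_closed[OF Psi_spec(1)[OF n f]])
  fix as bs assume as: "as \<in> tuples A (Suc n)" and bs: "bs \<in> tuples B (Suc n)"
  let ?xs = "map2 AB.pure as bs"
  let ?L = "\<lambda>r. AN.pure (A.word r as) (left_part n f r bs)"
  let ?I = "\<lambda>r i. AN.pure (A.word r as) (inner_part f r i bs)"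
  let ?R = "\<lambda>r. AN.pure (A.word r as) (right_part n f r bs)"
  note wc = A.word_closed'[OF as] and pc = AN.pure_closed and part = part_closed[OF f bs]
  note lsM = AN.linear_space_tensor
  note sc = AN.T.sgn_closed and scN = N.sgn_closed
  have c: "?L r \<in> carrier M" "?I r i \<in> carrier M" "?R r \<in> carrier M" for r i
    using wc part pc by auto
  have "\<Psi> (int (Suc n)) (dend_cobd B N n f) ?xs = psi_val (Suc n) (dend_cobd B N n f) as bs"
    by (rule Psi_spec(2)[OF n' df as bs])
  also have "\<dots> = (\<Oplus>\<^bsub>M\<^esub>r\<in>{1..Suc n}. ?L r \<oplus>\<^bsub>M\<^esub> (\<Oplus>\<^bsub>M\<^esub>i\<in>{1..n}. sgn_smult M i (?I r i)) \<oplus>\<^bsub>M\<^esub>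
      sgn_smult M (Suc n) (?R r))"
    unfolding psi_val_def
  proof (rule AN.T.M.finsum_cong')
    fix r assume r: "r \<in> {1..Suc n}"
    have p: "AN.pure (A.word r as) \<in> lin_maps K N M" by (rule bilinear_opD(1)[OF AN.pure_bilinear wc])
    have "AN.pure (A.word r as) (dend_cobd B N n f (r, bs)) =
      ?L r \<oplus>\<^bsub>M\<^esub> AN.pure (A.word r as) (\<Oplus>\<^bsub>N\<^esub>i\<in>{1..n}. sgn_smult N i (inner_part f r i bs)) \<oplus>\<^bsub>M\<^esub>
      AN.pure (A.word r as) (sgn_smult N (Suc n) (right_part n f r bs))"
      unfolding dend_cobd_eq[OF n f r bs] using part scN
      by (simp add: lin_maps_add[OF p] N.M.finsum_closed Pi_def)
    also have "AN.pure (A.word r as) (\<Oplus>\<^bsub>N\<^esub>i\<in>{1..n}. sgn_smult N i (inner_part f r i bs)) =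
        (\<Oplus>\<^bsub>M\<^esub>i\<in>{1..n}. AN.pure (A.word r as) (sgn_smult N i (inner_part f r i bs)))"
      using part scN by (intro lin_maps_finsum[OF p lsN lsM]) auto
    also have "(\<lambda>i. AN.pure (A.word r as) (sgn_smult N i (inner_part f r i bs))) = (\<lambda>i. sgn_smult M i (?I r i))"
      using part by (intro ext lin_maps_sgn[OF p lsN lsM])
    also have "AN.pure (A.word r as) (sgn_smult N (Suc n) (right_part n f r bs)) = sgn_smult M (Suc n) (?R r)"
      using part by (intro lin_maps_sgn[OF p lsN lsM])
    finally show "AN.pure (A.word r as) (dend_cobd B N n f (r, bs)) =
      ?L r \<oplus>\<^bsub>M\<^esub> (\<Oplus>\<^bsub>M\<^esub>i\<in>{1..n}. sgn_smult M i (?I r i)) \<oplus>\<^bsub>M\<^esub> sgn_smult M (Suc n) (?R r)" .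
  qed (use c sc in \<open>auto intro!: AN.T.M.finsum_closed\<close>)
  also have "\<dots> = (\<Oplus>\<^bsub>M\<^esub>r\<in>{1..Suc n}. ?L r \<oplus>\<^bsub>M\<^esub> (\<Oplus>\<^bsub>M\<^esub>i\<in>{1..n}. sgn_smult M i (?I r i))) \<oplus>\<^bsub>M\<^esub>
      (\<Oplus>\<^bsub>M\<^esub>r\<in>{1..Suc n}. sgn_smult M (Suc n) (?R r))"
    using c sc by (intro AN.T.M.finsum_addf) (auto intro!: AN.T.M.finsum_closed)
  also have "(\<Oplus>\<^bsub>M\<^esub>r\<in>{1..Suc n}. ?L r \<oplus>\<^bsub>M\<^esub> (\<Oplus>\<^bsub>M\<^esub>i\<in>{1..n}. sgn_smult M i (?I r i))) =
      (\<Oplus>\<^bsub>M\<^esub>r\<in>{1..Suc n}. ?L r) \<oplus>\<^bsub>M\<^esub> (\<Oplus>\<^bsub>M\<^esub>r\<in>{1..Suc n}. \<Oplus>\<^bsub>M\<^esub>i\<in>{1..n}. sgn_smult M i (?I r i))"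
    using c sc by (intro AN.T.M.finsum_addf) (auto intro!: AN.T.M.finsum_closed)
  \<comment> \<open>The dendriform side sums over leading positions first, the Hochschild side over
    contractions first.\<close>
  also have "(\<Oplus>\<^bsub>M\<^esub>r\<in>{1..Suc n}. \<Oplus>\<^bsub>M\<^esub>i\<in>{1..n}. sgn_smult M i (?I r i)) =
      (\<Oplus>\<^bsub>M\<^esub>i\<in>{1..n}. \<Oplus>\<^bsub>M\<^esub>r\<in>{1..Suc n}. sgn_smult M i (?I r i))"
    using c sc by (intro AN.T.finsum_swap) auto
  also have "(\<Oplus>\<^bsub>M\<^esub>i\<in>{1..n}. \<Oplus>\<^bsub>M\<^esub>r\<in>{1..Suc n}. sgn_smult M i (?I r i)) =
      (\<Oplus>\<^bsub>M\<^esub>i\<in>{1..n}. sgn_smult M i (\<Psi> (int n) f (contract (mult R) i ?xs)))"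
  proof (rule AN.T.M.finsum_cong')
    fix i assume i: "i \<in> {1..n}"
    then obtain k where k: "i = Suc k" "k < n" by (cases i) auto
    have "(\<Oplus>\<^bsub>M\<^esub>r\<in>{1..Suc n}. sgn_smult M i (?I r i)) = sgn_smult M i (\<Oplus>\<^bsub>M\<^esub>r\<in>{1..Suc n}. ?I r i)"
      using c by (intro AN.T.sgn_finsum[symmetric]) auto
    also have "(\<Oplus>\<^bsub>M\<^esub>r\<in>{1..Suc n}. ?I r i) = \<Psi> (int n) f (contract (mult R) i ?xs)"
      unfolding k(1) by (rule psi_inner[OF n f as bs k(2), symmetric])
    finally show "(\<Oplus>\<^bsub>M\<^esub>r\<in>{1..Suc n}. sgn_smult M i (?I r i)) =
      sgn_smult M i (\<Psi> (int n) f (contract (mult R) i ?xs))" .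
  qed (use sc H.cochain_closed[OF Psi_spec(1)[OF n f]] in auto)
  also have "(\<Oplus>\<^bsub>M\<^esub>r\<in>{1..Suc n}. sgn_smult M (Suc n) (?R r)) =
      sgn_smult M (Suc n) (\<Oplus>\<^bsub>M\<^esub>r\<in>{1..Suc n}. ?R r)"
    using c by (intro AN.T.sgn_finsum[symmetric]) auto
  also have "(\<Oplus>\<^bsub>M\<^esub>r\<in>{1..Suc n}. ?L r) = tensor_lact K A B N (hd ?xs) (\<Psi> (int n) f (tl ?xs))"
  proof -
    obtain a as' b bs' where d: "as = a # as'" "bs = b # bs'" "a \<in> carrier A" "as' \<in> tuples A n"
      "b \<in> carrier B" "bs' \<in> tuples B n" using as bs by (auto simp: tuples_Suc)
    show ?thesis
      using psi_left[OF n f d(4,6,3,5)] Psi_spec(2)[OF n f d(4,6)] by (simp add: d)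
  qed
  also have "(\<Oplus>\<^bsub>M\<^esub>r\<in>{1..Suc n}. ?R r) = tensor_ract K A B N (\<Psi> (int n) f (butlast ?xs)) (last ?xs)"
  proof -
    obtain a as' b bs' where d: "as = as' @ [a]" "bs = bs' @ [b]"
      using tuples_Suc_sel(1)[OF as] tuples_Suc_sel(1)[OF bs] by (metis append_butlast_last_id)
    then have c: "a \<in> carrier A" "as' \<in> tuples A n" "b \<in> carrier B" "bs' \<in> tuples B n"
      using as bs by (auto simp: tuples_def)
    have "length as' = length bs'" using c by (simp add: tuples_def)
    then show ?thesis
      using psi_right[OF n f c(2,4,1,3)] Psi_spec(2)[OF n f c(2,4)] by (simp add: d)
  qed
  finally show "\<Psi> (int (Suc n)) (dend_cobd B N n f) ?xs =
      hoch_cobd R M (tensor_lact K A B N) (tensor_ract K A B N) n (\<Psi> (int n) f) ?xs"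
    using AB.map2_pure_tuples[OF as bs] by (simp add: hoch_cobd_def R_simps(3))
qed

lemma Psi_inj:
  assumes l: "l \<in> lin_maps K A (self_module K)"
    and mult: "\<And>u v. u \<in> carrier A \<Longrightarrow> v \<in> carrier A \<Longrightarrow> l (u \<otimes>\<^bsub>A\<^esub> v) = l u \<otimes>\<^bsub>K\<^esub> e v"
    and ab: "a \<in> carrier A" "b \<in> carrier A"
    and val: "l a = \<one>\<^bsub>K\<^esub>" "l b = \<zero>\<^bsub>K\<^esub>" "e a = \<one>\<^bsub>K\<^esub>" "e b = \<one>\<^bsub>K\<^esub>"
    and n: "1 \<le> n"
  shows "inj_on (\<Psi> (int n)) (dcochain n)"
proof (rule inj_onI)
  have lc: "l u \<in> carrier K" if "u \<in> carrier A" for u using lin_maps_closed[OF l that] by simp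
  \<comment> \<open>\<open>h\<close> will be \<open>l\<close> tensored with the identity of
    \<open>N\<close>: it turns the coefficient in \<open>A\<close> into a scalar.\<close>
  have "bilinear_op K A N N (\<lambda>a n. l a \<odot>\<^bsub>N\<^esub> n)"
    by (rule bilinear_opI)
      (auto simp: lc lin_maps_add[OF l] lin_maps_smult[OF l] N.smult_l_distr N.smult_r_distr
        N.smult_assoc1[symmetric] A.R.m_comm)
  then obtain h where h: "h \<in> lin_maps K M N"
    "\<And>u x. u \<in> carrier A \<Longrightarrow> x \<in> carrier N \<Longrightarrow> h (AN.pure u x) = l u \<odot>\<^bsub>N\<^esub> x"
    using AN.tensor_lift[OF lsN] by blast
  have rec: "h (\<Psi> (int n) f (map2 AB.pure ((replicate n b)[r - 1 := a]) bs)) = f (r, bs)"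
    if f: "f \<in> dcochain n" and r: "r \<in> {1..n}" and bs: "bs \<in> tuples B n" for f r bs
  proof -
    let ?as = "(replicate n b)[r - 1 := a]"
    have sub: "set ?as \<subseteq> {a, b}" using set_update_subset_insert[of "replicate n b" "r - 1" a] by auto
    then have as: "?as \<in> tuples A n" using ab by (auto simp: tuples_def)
    have fc: "f z \<in> carrier N" for z by (rule dcochain_closed[OF f])
    \<comment> \<open>The functional sees only the leading entry, which is \<open>a\<close> exactly
      for \<open>s = r\<close>; the shifts \<open>r - 1\<close> and \<open>s - 1\<close> convert
      positions counted from 1 into list indices.\<close>
    have w: "l (A.word s ?as) = (if r = s then \<one>\<^bsub>K\<^esub> else \<zero>\<^bsub>K\<^esub>)" if s: "s \<in> {1..n}" for s
    proof -
      have "l (A.word s ?as) = l (?as ! (s - 1))"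
        using sub val by (intro A.word_functional[OF mult lc as _ s]) auto
      also have "?as ! (s - 1) = (if r = s then a else b)"
        using r s by (auto simp: nth_list_update)
      finally show ?thesis using val by simp
    qed
    have "h (\<Psi> (int n) f (map2 AB.pure ?as bs)) = h (psi_val n f ?as bs)"
      by (simp only: Psi_spec(2)[OF n f as bs])
    also have "\<dots> = (\<Oplus>\<^bsub>N\<^esub>s\<in>{1..n}. h (AN.pure (A.word s ?as) (f (s, bs))))"
      unfolding psi_val_def using fc A.word_closed[OF as] AN.pure_closed
      by (intro lin_maps_finsum[OF h(1) AN.linear_space_tensor lsN]) auto
    also have "\<dots> = (\<Oplus>\<^bsub>N\<^esub>s\<in>{1..n}. if r = s then f (s, bs) else \<zero>\<^bsub>N\<^esub>)"
    proof (rule N.M.finsum_cong')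
      fix s assume s: "s \<in> {1..n}"
      show "h (AN.pure (A.word s ?as) (f (s, bs))) = (if r = s then f (s, bs) else \<zero>\<^bsub>N\<^esub>)"
        using h(2)[OF A.word_closed[OF as s] fc] w[OF s] fc by simp
    qed (use fc in auto)
    also have "\<dots> = f (r, bs)"
      using r fc by (intro N.M.finsum_singleton) auto
    finally show ?thesis .
  qed
  fix f g assume f: "f \<in> dcochain n" and g: "g \<in> dcochain n" and eq: "\<Psi> (int n) f = \<Psi> (int n) g"
  show "f = g"
  proof
    fix z :: "nat \<times> 'b list"
    obtain r bs where z: "z = (r, bs)" by (cases z)
    show "f z = g z"
    proof (cases "(r, bs) \<in> {1..n} \<times> tuples B n")
      case True
      then show ?thesis using rec[OF f] rec[OF g] eq unfolding z by (metis mem_Sigma_iff)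
    next
      case False
      then have "h (r, bs) = \<zero>\<^bsub>N\<^esub>" if "h \<in> dcochain n" for h using that by blast
      from this[OF f] this[OF g] show ?thesis by (simp add: z)
    qed
  qed
qed

lemma obj_C_pos: "1 \<le> n \<Longrightarrow> obj C (int n) = pointwise N (dcochain n)"
  by (simp add: obj_C)

lemma obj_C_nonpos: "n \<le> 0 \<Longrightarrow> carrier (obj C n) = {\<lambda>_. \<zero>\<^bsub>N\<^esub>}"
  by (simp add: obj_C)

lemma zero_obj_C: "\<zero>\<^bsub>obj C n\<^esub> = (\<lambda>_. \<zero>\<^bsub>N\<^esub>)"
  by (simp add: obj_C)

lemma zero_obj_H: "\<zero>\<^bsub>obj H.complx n\<^esub> = (\<lambda>_. \<zero>\<^bsub>M\<^esub>)"
  by (simp add: H.obj_complx)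

lemma cobd_C_lin: "cobd C n \<in> lin_maps K (obj C n) (obj C (n + 1))"
proof (cases "n \<le> 0")
  case True
  have "(\<lambda>_. \<zero>\<^bsub>obj C (n + 1)\<^esub>) \<in> lin_maps K (obj C n) (obj C (n + 1))"
    by (rule linear_space.lin_maps_const_zero[OF linear_space_obj_C])
  then show ?thesis using True by (simp add: zero_obj_C) (simp add: dend_complex_def)
next
  case False
  then have e: "n = int (nat n)" "n + 1 = int (Suc (nat n))" "1 \<le> nat n" by auto
  have "cobd C n = dend_cobd B N (nat n)" using False by (simp add: dend_complex_def)
  moreover have "obj C n = pointwise N (dcochain (nat n))"
    using obj_C_pos[OF e(3)] unfolding e(1)[symmetric] .
  moreover have "1 \<le> Suc (nat n)" by simp
  then have "obj C (n + 1) = pointwise N (dcochain (Suc (nat n)))"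
    unfolding e(2) by (rule obj_C_pos)
  ultimately show ?thesis using dend_cobd_lin[OF e(3)] by simp
qed

lemma Psi_lin: "\<Psi> n \<in> lin_maps K (obj C n) (obj H.complx n)"
proof (cases "n \<le> 0")
  case True
  have "(\<lambda>_. \<zero>\<^bsub>obj H.complx n\<^esub>) \<in> lin_maps K (obj C n) (obj H.complx n)"
    by (rule linear_space.lin_maps_const_zero[OF H.linear_space_obj_complx])
  then show ?thesis using True by (simp add: zero_obj_H) (simp add: Psi_def[abs_def])
next
  case False
  then have e: "n = int (nat n)" "1 \<le> nat n" by auto
  show ?thesis
    using Psi_lin_nat[OF e(2)] obj_C_pos[OF e(2)] H.obj_complx[of n] False by simp
qed

text \<open>For \<open>n \<le> 0\<close> both sides vanish because \<open>\<Psi> n\<close> and the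
  dendriform differential are zero there. This covers the step out of degree 0, where the dendriform
  complex is still zero but the Hochschild complex has already begun.\<close>

lemma Psi_chain:
  assumes "f \<in> carrier (obj C n)"
  shows "\<Psi> (n + 1) (cobd C n f) = cobd H.complx n (\<Psi> n f)"
proof (cases "n \<le> 0")
  case True
  have f: "\<Psi> n f = \<zero>\<^bsub>obj H.complx n\<^esub>" using True by (simp add: Psi_def zero_obj_H)
  have c: "cobd C n f = \<zero>\<^bsub>obj C (n + 1)\<^esub>"
    unfolding zero_obj_C using True by (simp add: dend_complex_def)
  have lin: "cobd H.complx n \<in> lin_maps K (obj H.complx n) (obj H.complx (n + 1))"
    using H.cochain_complex_complx by (auto simp: cochain_complex_def)
  show ?thesis
    unfolding f c
    using lin_maps_zero[OF lin H.linear_space_obj_complx H.linear_space_obj_complx]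
      lin_maps_zero[OF Psi_lin linear_space_obj_C H.linear_space_obj_complx] by simp
next
  case False
  then have e: "n = int (nat n)" "n + 1 = int (Suc (nat n))" "1 \<le> nat n" by auto
  have f: "f \<in> dcochain (nat n)" using assms obj_C_pos[OF e(3)] e(1) by simp
  have "cobd C n = dend_cobd B N (nat n)" using False by (simp add: dend_complex_def)
  moreover have "cobd H.complx n = hoch_cobd R M (tensor_lact K A B N) (tensor_ract K A B N) (nat n)"
    using False by (simp add: hoch_complex_def)
  ultimately show ?thesis
    using Psi_cobd[OF e(3) f] unfolding e(1)[symmetric] e(2)[symmetric] by simp
qed

lemma Psi_complex_map:
  assumes inj: "\<And>n. 1 \<le> n \<Longrightarrow> inj_on (\<Psi> (int n)) (dcochain n)"
  shows "complex_map K C H.complx \<Psi>" and "inj_on (\<Psi> n) (carrier (obj C n))"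
proof -
  show inj': "inj_on (\<Psi> n) (carrier (obj C n))" for n
  proof (cases "n \<le> 0")
    case True
    then show ?thesis by (simp add: obj_C_nonpos)
  next
    case False
    then have e: "n = int (nat n)" "1 \<le> nat n" by auto
    show ?thesis using inj[OF e(2)] obj_C_pos[OF e(2)] e(1) by simp
  qed
  have "cobd C (n + 1) (cobd C n f) = \<zero>\<^bsub>obj C (n + 1 + 1)\<^esub>" if f: "f \<in> carrier (obj C n)" for n f
  proof (rule inj_onD[OF inj'])
    have c1: "cobd C n f \<in> carrier (obj C (n + 1))" by (rule lin_maps_closed[OF cobd_C_lin f])
    show "cobd C (n + 1) (cobd C n f) \<in> carrier (obj C (n + 1 + 1))"
      by (rule lin_maps_closed[OF cobd_C_lin c1])
    interpret L: linear_space K "obj C (n + 1 + 1)" by (rule linear_space_obj_C)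
    show "\<zero>\<^bsub>obj C (n + 1 + 1)\<^esub> \<in> carrier (obj C (n + 1 + 1))" by (rule L.M.zero_closed)
    have "\<Psi> n f \<in> carrier (obj H.complx n)" by (rule lin_maps_closed[OF Psi_lin f])
    then have "cobd H.complx (n + 1) (cobd H.complx n (\<Psi> n f)) = \<zero>\<^bsub>obj H.complx (n + 1 + 1)\<^esub>"
      using H.cochain_complex_complx unfolding cochain_complex_def by blast
    then show "\<Psi> (n + 1 + 1) (cobd C (n + 1) (cobd C n f)) = \<Psi> (n + 1 + 1) \<zero>\<^bsub>obj C (n + 1 + 1)\<^esub>"
      using lin_maps_zero[OF Psi_lin linear_space_obj_C H.linear_space_obj_complx]
      by (simp only: Psi_chain[OF c1] Psi_chain[OF f])
  qed
  then have "cochain_complex K C"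
    using cobd_C_lin linear_space.axioms[OF linear_space_obj_C] unfolding cochain_complex_def by blast
  moreover have "cochain_map K C H.complx \<Psi>"
    using Psi_lin Psi_chain unfolding cochain_map_def by blast
  ultimately show "complex_map K C H.complx \<Psi>"
    by (intro complex_map.intro complex_map_axioms.intro complex.intro H.cochain_complex_complx)
qed

end

text \<open>The three exactness claims, taken for all integers \<open>n\<close>, overlap in their
  maps and so spell out the long sequence. The two distinct elements of \<open>X\<close> enter
  through \<open>free_perm_functionals\<close>, and from there into the injectivity of
  \<open>\<Psi>\<close>.\<close>

theorem corollary3p6:
  fixes K :: "'k ring" and A :: "('k, 'a) module" and X :: "'x set"
    and B :: "('k, 'b) preassoc" and N :: "('k, 'b, 'n) preassoc_rep"
  assumes "field K"
    and "free_perm_algebra K X A"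
    and "\<exists>x\<in>X. \<exists>y\<in>X. x \<noteq> y"
    and "preassoc_algebra K B"
    and "preassoc_bimodule K B N"
  defines "C \<equiv> dend_complex K B N"
    and "D \<equiv> tensor_hoch_complex K A B N"
    and "Q \<equiv> quot_complex (tensor_hoch_complex K A B N) (Psi_image K A B N)"
    and "\<Psi> \<equiv> Psi K A B N"
    and "\<pi> \<equiv> quot_proj (tensor_hoch_complex K A B N) (Psi_image K A B N)"
  shows "short_exact_complexes K C \<Psi> D \<pi> Q \<and>
    (\<forall>n::int.
      exact_at K (coho C n) (coho_map D \<Psi> n) (coho D n) (coho_map Q \<pi> n) (coho Q n) \<and>
      exact_at K (coho D n) (coho_map Q \<pi> n) (coho Q n) (connecting C \<Psi> D \<pi> n) (coho C (n + 1)) \<and>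
      exact_at K (coho Q n) (connecting C \<Psi> D \<pi> n) (coho C (n + 1)) (coho_map D \<Psi> (n + 1)) (coho D (n + 1)))"
proof -
  interpret K: field K by fact
  have perm: "perm_algebra K A" using assms(2) by (simp add: free_perm_algebra_def)
  then have "linear_space K A" by (simp add: perm_algebra_def algebra_over_def linear_space_def)
  moreover have "linear_space K B" "linear_space K N"
    using assms(4,5) by (simp_all add: linear_space_def preassoc_algebra_def preassoc_bimodule_def)
  ultimately interpret P: perm_dendriform K A B N
    using perm assms(5) by (intro perm_dendriform.intro perm_alg.intro perm_alg_axioms.intro)
  obtain x y where xy: "x \<in> X" "y \<in> X" "x \<noteq> y" using assms(3) by blast
  obtain l e a b where "l \<in> lin_maps K A (self_module K)"
    "\<And>u v. u \<in> carrier A \<Longrightarrow> v \<in> carrier A \<Longrightarrow> l (u \<otimes>\<^bsub>A\<^esub> v) = l u \<otimes>\<^bsub>K\<^esub> e v"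
    "a \<in> carrier A" "b \<in> carrier A" "l a = \<one>\<^bsub>K\<^esub>" "l b = \<zero>\<^bsub>K\<^esub>" "e a = \<one>\<^bsub>K\<^esub>" "e b = \<one>\<^bsub>K\<^esub>"
    by (rule free_perm_functionals[OF K.is_cring assms(2) xy]) blast
  note inj = P.Psi_inj[OF this]
  interpret F: complex_map K C D \<Psi>
    unfolding C_def D_def \<Psi>_def P.complx_eq by (rule P.Psi_complex_map(1)[OF inj])
  have injF: "inj_on (\<Psi> n) (carrier (obj C n))" for n
    unfolding C_def \<Psi>_def by (rule P.Psi_complex_map(2)[OF inj])
  \<comment> \<open>Written over the complex itself, \<open>Psi_image\<close> is the image that
    \<open>short_exact_quotient\<close> divides by.\<close>
  have W: "Psi_image K A B N = (\<lambda>n. \<Psi> n ` carrier (obj C n))"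
    by (simp add: Psi_image_def[abs_def] C_def \<Psi>_def)
  have Q: "Q = quot_complex D (\<lambda>n. \<Psi> n ` carrier (obj C n))"
    and \<pi>: "\<pi> = quot_proj D (\<lambda>n. \<Psi> n ` carrier (obj C n))"
    unfolding Q_def \<pi>_def D_def W by (rule refl)+
  interpret S: short_exact K C D Q \<Psi> \<pi>
    unfolding Q \<pi> by (rule F.short_exact_quotient(2)[OF injF])
  show ?thesis
    using F.short_exact_quotient(1)[OF injF] S.exact_middle S.exact_quotient S.exact_sub
    unfolding Q \<pi> by blast
qed

end
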